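(* Let $\mathcal{G}=(X,Y,A,B,\lambda)$ be a variable assignment game with $n$ variables and set of variable values $C$. Its game C*-algebra $C^*(\mathcal{G})$ is *-isomorphic to the universal unital C*-algebra generated by a family $\{e_{i,c}:i=1,\dots,n,\ c\in C\}$ of projections subject to the relations (a) $\sum_{c\in C}e_{i,c}=1$, $i=1,2,\dots,n$; (b) $e_{i,c}e_{j,d}=e_{j,d}e_{i,c}$ for all $c,d\in C$, whenever there exists $z\in X\cup Y$ such that $i,j\in V_z$; (c) the projections $\prod_{i\in V_x}e_{i,a_i}$ and $\prod_{j\in V_y}e_{j,b_j}$ are orthogonal whenever $x\in X$, $y\in Y$, $(a_i)_{i\in V_x}\in C^{V_x}$, $(b_j)_{j\in V_y}\in C^{V_y}$ and $\lambda(x,y,(a_i)_{i\in V_x},(b_j)_{j\in V_y})=0$.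
   Context: A non-signalling game is a tuple $(X,Y,A,B,\lambda)$ with $X,Y,A,B$ finite sets and $\lambda:X\times Y\times A\times B\to\{0,1\}$. Variable assignment game: let $C$ be a finite set of values for variables $v_1,\dots,v_n$, and let $X$, $Y$ be finite (disjoint) sets of questions. To each $z\in X\cup Y$ a subset $V_z\subseteq\{1,\dots,n\}$ is assigned, such that for every $i\in\{1,\dots,n\}$ there exist $x\in X$ and $y\in Y$ with $i\in V_x\cap V_y$. Both $A$ and $B$ are the set of all tuples $(c_i)_{i\in V}$ with $V\subseteq\{1,\dots,n\}$ and $c_i\in C$. A variable assignment game is a game $(X,Y,A,B,\lambda)$ such that, whenever $\lambda(x,y,(a_i)_{i\in V},(b_j)_{j\in W})=1$, one has $V=V_x$, $W=V_y$, and $a_i=b_i$ for every $i\in V_x\cap V_y$. The game C*-algebra $C^*(\mathcal{G})$ is the universal unital C*-algebra generated by projections $(p_{x,a})_{x\in X,a\in A}$ and $(q_{y,b})_{y\in Y,b\in B}$ satisfying: $\sum_{a\in A}p_{x,a}=1$ for every $x\in X$; $\sum_{b\in B}q_{y,b}=1$ for every $y\in Y$; and $p_{x,a}q_{y,b}=0$ whenever $\lambda(x,y,a,b)=0$. The zero C*-algebra $\{0\}$ is regarded as a unital C*-algebra. (Every variable assignment game is an imitation game, the class of games for which $C^*(\mathcal{G})$ is defined in the paper.) *)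

theory Defs
  imports "HOL-Analysis.Analysis" "HOL-Library.Poly_Mapping" "HOL-Algebra.Module"
begin

section \<open>Unital C*-algebras\<close>

record 'a cstar_alg = "(complex, 'a) module" +
  adj :: "'a \<Rightarrow> 'a"
  nrm :: "'a \<Rightarrow> real"

text \<open>As \<^locale>\<open>ring\<close> does not demand $1 \neq 0$, the zero algebra is included.\<close>

locale unital_cstar_algebra = ring A for A :: "('a, 'm) cstar_alg_scheme" (structure) +
  assumes smult_closed [simp, intro]: "x \<in> carrier A \<Longrightarrow> c \<odot> x \<in> carrier A"
    and smult_l_distr: "x \<in> carrier A \<Longrightarrow> (c + d) \<odot> x = c \<odot> x \<oplus> d \<odot> x"
    and smult_r_distr: "\<lbrakk>x \<in> carrier A; y \<in> carrier A\<rbrakk> \<Longrightarrow> c \<odot> (x \<oplus> y) = c \<odot> x \<oplus> c \<odot> y"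
    and smult_assoc: "x \<in> carrier A \<Longrightarrow> (c * d) \<odot> x = c \<odot> (d \<odot> x)"
    and smult_one [simp]: "x \<in> carrier A \<Longrightarrow> 1 \<odot> x = x"
    and smult_mult_left: "\<lbrakk>x \<in> carrier A; y \<in> carrier A\<rbrakk> \<Longrightarrow> (c \<odot> x) \<otimes> y = c \<odot> (x \<otimes> y)"
    and smult_mult_right: "\<lbrakk>x \<in> carrier A; y \<in> carrier A\<rbrakk> \<Longrightarrow> x \<otimes> (c \<odot> y) = c \<odot> (x \<otimes> y)"
    and adj_closed [simp, intro]: "x \<in> carrier A \<Longrightarrow> adj A x \<in> carrier A"
    and adj_adj [simp]: "x \<in> carrier A \<Longrightarrow> adj A (adj A x) = x"
    and adj_add: "\<lbrakk>x \<in> carrier A; y \<in> carrier A\<rbrakk> \<Longrightarrow> adj A (x \<oplus> y) = adj A x \<oplus> adj A y"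
    and adj_smult: "x \<in> carrier A \<Longrightarrow> adj A (c \<odot> x) = cnj c \<odot> adj A x"
    and adj_mult: "\<lbrakk>x \<in> carrier A; y \<in> carrier A\<rbrakk> \<Longrightarrow> adj A (x \<otimes> y) = adj A y \<otimes> adj A x"
    and nrm_nonneg: "x \<in> carrier A \<Longrightarrow> 0 \<le> nrm A x"
    and nrm_eq_0_iff: "x \<in> carrier A \<Longrightarrow> nrm A x = 0 \<longleftrightarrow> x = \<zero>"
    and nrm_triangle: "\<lbrakk>x \<in> carrier A; y \<in> carrier A\<rbrakk> \<Longrightarrow> nrm A (x \<oplus> y) \<le> nrm A x + nrm A y"
    and nrm_smult: "x \<in> carrier A \<Longrightarrow> nrm A (c \<odot> x) = cmod c * nrm A x"
    and nrm_mult: "\<lbrakk>x \<in> carrier A; y \<in> carrier A\<rbrakk> \<Longrightarrow> nrm A (x \<otimes> y) \<le> nrm A x * nrm A y"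
    and nrm_adj_mult: "x \<in> carrier A \<Longrightarrow> nrm A (adj A x \<otimes> x) = (nrm A x)\<^sup>2"
    and complete: "\<lbrakk>\<And>n. s n \<in> carrier A; \<And>e. e > 0 \<Longrightarrow> \<exists>N. \<forall>m \<ge> N. \<forall>n \<ge> N. nrm A (s m \<ominus> s n) < e\<rbrakk>
      \<Longrightarrow> \<exists>x \<in> carrier A. (\<lambda>n. nrm A (s n \<ominus> x)) \<longlonglongrightarrow> 0"

definition star_hom ::
  "('a, 'm) cstar_alg_scheme \<Rightarrow> ('b, 'n) cstar_alg_scheme \<Rightarrow> ('a \<Rightarrow> 'b) set" where
  "star_hom A B = {\<phi> \<in> ring_hom A B. \<forall>x \<in> carrier A.
     (\<forall>c. \<phi> (c \<odot>\<^bsub>A\<^esub> x) = c \<odot>\<^bsub>B\<^esub> \<phi> x) \<and> \<phi> (adj A x) = adj B (\<phi> x)}"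

definition star_isomorphic ::
  "('a, 'm) cstar_alg_scheme \<Rightarrow> ('b, 'n) cstar_alg_scheme \<Rightarrow> bool" (infix \<open>\<cong>\<^sub>*\<close> 50) where
  "A \<cong>\<^sub>* B \<longleftrightarrow> (\<exists>\<phi> \<in> star_hom A B. bij_betw \<phi> (carrier A) (carrier B))"


section \<open>Free unital *-algebras\<close>

text \<open>Words in the letters $g$ and $g^*$ form the free *-monoid; finitely supported complex
  functions on words, with the convolution product of \<^theory>\<open>HOL-Library.Poly_Mapping\<close>,
  are the noncommutative *-polynomials.\<close>

datatype 'g letter = Plain 'g | Star 'g

datatype 'g star_word = Word "'g letter list"

instantiation star_word :: (type) monoid_add
begin

definition zero_star_word :: "'a star_word" where
  "0 = Word []"

fun plus_star_word :: "'a star_word \<Rightarrow> 'a star_word \<Rightarrow> 'a star_word" where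
  "Word u + Word v = Word (u @ v)"

instance
proof
  fix a b c :: "'a star_word"
  show "a + b + c = a + (b + c)" by (cases a; cases b; cases c) simp
  show "0 + a = a" by (cases a) (simp add: zero_star_word_def)
  show "a + 0 = a" by (cases a) (simp add: zero_star_word_def)
qed

end

type_synonym 'g star_poly = "'g star_word \<Rightarrow>\<^sub>0 complex"

definition const :: "complex \<Rightarrow> 'g star_poly" where
  "const c = Poly_Mapping.single 0 c"

definition gen :: "'g \<Rightarrow> 'g star_poly" where
  "gen g = Poly_Mapping.single (Word [Plain g]) 1"

fun letter_base :: "'g letter \<Rightarrow> 'g" where
  "letter_base (Plain g) = g"
| "letter_base (Star g) = g"

fun letter_star :: "'g letter \<Rightarrow> 'g letter" where
  "letter_star (Plain g) = Star g"
| "letter_star (Star g) = Plain g"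

fun word_gens :: "'g star_word \<Rightarrow> 'g set" where
  "word_gens (Word w) = letter_base ` set w"

fun word_star :: "'g star_word \<Rightarrow> 'g star_word" where
  "word_star (Word w) = Word (rev (map letter_star w))"

definition poly_star :: "'g star_poly \<Rightarrow> 'g star_poly" where
  "poly_star f = Poly_Mapping.map_key word_star (Poly_Mapping.map cnj f)"

definition free_star_alg :: "'g set \<Rightarrow> 'g star_poly set" where
  "free_star_alg G = {f. \<forall>w \<in> Poly_Mapping.keys f. word_gens w \<subseteq> G}"


section \<open>Universal unital C*-algebras\<close>

definition cstar_seminorm :: "'g set \<Rightarrow> ('g star_poly \<Rightarrow> real) \<Rightarrow> bool" where
  "cstar_seminorm G p \<longleftrightarrow> (\<forall>f \<in> free_star_alg G. \<forall>g \<in> free_star_alg G.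
     0 \<le> p f \<and> p (f + g) \<le> p f + p g \<and> (\<forall>c. p (const c * f) = cmod c * p f) \<and>
     p (f * g) \<le> p f * p g \<and> p (poly_star f * f) = (p f)\<^sup>2)"

text \<open>A relation is the requirement that a *-polynomial in the generators vanish. The universal
  C*-algebra is the Hausdorff completion of the free *-algebra in the largest C*-seminorm
  vanishing on the relators. The supremum is meaningful only if it is finite everywhere, as it is
  when all generators are required to be projections.\<close>

definition universal_seminorm :: "'g set \<Rightarrow> 'g star_poly set \<Rightarrow> 'g star_poly \<Rightarrow> real" where
  "universal_seminorm G R f = Sup {p f | p. cstar_seminorm G p \<and> (\<forall>r \<in> R. p r = 0)}"

definition cauchy_seqs :: "'g set \<Rightarrow> ('g star_poly \<Rightarrow> real) \<Rightarrow> (nat \<Rightarrow> 'g star_poly) set" where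
  "cauchy_seqs G u = {s. range s \<subseteq> free_star_alg G \<and>
     (\<forall>e > 0. \<exists>N. \<forall>m \<ge> N. \<forall>n \<ge> N. u (s m - s n) < e)}"

definition seq_class ::
  "'g set \<Rightarrow> ('g star_poly \<Rightarrow> real) \<Rightarrow> (nat \<Rightarrow> 'g star_poly) \<Rightarrow> (nat \<Rightarrow> 'g star_poly) set" where
  "seq_class G u s = {t \<in> cauchy_seqs G u. (\<lambda>n. u (s n - t n)) \<longlonglongrightarrow> 0}"

definition seq_rep :: "(nat \<Rightarrow> 'g star_poly) set \<Rightarrow> nat \<Rightarrow> 'g star_poly" where
  "seq_rep S = (SOME s. s \<in> S)"

definition cstar_completion ::
  "'g set \<Rightarrow> ('g star_poly \<Rightarrow> real) \<Rightarrow> (nat \<Rightarrow> 'g star_poly) set cstar_alg" where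
  "cstar_completion G u =
    \<lparr>carrier = seq_class G u ` cauchy_seqs G u,
     mult = (\<lambda>S T. seq_class G u (\<lambda>n. seq_rep S n * seq_rep T n)),
     one = seq_class G u (\<lambda>n. 1),
     zero = seq_class G u (\<lambda>n. 0),
     add = (\<lambda>S T. seq_class G u (\<lambda>n. seq_rep S n + seq_rep T n)),
     smult = (\<lambda>c S. seq_class G u (\<lambda>n. const c * seq_rep S n)),
     adj = (\<lambda>S. seq_class G u (\<lambda>n. poly_star (seq_rep S n))),
     nrm = (\<lambda>S. lim (\<lambda>n. u (seq_rep S n)))\<rparr>"

definition universal_cstar ::
  "'g set \<Rightarrow> 'g star_poly set \<Rightarrow> (nat \<Rightarrow> 'g star_poly) set cstar_alg" where
  "universal_cstar G R = cstar_completion G (universal_seminorm G R)"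

definition projection_relators :: "'g set \<Rightarrow> 'g star_poly set" where
  "projection_relators G =
     {gen g * gen g - gen g | g. g \<in> G} \<union> {poly_star (gen g) - gen g | g. g \<in> G}"


section \<open>Games\<close>

text \<open>A game is given by its question sets \<open>X\<close>, \<open>Y\<close>, its answer sets \<open>A\<close>, \<open>B\<close> and the
  predicate \<open>lam x y a b\<close>, which stands for $\lambda(x,y,a,b) = 1$.\<close>

definition nonsignalling_game ::
  "'x set \<Rightarrow> 'y set \<Rightarrow> 'a set \<Rightarrow> 'b set \<Rightarrow> ('x \<Rightarrow> 'y \<Rightarrow> 'a \<Rightarrow> 'b \<Rightarrow> bool) \<Rightarrow> bool" where
  "nonsignalling_game X Y A B lam \<longleftrightarrow> finite X \<and> finite Y \<and> finite A \<and> finite B"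

datatype ('x, 'y, 'a, 'b) game_gen = PGen 'x 'a | QGen 'y 'b

definition game_gens :: "'x set \<Rightarrow> 'y set \<Rightarrow> 'a set \<Rightarrow> 'b set \<Rightarrow> ('x, 'y, 'a, 'b) game_gen set" where
  "game_gens X Y A B =
     {PGen x a | x a. x \<in> X \<and> a \<in> A} \<union> {QGen y b | y b. y \<in> Y \<and> b \<in> B}"

definition game_relators ::
  "'x set \<Rightarrow> 'y set \<Rightarrow> 'a set \<Rightarrow> 'b set \<Rightarrow> ('x \<Rightarrow> 'y \<Rightarrow> 'a \<Rightarrow> 'b \<Rightarrow> bool) \<Rightarrow>
    ('x, 'y, 'a, 'b) game_gen star_poly set" where
  "game_relators X Y A B lam =
     projection_relators (game_gens X Y A B) \<union>
     {(\<Sum>a\<in>A. gen (PGen x a)) - 1 | x. x \<in> X} \<union>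
     {(\<Sum>b\<in>B. gen (QGen y b)) - 1 | y. y \<in> Y} \<union>
     {gen (PGen x a) * gen (QGen y b) | x y a b.
        x \<in> X \<and> y \<in> Y \<and> a \<in> A \<and> b \<in> B \<and> \<not> lam x y a b}"

definition game_cstar ::
  "'x set \<Rightarrow> 'y set \<Rightarrow> 'a set \<Rightarrow> 'b set \<Rightarrow> ('x \<Rightarrow> 'y \<Rightarrow> 'a \<Rightarrow> 'b \<Rightarrow> bool) \<Rightarrow>
    (nat \<Rightarrow> ('x, 'y, 'a, 'b) game_gen star_poly) set cstar_alg" where
  "game_cstar X Y A B lam = universal_cstar (game_gens X Y A B) (game_relators X Y A B lam)"


section \<open>Variable assignment games\<close>

text \<open>A tuple $(c_i)_{i \in V}$ is the partial map with domain $V$ sending $i$ to $c_i$.\<close>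

definition tuples :: "nat \<Rightarrow> 'c set \<Rightarrow> (nat \<rightharpoonup> 'c) set" where
  "tuples n C = {a. dom a \<subseteq> {1..n} \<and> ran a \<subseteq> C}"

definition variable_assignment_game ::
  "nat \<Rightarrow> 'c set \<Rightarrow> ('q \<Rightarrow> nat set) \<Rightarrow> 'q set \<Rightarrow> 'q set \<Rightarrow> (nat \<rightharpoonup> 'c) set \<Rightarrow> (nat \<rightharpoonup> 'c) set \<Rightarrow>
    ('q \<Rightarrow> 'q \<Rightarrow> (nat \<rightharpoonup> 'c) \<Rightarrow> (nat \<rightharpoonup> 'c) \<Rightarrow> bool) \<Rightarrow> bool" where
  "variable_assignment_game n C V X Y A B lam \<longleftrightarrow>
     nonsignalling_game X Y A B lam \<and> finite C \<and> X \<inter> Y = {} \<and>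
     (\<forall>z \<in> X \<union> Y. V z \<subseteq> {1..n}) \<and>
     (\<forall>i \<in> {1..n}. \<exists>x \<in> X. \<exists>y \<in> Y. i \<in> V x \<inter> V y) \<and>
     A = tuples n C \<and> B = tuples n C \<and>
     (\<forall>x \<in> X. \<forall>y \<in> Y. \<forall>a \<in> A. \<forall>b \<in> B. lam x y a b \<longrightarrow>
        dom a = V x \<and> dom b = V y \<and> (\<forall>i \<in> V x \<inter> V y. a i = b i))"

definition assignment_gens :: "nat \<Rightarrow> 'c set \<Rightarrow> (nat \<times> 'c) set" where
  "assignment_gens n C = {1..n} \<times> C"

text \<open>The factors are multiplied in increasing order of $i$; the order is irrelevant modulo the
  commutation relators below.\<close>

definition assignment_prod :: "nat set \<Rightarrow> (nat \<rightharpoonup> 'c) \<Rightarrow> (nat \<times> 'c) star_poly" where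
  "assignment_prod W a = prod_list (map (\<lambda>i. gen (i, the (a i))) (sorted_list_of_set W))"

definition assignment_relators ::
  "nat \<Rightarrow> 'c set \<Rightarrow> ('q \<Rightarrow> nat set) \<Rightarrow> 'q set \<Rightarrow> 'q set \<Rightarrow>
    ('q \<Rightarrow> 'q \<Rightarrow> (nat \<rightharpoonup> 'c) \<Rightarrow> (nat \<rightharpoonup> 'c) \<Rightarrow> bool) \<Rightarrow> (nat \<times> 'c) star_poly set" where
  "assignment_relators n C V X Y lam =
     projection_relators (assignment_gens n C) \<union>
     {(\<Sum>c\<in>C. gen (i, c)) - 1 | i. i \<in> {1..n}} \<union>
     {gen (i, c) * gen (j, d) - gen (j, d) * gen (i, c) | i j c d.
        c \<in> C \<and> d \<in> C \<and> (\<exists>z \<in> X \<union> Y. i \<in> V z \<and> j \<in> V z)} \<union>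
     {assignment_prod (V x) a * assignment_prod (V y) b | x y a b.
        x \<in> X \<and> y \<in> Y \<and> dom a = V x \<and> ran a \<subseteq> C \<and> dom b = V y \<and> ran b \<subseteq> C \<and> \<not> lam x y a b}"


section \<open>The universal property\<close>

text \<open>The results from here on are not used in any definition above. They show that, for a
  presentation whose generators are projections, \<^const>\<open>universal_cstar\<close> is a unital
  C*-algebra generated by elements satisfying the relations, and that it maps to every unital
  C*-algebra, over an arbitrary type, containing elements that satisfy the relations.\<close>

lemma letter_star_star [simp]: "letter_star (letter_star l) = l"
  by (cases l) auto

lemma letter_base_star [simp]: "letter_base (letter_star l) = letter_base l"
  by (cases l) auto

lemma word_star_star [simp]: "word_star (word_star w) = w"
  by (cases w) (simp add: rev_map comp_def)

lemma inj_word_star [simp]: "inj word_star"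
  by (metis injI word_star_star)

lemma word_star_add: "word_star (v + w) = word_star w + word_star v"
  by (cases v; cases w) simp

lemma word_star_0 [simp]: "word_star 0 = 0"
  by (simp add: zero_star_word_def)

lemma word_gens_star [simp]: "word_gens (word_star w) = word_gens w"
  by (cases w) (simp add: image_image)

lemma word_gens_add [simp]: "word_gens (v + w) = word_gens v \<union> word_gens w"
  by (cases v; cases w) auto

lemma word_gens_0 [simp]: "word_gens 0 = {}"
  by (simp add: zero_star_word_def)

lemma lookup_poly_star: "Poly_Mapping.lookup (poly_star f) w = cnj (Poly_Mapping.lookup f (word_star w))"
  by (simp add: poly_star_def map_key.rep_eq Poly_Mapping.map.rep_eq when_def)

lemma poly_star_add: "poly_star (f + g) = poly_star f + poly_star g"
  by (rule poly_mapping_eqI) (simp add: lookup_poly_star lookup_add)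

lemma poly_star_0 [simp]: "poly_star 0 = 0"
  by (rule poly_mapping_eqI) (simp add: lookup_poly_star)

lemma poly_star_uminus: "poly_star (- f) = - poly_star f"
  by (rule poly_mapping_eqI) (simp add: lookup_poly_star)

lemma poly_star_diff: "poly_star (f - g) = poly_star f - poly_star g"
  by (rule poly_mapping_eqI) (simp add: lookup_poly_star lookup_minus)

lemma poly_star_star [simp]: "poly_star (poly_star f) = f"
  by (rule poly_mapping_eqI) (simp add: lookup_poly_star)

lemma poly_star_single:
  "poly_star (Poly_Mapping.single w c) = Poly_Mapping.single (word_star w) (cnj c)"
  by (rule poly_mapping_eqI) (auto simp: lookup_poly_star lookup_single when_def)

lemma poly_star_const: "poly_star (const c) = const (cnj c)"
  by (simp add: const_def poly_star_single)

lemma keys_poly_star: "Poly_Mapping.keys (poly_star f) = word_star ` Poly_Mapping.keys f"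
proof (intro Set.set_eqI)
  fix w
  have "w \<in> Poly_Mapping.keys (poly_star f) \<longleftrightarrow> word_star w \<in> Poly_Mapping.keys f"
    by (simp add: in_keys_iff lookup_poly_star)
  also have "\<dots> \<longleftrightarrow> w \<in> word_star ` Poly_Mapping.keys f"
    by (metis imageI image_iff word_star_star)
  finally show "w \<in> Poly_Mapping.keys (poly_star f) \<longleftrightarrow> w \<in> word_star ` Poly_Mapping.keys f" .
qed

lemma const_0 [simp]: "const 0 = 0" by (simp add: const_def)
lemma const_1 [simp]: "const 1 = 1" by (simp add: const_def)
lemma const_add: "const (c + d) = const c + const d" by (simp add: const_def single_add)
lemma const_mult: "const (c * d) = const c * const d" by (simp add: const_def mult_single)

lemma poly_decomp: "f = (\<Sum>w\<in>Poly_Mapping.keys f. Poly_Mapping.single w (Poly_Mapping.lookup f w))"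
proof (rule poly_mapping_eqI)
  fix k
  have "Poly_Mapping.lookup (\<Sum>w\<in>Poly_Mapping.keys f. Poly_Mapping.single w (Poly_Mapping.lookup f w)) k
    = (\<Sum>w\<in>Poly_Mapping.keys f. if w = k then Poly_Mapping.lookup f w else 0)"
    unfolding lookup_sum by (intro sum.cong) (auto simp: lookup_single when_def)
  also have "\<dots> = Poly_Mapping.lookup f k"
    by (subst sum.delta) (auto simp: in_keys_iff)
  finally show "Poly_Mapping.lookup f k = Poly_Mapping.lookup
      (\<Sum>w\<in>Poly_Mapping.keys f. Poly_Mapping.single w (Poly_Mapping.lookup f w)) k" ..
qed

lemma free_zero [simp, intro]: "0 \<in> free_star_alg G"
  by (simp add: free_star_alg_def)

lemma free_one [simp, intro]: "1 \<in> free_star_alg G"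
  by (simp add: free_star_alg_def)

lemma free_single: "word_gens w \<subseteq> G \<Longrightarrow> Poly_Mapping.single w c \<in> free_star_alg G"
  by (auto simp: free_star_alg_def)

lemma free_const [simp, intro]: "const c \<in> free_star_alg G"
  unfolding const_def by (rule free_single) simp

lemma free_gen [intro]: "g \<in> G \<Longrightarrow> gen g \<in> free_star_alg G"
  unfolding gen_def by (rule free_single) simp

lemma free_add [simp, intro]: "\<lbrakk>f \<in> free_star_alg G; g \<in> free_star_alg G\<rbrakk> \<Longrightarrow> f + g \<in> free_star_alg G"
  using Poly_Mapping.keys_add[of f g] by (auto simp: free_star_alg_def)

lemma free_uminus [simp, intro]: "f \<in> free_star_alg G \<Longrightarrow> - f \<in> free_star_alg G"
  by (auto simp: free_star_alg_def in_keys_iff)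

lemma free_diff [simp, intro]: "\<lbrakk>f \<in> free_star_alg G; g \<in> free_star_alg G\<rbrakk> \<Longrightarrow> f - g \<in> free_star_alg G"
  using free_add[of f G "- g"] by simp

lemma free_mult [simp, intro]: "\<lbrakk>f \<in> free_star_alg G; g \<in> free_star_alg G\<rbrakk> \<Longrightarrow> f * g \<in> free_star_alg G"
  using keys_mult[of f g] unfolding free_star_alg_def by fastforce

lemma free_star [simp, intro]: "f \<in> free_star_alg G \<Longrightarrow> poly_star f \<in> free_star_alg G"
  by (auto simp: free_star_alg_def keys_poly_star)

lemma free_sum [intro]: "(\<And>i. i \<in> I \<Longrightarrow> f i \<in> free_star_alg G) \<Longrightarrow> sum f I \<in> free_star_alg G"
  by (induction I rule: infinite_finite_induct) auto

lemma free_prod_list [intro]: "set fs \<subseteq> free_star_alg G \<Longrightarrow> prod_list fs \<in> free_star_alg G"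
  by (induction fs) auto

lemma free_induct [consumes 1, case_names zero single add]:
  assumes "f \<in> free_star_alg G" and "P 0"
    and "\<And>w c. word_gens w \<subseteq> G \<Longrightarrow> P (Poly_Mapping.single w c)"
    and "\<And>f g. \<lbrakk>f \<in> free_star_alg G; g \<in> free_star_alg G; P f; P g\<rbrakk> \<Longrightarrow> P (f + g)"
  shows "P f"
proof -
  have "P (\<Sum>w\<in>S. Poly_Mapping.single w (Poly_Mapping.lookup f w))"
    if "finite S" "S \<subseteq> Poly_Mapping.keys f" for S
    using that
  proof (induction S rule: finite_induct)
    case (insert w S)
    then have "word_gens w \<subseteq> G" "\<forall>v\<in>S. word_gens v \<subseteq> G"
      using assms(1) by (auto simp: free_star_alg_def)
    then show ?case
      using insert by (auto intro!: assms(3,4) free_single free_sum)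
  qed (use assms(2) in simp)
  from this[of "Poly_Mapping.keys f"] show ?thesis
    by (simp flip: poly_decomp)
qed

lemma free_UNIV [simp]: "f \<in> free_star_alg UNIV"
  by (simp add: free_star_alg_def)

lemma poly_star_mult: "poly_star (f * g) = poly_star g * poly_star f"
proof -
  have 1: "poly_star (Poly_Mapping.single w c * g) = poly_star g * poly_star (Poly_Mapping.single w c)" for w c
    using free_UNIV[of g]
    by (induction g rule: free_induct)
      (simp_all add: poly_star_add distrib_left distrib_right mult_single poly_star_single word_star_add mult.commute)
  show ?thesis
    using free_UNIV[of f]
    by (induction f rule: free_induct) (simp_all add: 1 poly_star_add distrib_left distrib_right)
qed

lemma poly_star_1 [simp]: "poly_star 1 = 1"
  using poly_star_const[of 1] by simp

lemma const_commute: "const c * f = f * const c"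
  using free_UNIV[of f]
  by (induction f rule: free_induct)
    (simp_all add: distrib_left distrib_right mult_single const_def mult.commute)

lemma const_single: "const c * Poly_Mapping.single w d = Poly_Mapping.single w (c * d)"
  by (simp add: const_def mult_single)

context
  fixes G :: "'g set" and p
  assumes p: "cstar_seminorm G p"
begin

lemma csn_nonneg: "f \<in> free_star_alg G \<Longrightarrow> 0 \<le> p f"
  using p unfolding cstar_seminorm_def by blast
lemma csn_add: "\<lbrakk>f \<in> free_star_alg G; g \<in> free_star_alg G\<rbrakk> \<Longrightarrow> p (f + g) \<le> p f + p g"
  using p unfolding cstar_seminorm_def by blast
lemma csn_mult: "\<lbrakk>f \<in> free_star_alg G; g \<in> free_star_alg G\<rbrakk> \<Longrightarrow> p (f * g) \<le> p f * p g"
  using p unfolding cstar_seminorm_def by blast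
lemma csn_const: "f \<in> free_star_alg G \<Longrightarrow> p (const c * f) = cmod c * p f"
  using p unfolding cstar_seminorm_def by blast
lemma csn_cstar: "f \<in> free_star_alg G \<Longrightarrow> p (poly_star f * f) = (p f)\<^sup>2"
  using p unfolding cstar_seminorm_def by blast

lemma csn_zero [simp]: "p 0 = 0"
  using csn_const[of 0 0] by simp

lemma csn_uminus: "f \<in> free_star_alg G \<Longrightarrow> p (- f) = p f"
proof -
  assume f: "f \<in> free_star_alg G"
  have "const (-1) = (- 1 :: 'g star_poly)"
    unfolding const_def by (metis single_one single_uminus)
  then show ?thesis using csn_const[OF f, of "-1"] by simp
qed

lemma csn_diff: "\<lbrakk>f \<in> free_star_alg G; g \<in> free_star_alg G\<rbrakk> \<Longrightarrow> p (f - g) \<le> p f + p g"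
  using csn_add[of f "-g"] csn_uminus[of g] by simp

lemma csn_minus_commute: "\<lbrakk>f \<in> free_star_alg G; g \<in> free_star_alg G\<rbrakk> \<Longrightarrow> p (f - g) = p (g - f)"
  using csn_uminus[of "f - g"] by simp

lemma csn_triangle: 
  "\<lbrakk>f \<in> free_star_alg G; g \<in> free_star_alg G; h \<in> free_star_alg G\<rbrakk> \<Longrightarrow> p (f - h) \<le> p (f - g) + p (g - h)"
  using csn_add[of "f - g" "g - h"] by simp

lemma csn_abs_diff: "\<lbrakk>f \<in> free_star_alg G; g \<in> free_star_alg G\<rbrakk> \<Longrightarrow> \<bar>p f - p g\<bar> \<le> p (f - g)"
  using csn_add[of "f - g" g] csn_add[of "g - f" f] csn_minus_commute[of f g] by simp

lemma csn_star: "f \<in> free_star_alg G \<Longrightarrow> p (poly_star f) = p f"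
proof -
  have *: "p f \<le> p (poly_star f)" if f: "f \<in> free_star_alg G" for f
  proof -
    have "p f * p f \<le> p (poly_star f) * p f"
      using csn_mult[of "poly_star f" f] csn_cstar[OF f] f by (simp add: power2_eq_square)
    then show ?thesis
      using csn_nonneg[OF f] csn_nonneg[of "poly_star f"] f by (cases "p f = 0") auto
  qed
  assume "f \<in> free_star_alg G"
  then show ?thesis using *[of f] *[of "poly_star f"] by simp
qed

lemma csn_single_bound:
  assumes "\<And>g. g \<in> G \<Longrightarrow> p (gen g) \<le> 1" "word_gens w \<subseteq> G" 
  shows "p (Poly_Mapping.single w c) \<le> cmod c"
proof -
  have one: "p 1 \<le> 1"
  proof -
    have "p 1 = p 1 * p 1" using csn_cstar[of 1] by (simp add: power2_eq_square)
    then show ?thesis by (metis mult_cancel_right1 order_refl zero_le_one)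
  qed
  have "p (Poly_Mapping.single (Word ls) 1) \<le> 1" if "letter_base ` set ls \<subseteq> G" for ls
    using that
  proof (induction ls)
    case Nil
    then show ?case using one by (simp flip: zero_star_word_def)
  next
    case (Cons l ls)
    have l: "Poly_Mapping.single (Word [l]) 1 \<in> free_star_alg G" (is "?l \<in> _")
      and ls: "Poly_Mapping.single (Word ls) 1 \<in> free_star_alg G" (is "?ls \<in> _")
      using Cons.prems by (auto intro!: free_single)
    have "p ?l \<le> 1"
    proof (cases l)
      case (Plain g)
      then show ?thesis using assms(1)[of g] Cons.prems by (simp add: gen_def)
    next
      case (Star g)
      then have "?l = poly_star (gen g)" by (simp add: gen_def poly_star_single)
      then show ?thesis using assms(1)[of g] Cons.prems Star csn_star[OF free_gen, of g] by simp
    qed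
    moreover have "Poly_Mapping.single (Word (l # ls)) 1 = ?l * ?ls"
      by (simp add: mult_single)
    ultimately show ?case
      using csn_mult[OF l ls] Cons csn_nonneg[OF l] csn_nonneg[OF ls] mult_le_one[of "p ?l" "p ?ls"] by simp
  qed
  moreover obtain ls where "w = Word ls" by (cases w)
  ultimately have "p (Poly_Mapping.single w 1) \<le> 1" using assms(2) by simp
  moreover have "Poly_Mapping.single w c = const c * Poly_Mapping.single w 1"
    by (simp add: const_single)
  ultimately show ?thesis
    using csn_const[OF free_single[OF assms(2)], of c 1] by (simp add: mult_left_le)
qed

lemma csn_projection:
  assumes "\<forall>r \<in> projection_relators G. p r = 0" "g \<in> G"
  shows "p (gen g) \<le> 1"
proof -
  let ?g = "gen g"
  have g: "?g \<in> free_star_alg G" using assms(2) by auto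
  have 1: "p (?g * ?g - ?g) = 0" "p (poly_star ?g - ?g) = 0"
    using assms by (auto simp: projection_relators_def)
  have "p ((poly_star ?g - ?g) * ?g) \<le> 0"
    using csn_mult[of "poly_star ?g - ?g" ?g] g 1 by simp
  then have "p (poly_star ?g * ?g - ?g * ?g) = 0"
    using csn_nonneg[of "poly_star ?g * ?g - ?g * ?g"] g by (simp add: left_diff_distrib)
  then have "p (poly_star ?g * ?g - ?g) \<le> 0"
    using csn_triangle[of "poly_star ?g * ?g" "?g * ?g" ?g] g 1 by simp
  then have "(p ?g)\<^sup>2 = p ?g"
    using csn_abs_diff[of "poly_star ?g * ?g" ?g] g csn_cstar[OF g] by simp
  then show ?thesis by (auto simp: power2_eq_square)
qed

end

lemma zero_csn: "cstar_seminorm G (\<lambda>_. 0)"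
  by (simp add: cstar_seminorm_def)

lemma universal_seminorm_aux:
  assumes "projection_relators G \<subseteq> R" "f \<in> free_star_alg G"
  shows "bdd_above {p f | p. cstar_seminorm G p \<and> (\<forall>r \<in> R. p r = 0)}"
proof -
  have "\<exists>M. \<forall>p. cstar_seminorm G p \<and> (\<forall>r \<in> R. p r = 0) \<longrightarrow> p f \<le> M"
    using assms(2)
  proof (induction f rule: free_induct)
    case zero
    then show ?case by (metis csn_zero order_refl)
  next
    case (single w c)
    have "p (Poly_Mapping.single w c) \<le> cmod c" if "cstar_seminorm G p" "\<forall>r \<in> R. p r = 0" for p
      using csn_single_bound[OF that(1) csn_projection[OF that(1)] single] that assms(1) by auto
    then show ?case by blast
  next
    case (add f g)
    then obtain M N where MN: "\<And>p. cstar_seminorm G p \<and> (\<forall>r \<in> R. p r = 0) \<Longrightarrow> p f \<le> M"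
      "\<And>p. cstar_seminorm G p \<and> (\<forall>r \<in> R. p r = 0) \<Longrightarrow> p g \<le> N" by metis
    have "p (f + g) \<le> M + N" if "cstar_seminorm G p \<and> (\<forall>r \<in> R. p r = 0)" for p
      using MN[OF that] csn_add[of G p f g] that add.hyps by linarith
    then show ?case by blast
  qed
  then show ?thesis by (auto simp: bdd_above_def)
qed

lemma universal_seminorm_upper:
  assumes "projection_relators G \<subseteq> R" "cstar_seminorm G p" "\<forall>r \<in> R. p r = 0" "f \<in> free_star_alg G"
  shows "p f \<le> universal_seminorm G R f"
  unfolding universal_seminorm_def
  using assms by (intro cSup_upper universal_seminorm_aux) auto

lemma universal_seminorm_least:
  assumes "\<And>p. \<lbrakk>cstar_seminorm G p; \<forall>r \<in> R. p r = 0\<rbrakk> \<Longrightarrow> p f \<le> M"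
  shows "universal_seminorm G R f \<le> M"
  unfolding universal_seminorm_def
proof (rule cSup_least)
  show "{p f | p. cstar_seminorm G p \<and> (\<forall>r \<in> R. p r = 0)} \<noteq> {}"
    using zero_csn[of G] by fastforce
qed (use assms in auto)

lemma universal_seminorm_csn:
  assumes R: "projection_relators G \<subseteq> R"
  shows "cstar_seminorm G (universal_seminorm G R)" (is "cstar_seminorm G ?u")
  unfolding cstar_seminorm_def
proof (intro ballI conjI allI)
  note up = universal_seminorm_upper[OF R]
  fix f g :: "'a star_poly" and c
  assume f: "f \<in> free_star_alg G" and g: "g \<in> free_star_alg G"
  show nn: "0 \<le> ?u f"
    using up[OF zero_csn _ f] by simp
  have nn': "0 \<le> ?u g" 
    using up[OF zero_csn _ g] by simp
  show "?u (f + g) \<le> ?u f + ?u g"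
  proof (rule universal_seminorm_least)
    fix p assume p: "cstar_seminorm G p" "\<forall>r \<in> R. p r = 0"
    show "p (f + g) \<le> ?u f + ?u g"
      using up[OF p f] up[OF p g] csn_add[OF p(1) f g] by simp
  qed
  show "?u (f * g) \<le> ?u f * ?u g"
  proof (rule universal_seminorm_least)
    fix p assume p: "cstar_seminorm G p" "\<forall>r \<in> R. p r = 0"
    have "p f * p g \<le> ?u f * ?u g"
      using up[OF p f] up[OF p g] csn_nonneg[OF p(1) f] csn_nonneg[OF p(1) g] nn by (intro mult_mono) auto
    then show "p (f * g) \<le> ?u f * ?u g"
      using csn_mult[OF p(1) f g] by simp
  qed
  show "?u (const c * f) = cmod c * ?u f"
  proof (rule antisym)
    show "?u (const c * f) \<le> cmod c * ?u f"
    proof (rule universal_seminorm_least)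
      fix p assume p: "cstar_seminorm G p" "\<forall>r \<in> R. p r = 0"
      show "p (const c * f) \<le> cmod c * ?u f"
        using up[OF p f] csn_const[OF p(1) f] by (simp add: mult_left_mono)
    qed
    show "cmod c * ?u f \<le> ?u (const c * f)"
    proof (cases "c = 0")
      case True
      then show ?thesis using up[OF zero_csn, of "0 :: 'a star_poly"] by simp
    next
      case False
      have "?u f \<le> ?u (const c * f) / cmod c"
      proof (rule universal_seminorm_least)
        fix p assume p: "cstar_seminorm G p" "\<forall>r \<in> R. p r = 0"
        show "p f \<le> ?u (const c * f) / cmod c"
          using up[OF p, of "const c * f"] csn_const[OF p(1) f, of c] f False
          by (simp add: field_simps)
      qed
      then show ?thesis using False by (simp add: field_simps)
    qed
  qed
  show "?u (poly_star f * f) = (?u f)\<^sup>2"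
  proof (rule antisym)
    show "?u (poly_star f * f) \<le> (?u f)\<^sup>2"
    proof (rule universal_seminorm_least)
      fix p assume p: "cstar_seminorm G p" "\<forall>r \<in> R. p r = 0"
      show "p (poly_star f * f) \<le> (?u f)\<^sup>2"
        using up[OF p f] csn_cstar[OF p(1) f] csn_nonneg[OF p(1) f] by (simp add: power_mono)
    qed
    have "?u f \<le> sqrt (?u (poly_star f * f))"
    proof (rule universal_seminorm_least)
      fix p assume p: "cstar_seminorm G p" "\<forall>r \<in> R. p r = 0"
      show "p f \<le> sqrt (?u (poly_star f * f))"
        using up[OF p, of "poly_star f * f"] csn_cstar[OF p(1) f] f by (simp add: real_le_rsqrt)
    qed
    moreover have "0 \<le> ?u (poly_star f * f)"
      using up[OF zero_csn, of "poly_star f * f"] f by simp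
    ultimately show "(?u f)\<^sup>2 \<le> ?u (poly_star f * f)"
      using nn by (metis power_mono real_sqrt_pow2)
  qed
qed

lemma universal_seminorm_relator:
  assumes "projection_relators G \<subseteq> R" "r \<in> R" "r \<in> free_star_alg G"
  shows "universal_seminorm G R r = 0"
  using csn_nonneg[OF universal_seminorm_csn[OF assms(1)] assms(3)] 
    universal_seminorm_least[of G R r 0] assms(2) by fastforce

lemma null_squeeze:
  assumes "\<And>n. 0 \<le> (f n :: real)" "\<And>n. f n \<le> g n" "g \<longlonglongrightarrow> 0"
  shows "f \<longlonglongrightarrow> 0"
  by (rule tendsto_sandwich[OF _ _ tendsto_const assms(3)]) (use assms in auto)

context
  fixes G :: "'g set" and u
  assumes u: "cstar_seminorm G u"
begin

lemma cauchy_in_free: "s \<in> cauchy_seqs G u \<Longrightarrow> s n \<in> free_star_alg G"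
  by (auto simp: cauchy_seqs_def)

lemma cauchy_seqsI:
  "\<lbrakk>\<And>n. s n \<in> free_star_alg G; \<And>e. e > 0 \<Longrightarrow> \<exists>N. \<forall>m \<ge> N. \<forall>n \<ge> N. u (s m - s n) < e\<rbrakk>
    \<Longrightarrow> s \<in> cauchy_seqs G u"
  by (auto simp: cauchy_seqs_def)

lemma cauchy_seqsD:
  "\<lbrakk>s \<in> cauchy_seqs G u; e > 0\<rbrakk> \<Longrightarrow> \<exists>N. \<forall>m \<ge> N. \<forall>n \<ge> N. u (s m - s n) < e"
  by (auto simp: cauchy_seqs_def)

lemma cauchy_lipschitz:
  assumes s: "s \<in> cauchy_seqs G u" and t: "\<And>n. t n \<in> free_star_alg G"
    and L: "\<And>m n. u (t m - t n) \<le> L * u (s m - s n)"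
  shows "t \<in> cauchy_seqs G u"
proof (rule cauchy_seqsI[OF t])
  fix e :: real assume "e > 0"
  then obtain N where N: "\<And>m n. \<lbrakk>m \<ge> N; n \<ge> N\<rbrakk> \<Longrightarrow> u (s m - s n) < e / (\<bar>L\<bar> + 1)"
    using cauchy_seqsD[OF s, of "e / (\<bar>L\<bar> + 1)"] by auto
  have "u (t m - t n) < e" if "m \<ge> N" "n \<ge> N" for m n
  proof -
    have "0 \<le> u (s m - s n)" by (intro csn_nonneg[OF u] free_diff cauchy_in_free[OF s])
    then have "u (t m - t n) \<le> (\<bar>L\<bar> + 1) * u (s m - s n)"
      by (intro order_trans[OF L] mult_right_mono) auto
    also have "\<dots> < e" using N[OF that] by (simp add: field_simps)
    finally show ?thesis .
  qed
  then show "\<exists>N. \<forall>m \<ge> N. \<forall>n \<ge> N. u (t m - t n) < e" by blast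
qed

lemma cauchy_const: "f \<in> free_star_alg G \<Longrightarrow> (\<lambda>n. f) \<in> cauchy_seqs G u"
  by (intro cauchy_seqsI) (auto simp: csn_zero[OF u])

lemma cauchy_add:
  assumes s: "s \<in> cauchy_seqs G u" and t: "t \<in> cauchy_seqs G u"
  shows "(\<lambda>n. s n + t n) \<in> cauchy_seqs G u"
proof (rule cauchy_seqsI)
  fix e :: real assume "e > 0"
  then have "e / 2 > 0" by simp
  obtain M where M: "\<And>m n. \<lbrakk>m \<ge> M; n \<ge> M\<rbrakk> \<Longrightarrow> u (s m - s n) < e / 2"
    using cauchy_seqsD[OF s \<open>e / 2 > 0\<close>] by blast
  obtain N where N: "\<And>m n. \<lbrakk>m \<ge> N; n \<ge> N\<rbrakk> \<Longrightarrow> u (t m - t n) < e / 2"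
    using cauchy_seqsD[OF t \<open>e / 2 > 0\<close>] by blast
  have "u (s m + t m - (s n + t n)) < e" if "m \<ge> max M N" "n \<ge> max M N" for m n
  proof -
    have "u ((s m - s n) + (t m - t n)) \<le> u (s m - s n) + u (t m - t n)"
      by (intro csn_add[OF u] free_diff cauchy_in_free[OF s] cauchy_in_free[OF t])
    also have "\<dots> < e" using M[of m n] N[of m n] that by simp
    finally show ?thesis by (simp add: algebra_simps)
  qed
  then show "\<exists>N. \<forall>m \<ge> N. \<forall>n \<ge> N. u (s m + t m - (s n + t n)) < e" by blast
qed (auto intro: cauchy_in_free[OF s] cauchy_in_free[OF t])

lemma cauchy_scale:
  assumes s: "s \<in> cauchy_seqs G u"
  shows "(\<lambda>n. const c * s n) \<in> cauchy_seqs G u"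
proof (rule cauchy_lipschitz[OF s])
  show "u (const c * s m - const c * s n) \<le> cmod c * u (s m - s n)" for m n
    using csn_const[OF u, of "s m - s n" c] by (simp add: right_diff_distrib cauchy_in_free[OF s])
qed (auto intro: cauchy_in_free[OF s])

lemma cauchy_star:
  assumes s: "s \<in> cauchy_seqs G u"
  shows "(\<lambda>n. poly_star (s n)) \<in> cauchy_seqs G u"
proof (rule cauchy_lipschitz[OF s])
  show "u (poly_star (s m) - poly_star (s n)) \<le> 1 * u (s m - s n)" for m n
    using csn_star[OF u, of "s m - s n"] by (simp add: poly_star_diff cauchy_in_free[OF s])
qed (auto intro: cauchy_in_free[OF s])

lemma cauchy_norm: "s \<in> cauchy_seqs G u \<Longrightarrow> convergent (\<lambda>n. u (s n))"
proof -
  assume s: "s \<in> cauchy_seqs G u"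
  have "Cauchy (\<lambda>n. u (s n))"
  proof (rule metric_CauchyI)
    fix e :: real assume "e > 0"
    then obtain N where N: "\<And>m n. \<lbrakk>m \<ge> N; n \<ge> N\<rbrakk> \<Longrightarrow> u (s m - s n) < e"
      using cauchy_seqsD[OF s, of e] by auto
    have "dist (u (s m)) (u (s n)) < e" if "m \<ge> N" "n \<ge> N" for m n
      using csn_abs_diff[OF u cauchy_in_free[OF s] cauchy_in_free[OF s], of m n] N[OF that] by (simp add: dist_real_def)
    then show "\<exists>M. \<forall>m\<ge>M. \<forall>n\<ge>M. dist (u (s m)) (u (s n)) < e" by blast
  qed
  then show ?thesis by (simp add: real_Cauchy_convergent)
qed

lemma cauchy_bounded: "s \<in> cauchy_seqs G u \<Longrightarrow> \<exists>M>0. \<forall>n. u (s n) \<le> M"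
proof -
  assume "s \<in> cauchy_seqs G u"
  from convergent_imp_Bseq[OF cauchy_norm[OF this]] 
  obtain M where "M > 0" "\<And>n. norm (u (s n)) \<le> M" by (auto simp: Bseq_def)
  then show ?thesis by (auto intro!: exI[of _ M] simp: abs_le_iff)
qed

lemma cauchy_mult:
  assumes s: "s \<in> cauchy_seqs G u" and t: "t \<in> cauchy_seqs G u"
  shows "(\<lambda>n. s n * t n) \<in> cauchy_seqs G u"
proof (rule cauchy_seqsI)
  note [intro] = cauchy_in_free[OF s] cauchy_in_free[OF t]
  obtain K L where KL: "K > 0" "\<And>n. u (s n) \<le> K" "L > 0" "\<And>n. u (t n) \<le> L"
    using cauchy_bounded[OF s] cauchy_bounded[OF t] by auto
  fix e :: real assume e: "e > 0"
  then have eL: "e / (2 * L) > 0" "e / (2 * K) > 0" using KL by auto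
  obtain M where M: "\<And>m n. \<lbrakk>m \<ge> M; n \<ge> M\<rbrakk> \<Longrightarrow> u (s m - s n) < e / (2 * L)"
    using cauchy_seqsD[OF s eL(1)] by blast
  obtain N where N: "\<And>m n. \<lbrakk>m \<ge> N; n \<ge> N\<rbrakk> \<Longrightarrow> u (t m - t n) < e / (2 * K)"
    using cauchy_seqsD[OF t eL(2)] by blast
  have "u (s m * t m - s n * t n) < e" if "m \<ge> max M N" "n \<ge> max M N" for m n
  proof -
    have "u (s m * (t m - t n) + (s m - s n) * t n) \<le> u (s m) * u (t m - t n) + u (s m - s n) * u (t n)"
      by (rule order_trans[OF csn_add[OF u]]) (auto intro!: add_mono csn_mult[OF u])
    also have "u (s m) * u (t m - t n) \<le> K * u (t m - t n)"
      using KL by (intro mult_right_mono csn_nonneg[OF u]) auto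
    also have "K * u (t m - t n) < e / 2"
      using N[of m n] that KL by (simp add: field_simps)
    also have "u (s m - s n) * u (t n) \<le> u (s m - s n) * L"
      using KL by (intro mult_left_mono csn_nonneg[OF u]) auto
    also have "u (s m - s n) * L < e / 2"
      using M[of m n] that KL by (simp add: field_simps)
    finally show ?thesis by (simp add: algebra_simps)
  qed
  then show "\<exists>N. \<forall>m \<ge> N. \<forall>n \<ge> N. u (s m * t m - s n * t n) < e" by blast
qed (auto intro: cauchy_in_free[OF s] cauchy_in_free[OF t])

lemma cauchy_diff_null:
  assumes s: "s \<in> cauchy_seqs G u" and t: "t \<in> cauchy_seqs G u" and "(\<lambda>n. u (s n - t n)) \<longlonglongrightarrow> 0"
  shows "seq_class G u s = seq_class G u t"
proof -
  have *: "(\<lambda>n. u (b n - x n)) \<longlonglongrightarrow> 0"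
    if b: "a \<in> cauchy_seqs G u" "b \<in> cauchy_seqs G u" "x \<in> cauchy_seqs G u"
      and ab: "(\<lambda>n. u (a n - b n)) \<longlonglongrightarrow> 0" and ax: "(\<lambda>n. u (a n - x n)) \<longlonglongrightarrow> 0" for a b x
  proof (rule tendsto_sandwich[OF _ _ tendsto_const])
    show "\<forall>\<^sub>F n in sequentially. 0 \<le> u (b n - x n)"
      by (intro always_eventually allI csn_nonneg[OF u] free_diff cauchy_in_free[OF b(2)] cauchy_in_free[OF b(3)])
    show "\<forall>\<^sub>F n in sequentially. u (b n - x n) \<le> u (a n - b n) + u (a n - x n)"
      using csn_triangle[OF u cauchy_in_free[OF b(2)] cauchy_in_free[OF b(1)] cauchy_in_free[OF b(3)]]
        csn_minus_commute[OF u cauchy_in_free[OF b(1)] cauchy_in_free[OF b(2)]] by simp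
    show "(\<lambda>n. u (a n - b n) + u (a n - x n)) \<longlonglongrightarrow> 0"
      using tendsto_add[OF ab ax] by simp
  qed
  have ts: "(\<lambda>n. u (t n - s n)) \<longlonglongrightarrow> 0"
    using assms(3) csn_minus_commute[OF u cauchy_in_free[OF s] cauchy_in_free[OF t]] by simp
  show ?thesis
    unfolding seq_class_def
  proof (intro Collect_cong conj_cong refl iffI)
    fix x assume x: "x \<in> cauchy_seqs G u"
    show "(\<lambda>n. u (t n - x n)) \<longlonglongrightarrow> 0" if "(\<lambda>n. u (s n - x n)) \<longlonglongrightarrow> 0"
      by (rule *[OF s t x assms(3) that])
    show "(\<lambda>n. u (s n - x n)) \<longlonglongrightarrow> 0" if "(\<lambda>n. u (t n - x n)) \<longlonglongrightarrow> 0"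
      by (rule *[OF t s x ts that])
  qed
qed

lemma seq_class_self: "s \<in> cauchy_seqs G u \<Longrightarrow> s \<in> seq_class G u s"
  by (simp add: seq_class_def csn_zero[OF u])

lemma in_seq_class_iff:
  "t \<in> seq_class G u s \<longleftrightarrow> t \<in> cauchy_seqs G u \<and> (\<lambda>n. u (s n - t n)) \<longlonglongrightarrow> 0"
  by (simp add: seq_class_def)

lemma seq_class_eq_iff:
  assumes s: "s \<in> cauchy_seqs G u" and t: "t \<in> cauchy_seqs G u"
  shows "seq_class G u s = seq_class G u t \<longleftrightarrow> (\<lambda>n. u (s n - t n)) \<longlonglongrightarrow> 0"
proof
  assume "seq_class G u s = seq_class G u t"
  then have "t \<in> seq_class G u s" using seq_class_self[OF t] by simp
  then show "(\<lambda>n. u (s n - t n)) \<longlonglongrightarrow> 0" unfolding in_seq_class_iff by blast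
qed (rule cauchy_diff_null[OF s t])

lemma seq_rep_in:
  assumes "s \<in> cauchy_seqs G u"
  shows "seq_rep (seq_class G u s) \<in> seq_class G u s"
  unfolding seq_rep_def some_in_eq using seq_class_self[OF assms] by blast

lemma seq_rep:
  assumes "s \<in> cauchy_seqs G u"
  shows "seq_rep (seq_class G u s) \<in> cauchy_seqs G u"
    and "(\<lambda>n. u (s n - seq_rep (seq_class G u s) n)) \<longlonglongrightarrow> 0"
  using seq_rep_in[OF assms] unfolding in_seq_class_iff by blast+

lemma completion_carrier: "carrier (cstar_completion G u) = seq_class G u ` cauchy_seqs G u"
  by (simp add: cstar_completion_def)

lemma completion_one: "\<one>\<^bsub>cstar_completion G u\<^esub> = seq_class G u (\<lambda>n. 1)"
  by (simp add: cstar_completion_def)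

lemma completion_zero: "\<zero>\<^bsub>cstar_completion G u\<^esub> = seq_class G u (\<lambda>n. 0)"
  by (simp add: cstar_completion_def)

lemma completion_add:
  assumes s: "s \<in> cauchy_seqs G u" and t: "t \<in> cauchy_seqs G u"
  shows "seq_class G u s \<oplus>\<^bsub>cstar_completion G u\<^esub> seq_class G u t = seq_class G u (\<lambda>n. s n + t n)"
proof -
  let ?s = "seq_rep (seq_class G u s)" and ?t = "seq_rep (seq_class G u t)"
  note [intro] = cauchy_in_free[OF s] cauchy_in_free[OF t]
    cauchy_in_free[OF seq_rep(1)[OF s]] cauchy_in_free[OF seq_rep(1)[OF t]]
  have "(\<lambda>n. u ((s n + t n) - (?s n + ?t n))) \<longlonglongrightarrow> 0"
  proof (rule null_squeeze)
    show "(\<lambda>n. u (s n - ?s n) + u (t n - ?t n)) \<longlonglongrightarrow> 0"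
      using tendsto_add[OF seq_rep(2)[OF s] seq_rep(2)[OF t]] by simp
    show "u ((s n + t n) - (?s n + ?t n)) \<le> u (s n - ?s n) + u (t n - ?t n)" for n
      using csn_add[OF u, of "s n - ?s n" "t n - ?t n"] by (auto simp: algebra_simps)
    show "0 \<le> u ((s n + t n) - (?s n + ?t n))" for n
      by (intro csn_nonneg[OF u]) auto
  qed
  then have "seq_class G u (\<lambda>n. s n + t n) = seq_class G u (\<lambda>n. ?s n + ?t n)"
    by (intro cauchy_diff_null cauchy_add s t seq_rep)
  then show ?thesis by (simp add: cstar_completion_def)
qed

lemma completion_mult:
  assumes s: "s \<in> cauchy_seqs G u" and t: "t \<in> cauchy_seqs G u"
  shows "seq_class G u s \<otimes>\<^bsub>cstar_completion G u\<^esub> seq_class G u t = seq_class G u (\<lambda>n. s n * t n)"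
proof -
  let ?s = "seq_rep (seq_class G u s)" and ?t = "seq_rep (seq_class G u t)"
  note [intro] = cauchy_in_free[OF s] cauchy_in_free[OF t]
    cauchy_in_free[OF seq_rep(1)[OF s]] cauchy_in_free[OF seq_rep(1)[OF t]]
  obtain K L where KL: "K > 0" "\<And>n. u (s n) \<le> K" "L > 0" "\<And>n. u (?t n) \<le> L"
    using cauchy_bounded[OF s] cauchy_bounded[OF seq_rep(1)[OF t]] by auto
  have "(\<lambda>n. u (s n * t n - ?s n * ?t n)) \<longlonglongrightarrow> 0"
  proof (rule null_squeeze)
    show "(\<lambda>n. K * u (t n - ?t n) + u (s n - ?s n) * L) \<longlonglongrightarrow> 0"
      using tendsto_add[OF tendsto_mult_left[OF seq_rep(2)[OF t], of K]
          tendsto_mult_right[OF seq_rep(2)[OF s], of L]] by simp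
    show "u (s n * t n - ?s n * ?t n) \<le> K * u (t n - ?t n) + u (s n - ?s n) * L" for n
    proof -
      have "u (s n * (t n - ?t n) + (s n - ?s n) * ?t n)
          \<le> u (s n) * u (t n - ?t n) + u (s n - ?s n) * u (?t n)"
        by (rule order_trans[OF csn_add[OF u]]) (auto intro!: add_mono csn_mult[OF u])
      also have "\<dots> \<le> K * u (t n - ?t n) + u (s n - ?s n) * L"
        using KL by (intro add_mono mult_right_mono mult_left_mono csn_nonneg[OF u]) auto
      finally show ?thesis by (simp add: algebra_simps)
    qed
    show "0 \<le> u (s n * t n - ?s n * ?t n)" for n
      by (intro csn_nonneg[OF u]) auto
  qed
  then have "seq_class G u (\<lambda>n. s n * t n) = seq_class G u (\<lambda>n. ?s n * ?t n)"
    by (intro cauchy_diff_null cauchy_mult s t seq_rep)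
  then show ?thesis by (simp add: cstar_completion_def)
qed

lemma completion_smult:
  assumes s: "s \<in> cauchy_seqs G u"
  shows "c \<odot>\<^bsub>cstar_completion G u\<^esub> seq_class G u s = seq_class G u (\<lambda>n. const c * s n)"
proof -
  let ?s = "seq_rep (seq_class G u s)"
  have "u (const c * s n - const c * ?s n) = cmod c * u (s n - ?s n)" for n
    using csn_const[OF u, of "s n - ?s n" c] cauchy_in_free[OF s] cauchy_in_free[OF seq_rep(1)[OF s]]
    by (simp add: right_diff_distrib)
  then have "(\<lambda>n. u (const c * s n - const c * ?s n)) \<longlonglongrightarrow> 0"
    using tendsto_mult_left[OF seq_rep(2)[OF s], of "cmod c"] by simp
  then have "seq_class G u (\<lambda>n. const c * s n) = seq_class G u (\<lambda>n. const c * ?s n)"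
    by (intro cauchy_diff_null cauchy_scale s seq_rep)
  then show ?thesis by (simp add: cstar_completion_def)
qed

lemma completion_adj:
  assumes s: "s \<in> cauchy_seqs G u"
  shows "adj (cstar_completion G u) (seq_class G u s) = seq_class G u (\<lambda>n. poly_star (s n))"
proof -
  let ?s = "seq_rep (seq_class G u s)"
  have "u (poly_star (s n) - poly_star (?s n)) = u (s n - ?s n)" for n
    using csn_star[OF u, of "s n - ?s n"] cauchy_in_free[OF s] cauchy_in_free[OF seq_rep(1)[OF s]]
    by (simp add: poly_star_diff)
  then have "(\<lambda>n. u (poly_star (s n) - poly_star (?s n))) \<longlonglongrightarrow> 0"
    using seq_rep(2)[OF s] by simp
  then have "seq_class G u (\<lambda>n. poly_star (s n)) = seq_class G u (\<lambda>n. poly_star (?s n))"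
    by (intro cauchy_diff_null cauchy_star s seq_rep)
  then show ?thesis by (simp add: cstar_completion_def)
qed

lemma completion_nrm:
  assumes s: "s \<in> cauchy_seqs G u"
  shows "(\<lambda>n. u (s n)) \<longlonglongrightarrow> nrm (cstar_completion G u) (seq_class G u s)"
proof -
  let ?s = "seq_rep (seq_class G u s)"
  have l: "(\<lambda>n. u (?s n)) \<longlonglongrightarrow> nrm (cstar_completion G u) (seq_class G u s)"
    using cauchy_norm[OF seq_rep(1)[OF s]] by (simp add: cstar_completion_def convergent_LIMSEQ_iff)
  have "(\<lambda>n. u (s n) - u (?s n)) \<longlonglongrightarrow> 0"
  proof (rule tendsto_rabs_zero_cancel, rule null_squeeze[OF _ _ seq_rep(2)[OF s]])
    show "\<bar>u (s n) - u (?s n)\<bar> \<le> u (s n - ?s n)" for n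
      by (intro csn_abs_diff[OF u] cauchy_in_free[OF s] cauchy_in_free[OF seq_rep(1)[OF s]])
  qed auto
  from tendsto_add[OF this l] show ?thesis by simp
qed

lemma completion_nrm_eq:
  assumes "s \<in> cauchy_seqs G u" "(\<lambda>n. u (s n)) \<longlonglongrightarrow> l"
  shows "nrm (cstar_completion G u) (seq_class G u s) = l"
  using LIMSEQ_unique[OF completion_nrm[OF assms(1)] assms(2)] .

lemma completion_cases:
  assumes "S \<in> carrier (cstar_completion G u)"
  obtains s where "s \<in> cauchy_seqs G u" "S = seq_class G u s"
  using assms by (auto simp: completion_carrier)

lemma completion_in: "s \<in> cauchy_seqs G u \<Longrightarrow> seq_class G u s \<in> carrier (cstar_completion G u)"
  by (simp add: completion_carrier)

lemmas cauchy_intros = cauchy_const[OF free_zero] cauchy_const[OF free_one] cauchy_add cauchy_mult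
  cauchy_scale cauchy_star
lemmas completion_ops = completion_add completion_mult completion_one completion_zero
  completion_smult completion_adj

lemma completion_ring: "ring (cstar_completion G u)" (is "ring ?C")
proof (rule ringI)
  show "abelian_group ?C"
  proof (rule abelian_groupI)
    fix S T assume S: "S \<in> carrier ?C" "T \<in> carrier ?C"
    then show "S \<oplus>\<^bsub>?C\<^esub> T \<in> carrier ?C" "S \<oplus>\<^bsub>?C\<^esub> T = T \<oplus>\<^bsub>?C\<^esub> S"
      by (auto elim!: completion_cases simp: completion_ops cauchy_intros completion_in add.commute)
  next
    fix S T U assume S: "S \<in> carrier ?C" "T \<in> carrier ?C" "U \<in> carrier ?C"
    then show "S \<oplus>\<^bsub>?C\<^esub> T \<oplus>\<^bsub>?C\<^esub> U = S \<oplus>\<^bsub>?C\<^esub> (T \<oplus>\<^bsub>?C\<^esub> U)"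
      by (auto elim!: completion_cases simp: completion_ops cauchy_intros completion_in add.assoc)
  next
    show "\<zero>\<^bsub>?C\<^esub> \<in> carrier ?C" by (simp add: completion_ops cauchy_intros completion_in)
  next
    fix S assume S: "S \<in> carrier ?C"
    then show "\<zero>\<^bsub>?C\<^esub> \<oplus>\<^bsub>?C\<^esub> S = S"
      by (auto elim!: completion_cases simp: completion_ops cauchy_intros)
    obtain s where s: "s \<in> cauchy_seqs G u" "S = seq_class G u s" using S by (rule completion_cases)
    have m1: "const (-1) = (- 1 :: 'g star_poly)"
      unfolding const_def by (metis single_one single_uminus)
    have "seq_class G u (\<lambda>n. const (-1) * s n) \<oplus>\<^bsub>?C\<^esub> S = \<zero>\<^bsub>?C\<^esub>"
      using s cauchy_scale[OF s(1), of "-1"] by (simp add: completion_ops m1)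
    then show "\<exists>T\<in>carrier ?C. T \<oplus>\<^bsub>?C\<^esub> S = \<zero>\<^bsub>?C\<^esub>"
      using completion_in[OF cauchy_scale[OF s(1)]] by blast
  qed
  show "monoid ?C"
  proof (rule monoidI)
    fix S T U assume S: "S \<in> carrier ?C" "T \<in> carrier ?C" "U \<in> carrier ?C"
    then show "S \<otimes>\<^bsub>?C\<^esub> T \<otimes>\<^bsub>?C\<^esub> U = S \<otimes>\<^bsub>?C\<^esub> (T \<otimes>\<^bsub>?C\<^esub> U)"
      by (auto elim!: completion_cases simp: completion_ops cauchy_intros completion_in mult.assoc)
  qed (auto elim!: completion_cases simp: completion_ops cauchy_intros completion_in)
  fix S T U assume S: "S \<in> carrier ?C" "T \<in> carrier ?C" "U \<in> carrier ?C"
  then show "(S \<oplus>\<^bsub>?C\<^esub> T) \<otimes>\<^bsub>?C\<^esub> U = S \<otimes>\<^bsub>?C\<^esub> U \<oplus>\<^bsub>?C\<^esub> T \<otimes>\<^bsub>?C\<^esub> U"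
    "U \<otimes>\<^bsub>?C\<^esub> (S \<oplus>\<^bsub>?C\<^esub> T) = U \<otimes>\<^bsub>?C\<^esub> S \<oplus>\<^bsub>?C\<^esub> U \<otimes>\<^bsub>?C\<^esub> T"
    by (auto elim!: completion_cases simp: completion_ops cauchy_intros completion_in
        distrib_left distrib_right)
qed

lemma completion_uminus:
  assumes s: "s \<in> cauchy_seqs G u"
  shows "\<ominus>\<^bsub>cstar_completion G u\<^esub> seq_class G u s = seq_class G u (\<lambda>n. - s n)"
    and "(\<lambda>n. - s n) \<in> cauchy_seqs G u"
proof -
  interpret ring "cstar_completion G u" by (rule completion_ring)
  have m1: "const (-1) = (- 1 :: 'g star_poly)"
    unfolding const_def by (metis single_one single_uminus)
  show m: "(\<lambda>n. - s n) \<in> cauchy_seqs G u"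
    using cauchy_scale[OF s, of "-1"] by (simp add: m1)
  have "seq_class G u (\<lambda>n. - s n) \<oplus>\<^bsub>cstar_completion G u\<^esub> seq_class G u s = \<zero>\<^bsub>cstar_completion G u\<^esub>"
    using s m by (simp add: completion_ops)
  then show "\<ominus>\<^bsub>cstar_completion G u\<^esub> seq_class G u s = seq_class G u (\<lambda>n. - s n)"
    using minus_equality[OF _ completion_in[OF s] completion_in[OF m]] by simp
qed

lemma completion_minus:
  assumes s: "s \<in> cauchy_seqs G u" and t: "t \<in> cauchy_seqs G u"
  shows "seq_class G u s \<ominus>\<^bsub>cstar_completion G u\<^esub> seq_class G u t = seq_class G u (\<lambda>n. s n - t n)"
    and "(\<lambda>n. s n - t n) \<in> cauchy_seqs G u"
  using completion_add[OF s completion_uminus(2)[OF t]] completion_uminus[OF t]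
    cauchy_add[OF s completion_uminus(2)[OF t]]
  by (simp_all add: a_minus_def)

lemma completion_nrm_const:
  "f \<in> free_star_alg G \<Longrightarrow> nrm (cstar_completion G u) (seq_class G u (\<lambda>n. f)) = u f"
  by (rule completion_nrm_eq[OF cauchy_const]) auto

lemma completion_dense:
  assumes S: "S \<in> carrier (cstar_completion G u)" and "e > 0"
  shows "\<exists>f \<in> free_star_alg G. nrm (cstar_completion G u) (S \<ominus>\<^bsub>cstar_completion G u\<^esub> seq_class G u (\<lambda>n. f)) < e"
proof -
  obtain s where s: "s \<in> cauchy_seqs G u" "S = seq_class G u s" using S by (rule completion_cases)
  obtain N where N: "\<And>m n. \<lbrakk>m \<ge> N; n \<ge> N\<rbrakk> \<Longrightarrow> u (s m - s n) < e / 2"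
    using cauchy_seqsD[OF s(1), of "e / 2"] \<open>e > 0\<close> by auto
  note c = completion_minus[OF s(1) cauchy_const[OF cauchy_in_free[OF s(1)], of N]]
  have "nrm (cstar_completion G u) (S \<ominus>\<^bsub>cstar_completion G u\<^esub> seq_class G u (\<lambda>n. s N)) \<le> e / 2"
    unfolding s(2) c(1) using N
    by (intro LIMSEQ_le_const2[OF completion_nrm[OF c(2)]]) (auto intro!: exI[of _ N] less_imp_le)
  then show ?thesis using \<open>e > 0\<close> cauchy_in_free[OF s(1), of N] by (intro bexI[of _ "s N"]) auto
qed

end

context
  fixes G :: "'g set" and u
  assumes u: "cstar_seminorm G u"
begin

lemma completion_dist_triangle:
  assumes S: "S \<in> carrier (cstar_completion G u)" "T \<in> carrier (cstar_completion G u)" "U \<in> carrier (cstar_completion G u)"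
  shows "nrm (cstar_completion G u) (S \<ominus>\<^bsub>cstar_completion G u\<^esub> U)
    \<le> nrm (cstar_completion G u) (S \<ominus>\<^bsub>cstar_completion G u\<^esub> T) + nrm (cstar_completion G u) (T \<ominus>\<^bsub>cstar_completion G u\<^esub> U)"
    and "nrm (cstar_completion G u) (S \<ominus>\<^bsub>cstar_completion G u\<^esub> T) = nrm (cstar_completion G u) (T \<ominus>\<^bsub>cstar_completion G u\<^esub> S)"
proof -
  obtain s where s: "s \<in> cauchy_seqs G u" "S = seq_class G u s" using S(1) by (rule completion_cases[OF u])
  obtain t where t: "t \<in> cauchy_seqs G u" "T = seq_class G u t" using S(2) by (rule completion_cases[OF u])
  obtain v where v: "v \<in> cauchy_seqs G u" "U = seq_class G u v" using S(3) by (rule completion_cases[OF u])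
  note mem = cauchy_in_free[OF u s(1)] cauchy_in_free[OF u t(1)] cauchy_in_free[OF u v(1)]
  note st = completion_minus[OF u s(1) t(1)] and tv = completion_minus[OF u t(1) v(1)]
    and sv = completion_minus[OF u s(1) v(1)] and ts = completion_minus[OF u t(1) s(1)]
  show "nrm (cstar_completion G u) (S \<ominus>\<^bsub>cstar_completion G u\<^esub> U)
    \<le> nrm (cstar_completion G u) (S \<ominus>\<^bsub>cstar_completion G u\<^esub> T) + nrm (cstar_completion G u) (T \<ominus>\<^bsub>cstar_completion G u\<^esub> U)"
    unfolding s(2) t(2) v(2) st(1) tv(1) sv(1)
    by (rule LIMSEQ_le[OF completion_nrm[OF u sv(2)] tendsto_add[OF completion_nrm[OF u st(2)] completion_nrm[OF u tv(2)]]])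
      (use csn_triangle[OF u mem] in blast)
  have "(\<lambda>n. u (t n - s n)) \<longlonglongrightarrow> nrm (cstar_completion G u) (seq_class G u (\<lambda>n. s n - t n))"
    using completion_nrm[OF u st(2)] csn_minus_commute[OF u mem(1) mem(2)] by simp
  then show "nrm (cstar_completion G u) (S \<ominus>\<^bsub>cstar_completion G u\<^esub> T) = nrm (cstar_completion G u) (T \<ominus>\<^bsub>cstar_completion G u\<^esub> S)"
    unfolding s(2) t(2) st(1) ts(1) using completion_nrm_eq[OF u ts(2)] by simp
qed

lemma completion_complete:
  assumes S: "\<And>n. S n \<in> carrier (cstar_completion G u)"
    and C: "\<And>e. e > 0 \<Longrightarrow> \<exists>N. \<forall>m \<ge> N. \<forall>n \<ge> N. nrm (cstar_completion G u) (S m \<ominus>\<^bsub>cstar_completion G u\<^esub> S n) < e"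
  shows "\<exists>X \<in> carrier (cstar_completion G u). (\<lambda>n. nrm (cstar_completion G u) (S n \<ominus>\<^bsub>cstar_completion G u\<^esub> X)) \<longlonglongrightarrow> 0"
proof -
  let ?C = "cstar_completion G u"
  let ?c = "\<lambda>f. seq_class G u (\<lambda>n. f)"
  have "\<forall>k. \<exists>f. f \<in> free_star_alg G \<and> nrm ?C (S k \<ominus>\<^bsub>?C\<^esub> ?c f) < inverse (real (Suc k))"
    using completion_dense[OF u S, of "inverse (real (Suc _))"] by simp blast
  then obtain f where f: "\<And>k. f k \<in> free_star_alg G" 
    and fk: "\<And>k. nrm ?C (S k \<ominus>\<^bsub>?C\<^esub> ?c (f k)) < inverse (real (Suc k))" by metis
  have cf: "?c (f k) \<in> carrier ?C" for k
    by (intro completion_in[OF u] cauchy_const[OF u] f)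
  have ff: "nrm ?C (?c (f j) \<ominus>\<^bsub>?C\<^esub> ?c (f k)) = u (f j - f k)" for j k
    using completion_minus(1)[OF u cauchy_const[OF u f[of j]] cauchy_const[OF u f[of k]]]
      completion_nrm_const[OF u free_diff[OF f[of j] f[of k]]] by simp
  have fc: "f \<in> cauchy_seqs G u"
  proof (rule cauchy_seqsI[OF u f])
    fix e :: real assume "e > 0"
    then have e3: "e / 3 > 0" by simp
    obtain M where M: "\<And>m n. \<lbrakk>m \<ge> M; n \<ge> M\<rbrakk> \<Longrightarrow> nrm ?C (S m \<ominus>\<^bsub>?C\<^esub> S n) < e / 3"
      using C[OF e3] by blast
    obtain K where K: "inverse (real (Suc K)) < e / 3"
      using reals_Archimedean[OF e3] by blast
    have small: "inverse (real (Suc m)) < e / 3" if "m \<ge> K" for m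
    proof -
      have "inverse (real (Suc m)) \<le> inverse (real (Suc K))" using that by simp
      then show ?thesis using K by linarith
    qed
    have "u (f m - f n) < e" if "m \<ge> max M K" "n \<ge> max M K" for m n
    proof -
      have "u (f m - f n) \<le> nrm ?C (?c (f m) \<ominus>\<^bsub>?C\<^esub> S m) + nrm ?C (S m \<ominus>\<^bsub>?C\<^esub> ?c (f n))"
        unfolding ff[symmetric] by (rule completion_dist_triangle(1)[OF cf S cf])
      moreover have "nrm ?C (S m \<ominus>\<^bsub>?C\<^esub> ?c (f n)) \<le> nrm ?C (S m \<ominus>\<^bsub>?C\<^esub> S n) + nrm ?C (S n \<ominus>\<^bsub>?C\<^esub> ?c (f n))"
        by (rule completion_dist_triangle(1)[OF S S cf])
      moreover have "nrm ?C (?c (f m) \<ominus>\<^bsub>?C\<^esub> S m) = nrm ?C (S m \<ominus>\<^bsub>?C\<^esub> ?c (f m))"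
        by (rule completion_dist_triangle(2)[OF cf S S])
      ultimately show ?thesis
        using fk[of m] fk[of n] small[of m] small[of n] M[of m n] that by linarith
    qed
    then show "\<exists>N. \<forall>m \<ge> N. \<forall>n \<ge> N. u (f m - f n) < e" by blast
  qed
  let ?X = "seq_class G u f"
  have X: "?X \<in> carrier ?C" by (rule completion_in[OF u fc])
  have "(\<lambda>n. nrm ?C (S n \<ominus>\<^bsub>?C\<^esub> ?X)) \<longlonglongrightarrow> 0"
  proof (rule LIMSEQ_I)
    fix e :: real assume "e > 0"
    then have e3: "e / 3 > 0" by simp
    obtain M where M: "\<And>m n. \<lbrakk>m \<ge> M; n \<ge> M\<rbrakk> \<Longrightarrow> u (f m - f n) < e / 3"
      using cauchy_seqsD[OF u fc e3] by blast
    obtain K where K: "inverse (real (Suc K)) < e / 3"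
      using reals_Archimedean[OF e3] by blast
    have "norm (nrm ?C (S n \<ominus>\<^bsub>?C\<^esub> ?X) - 0) < e" if n: "n \<ge> max M K" for n
    proof -
      note m = completion_minus[OF u cauchy_const[OF u f[of n]] fc]
      note m' = completion_minus[OF u _ fc]
      have "nrm ?C (?c (f n) \<ominus>\<^bsub>?C\<^esub> ?X) \<le> e / 3"
        unfolding m(1)
      proof (rule LIMSEQ_le_const2[OF completion_nrm[OF u m(2)]], intro exI allI impI)
        show "u (f n - f k) \<le> e / 3" if "k \<ge> M" for k using M[of n k] that n by simp
      qed
      moreover have "nrm ?C (S n \<ominus>\<^bsub>?C\<^esub> ?X) \<le> nrm ?C (S n \<ominus>\<^bsub>?C\<^esub> ?c (f n)) + nrm ?C (?c (f n) \<ominus>\<^bsub>?C\<^esub> ?X)"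
        by (rule completion_dist_triangle(1)[OF S cf X])
      moreover have "inverse (real (Suc n)) < e / 3"
      proof -
        have "inverse (real (Suc n)) \<le> inverse (real (Suc K))" using n by simp
        then show ?thesis using K by linarith
      qed
      moreover have "0 \<le> nrm ?C (S n \<ominus>\<^bsub>?C\<^esub> ?X)"
      proof -
        obtain s where s: "s \<in> cauchy_seqs G u" "S n = seq_class G u s" using S by (rule completion_cases[OF u])
        note m = completion_minus[OF u s(1) fc]
        show ?thesis unfolding s(2) m(1)
          by (rule LIMSEQ_le_const[OF completion_nrm[OF u m(2)]])
            (use csn_nonneg[OF u cauchy_in_free[OF u m(2)]] in blast)
      qed
      ultimately show ?thesis using fk[of n] \<open>e > 0\<close> by simp
    qed
    then show "\<exists>N. \<forall>n\<ge>N. norm (nrm ?C (S n \<ominus>\<^bsub>?C\<^esub> ?X) - 0) < e" by blast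
  qed
  then show ?thesis using X by blast
qed

theorem completion_cstar_algebra: "unital_cstar_algebra (cstar_completion G u)"
    (is "unital_cstar_algebra ?C")
proof -
  note ops = completion_ops[OF u] and ints = cauchy_intros[OF u] completion_in[OF u]
  note cases = completion_cases[OF u]
  show ?thesis
  proof (intro unital_cstar_algebra.intro unital_cstar_algebra_axioms.intro completion_ring[OF u])
    fix S T c d assume S: "S \<in> carrier ?C"
    then obtain s where s: "s \<in> cauchy_seqs G u" "S = seq_class G u s" by (rule cases)
    note ss = cauchy_in_free[OF u s(1)]
    show "c \<odot>\<^bsub>?C\<^esub> S \<in> carrier ?C" "adj ?C S \<in> carrier ?C" "adj ?C (adj ?C S) = S"
      "(c + d) \<odot>\<^bsub>?C\<^esub> S = c \<odot>\<^bsub>?C\<^esub> S \<oplus>\<^bsub>?C\<^esub> d \<odot>\<^bsub>?C\<^esub> S"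
      "(c * d) \<odot>\<^bsub>?C\<^esub> S = c \<odot>\<^bsub>?C\<^esub> (d \<odot>\<^bsub>?C\<^esub> S)" "1 \<odot>\<^bsub>?C\<^esub> S = S"
      "adj ?C (c \<odot>\<^bsub>?C\<^esub> S) = cnj c \<odot>\<^bsub>?C\<^esub> adj ?C S"
      using s by (simp_all add: ops ints const_add const_mult distrib_right mult.assoc poly_star_mult poly_star_const
          const_commute[of "cnj c"])
    show "0 \<le> nrm ?C S"
      unfolding s(2) by (rule LIMSEQ_le_const[OF completion_nrm[OF u s(1)]]) (use csn_nonneg[OF u ss] in blast)
    show "nrm ?C S = 0 \<longleftrightarrow> S = \<zero>\<^bsub>?C\<^esub>"
    proof -
      have "S = \<zero>\<^bsub>?C\<^esub> \<longleftrightarrow> (\<lambda>n. u (s n)) \<longlonglongrightarrow> 0"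
        using seq_class_eq_iff[OF u s(1) cauchy_const[OF u free_zero]] by (simp add: s(2) ops)
      then show ?thesis
        using completion_nrm[OF u s(1)] completion_nrm_eq[OF u s(1)] unfolding s(2) by metis
    qed
    show "nrm ?C (c \<odot>\<^bsub>?C\<^esub> S) = cmod c * nrm ?C S"
    proof -
      have "(\<lambda>n. u (const c * s n)) \<longlonglongrightarrow> cmod c * nrm ?C S"
        using tendsto_mult_left[OF completion_nrm[OF u s(1)], of "cmod c"] csn_const[OF u ss] by (simp add: s(2))
      from completion_nrm_eq[OF u cauchy_scale[OF u s(1)] this] show ?thesis
        unfolding s(2) completion_smult[OF u s(1)] .
    qed
    show "nrm ?C (adj ?C S \<otimes>\<^bsub>?C\<^esub> S) = (nrm ?C S)\<^sup>2"
    proof -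
      have "(\<lambda>n. u (poly_star (s n) * s n)) \<longlonglongrightarrow> (nrm ?C S)\<^sup>2"
        using tendsto_power[OF completion_nrm[OF u s(1)], of 2] csn_cstar[OF u ss] by (simp add: s(2))
      from completion_nrm_eq[OF u cauchy_mult[OF u cauchy_star[OF u s(1)] s(1)] this] show ?thesis
        unfolding s(2) completion_adj[OF u s(1)] completion_mult[OF u cauchy_star[OF u s(1)] s(1)] .
    qed
    assume T: "T \<in> carrier ?C"
    then obtain t where t: "t \<in> cauchy_seqs G u" "T = seq_class G u t" by (rule cases)
    note tt = cauchy_in_free[OF u t(1)]
    show "c \<odot>\<^bsub>?C\<^esub> (S \<oplus>\<^bsub>?C\<^esub> T) = c \<odot>\<^bsub>?C\<^esub> S \<oplus>\<^bsub>?C\<^esub> c \<odot>\<^bsub>?C\<^esub> T"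
      "(c \<odot>\<^bsub>?C\<^esub> S) \<otimes>\<^bsub>?C\<^esub> T = c \<odot>\<^bsub>?C\<^esub> (S \<otimes>\<^bsub>?C\<^esub> T)"
      "adj ?C (S \<oplus>\<^bsub>?C\<^esub> T) = adj ?C S \<oplus>\<^bsub>?C\<^esub> adj ?C T"
      "adj ?C (S \<otimes>\<^bsub>?C\<^esub> T) = adj ?C T \<otimes>\<^bsub>?C\<^esub> adj ?C S"
      using s t by (simp_all add: ops ints distrib_left mult.assoc poly_star_mult poly_star_add)
    have "s n * (const c * t n) = const c * (s n * t n)" for n
      by (metis const_commute mult.assoc)
    then show "S \<otimes>\<^bsub>?C\<^esub> (c \<odot>\<^bsub>?C\<^esub> T) = c \<odot>\<^bsub>?C\<^esub> (S \<otimes>\<^bsub>?C\<^esub> T)"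
      using s t by (simp add: ops ints)
    show "nrm ?C (S \<oplus>\<^bsub>?C\<^esub> T) \<le> nrm ?C S + nrm ?C T"
      unfolding s(2) t(2) completion_add[OF u s(1) t(1)]
      by (rule LIMSEQ_le[OF completion_nrm[OF u cauchy_add[OF u s(1) t(1)]]
            tendsto_add[OF completion_nrm[OF u s(1)] completion_nrm[OF u t(1)]]])
        (use csn_add[OF u ss tt] in blast)
    show "nrm ?C (S \<otimes>\<^bsub>?C\<^esub> T) \<le> nrm ?C S * nrm ?C T"
      unfolding s(2) t(2) completion_mult[OF u s(1) t(1)]
      by (rule LIMSEQ_le[OF completion_nrm[OF u cauchy_mult[OF u s(1) t(1)]]
            tendsto_mult[OF completion_nrm[OF u s(1)] completion_nrm[OF u t(1)]]])
        (use csn_mult[OF u ss tt] in blast)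
  next
    fix S :: "nat \<Rightarrow> (nat \<Rightarrow> 'g star_poly) set"
    assume "\<And>n. S n \<in> carrier ?C"
      "\<And>e. e > 0 \<Longrightarrow> \<exists>N. \<forall>m \<ge> N. \<forall>n \<ge> N. nrm ?C (S m \<ominus>\<^bsub>?C\<^esub> S n) < e"
    then show "\<exists>X \<in> carrier ?C. (\<lambda>n. nrm ?C (S n \<ominus>\<^bsub>?C\<^esub> X)) \<longlonglongrightarrow> 0"
      by (rule completion_complete)
  qed
qed

end

fun eval_letter :: "('a, 'm) cstar_alg_scheme \<Rightarrow> ('g \<Rightarrow> 'a) \<Rightarrow> 'g letter \<Rightarrow> 'a" where
  "eval_letter D v (Plain g) = v g"
| "eval_letter D v (Star g) = adj D (v g)"

fun eval_word :: "('a, 'm) cstar_alg_scheme \<Rightarrow> ('g \<Rightarrow> 'a) \<Rightarrow> 'g star_word \<Rightarrow> 'a" where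
  "eval_word D v (Word ls) = foldr (\<lambda>l x. eval_letter D v l \<otimes>\<^bsub>D\<^esub> x) ls \<one>\<^bsub>D\<^esub>"

definition eval_poly :: "('a, 'm) cstar_alg_scheme \<Rightarrow> ('g \<Rightarrow> 'a) \<Rightarrow> 'g star_poly \<Rightarrow> 'a" where
  "eval_poly D v f =
     (\<Oplus>\<^bsub>D\<^esub>w \<in> Poly_Mapping.keys f. Poly_Mapping.lookup f w \<odot>\<^bsub>D\<^esub> eval_word D v w)"

context unital_cstar_algebra
begin

lemma smult_zero_left [simp]: "x \<in> carrier A \<Longrightarrow> 0 \<odot> x = \<zero>"
  using smult_l_distr[of x 0 0] by (simp add: local.add.r_cancel_one')

lemma smult_zero_right [simp]: "c \<odot> \<zero> = \<zero>"
  using smult_r_distr[of \<zero> \<zero> c] by (simp add: local.add.r_cancel_one')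

lemma adj_zero [simp]: "adj A \<zero> = \<zero>"
  using adj_add[of \<zero> \<zero>] by (simp add: local.add.r_cancel_one')

lemma adj_one [simp]: "adj A \<one> = \<one>"
  using adj_mult[of \<one> "adj A \<one>"] by simp

lemma smult_uminus: "x \<in> carrier A \<Longrightarrow> (-1) \<odot> x = \<ominus> x"
  using smult_l_distr[of x "-1" 1] by (metis add.left_inverse minus_equality smult_closed smult_one smult_zero_left)

lemma nrm_zero [simp]: "nrm A \<zero> = 0"
  using nrm_eq_0_iff[of \<zero>] by simp

lemma nrm_uminus: "x \<in> carrier A \<Longrightarrow> nrm A (\<ominus> x) = nrm A x"
  using nrm_smult[of x "-1"] smult_uminus[of x] by simp

lemma nrm_adj: 
  assumes "x \<in> carrier A"
  shows "nrm A (adj A x) = nrm A x"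
proof -
  have *: "nrm A x \<le> nrm A (adj A x)" if x: "x \<in> carrier A" for x
  proof -
    have "nrm A x * nrm A x \<le> nrm A (adj A x) * nrm A x"
      using nrm_mult[of "adj A x" x] nrm_adj_mult[OF x] x by (simp add: power2_eq_square)
    then show ?thesis
      using nrm_nonneg[OF x] nrm_nonneg[of "adj A x"] x by (cases "nrm A x = 0") auto
  qed
  then show ?thesis using *[of x] *[of "adj A x"] assms by fastforce
qed

lemma eval_letter_closed: "v (letter_base l) \<in> carrier A \<Longrightarrow> eval_letter A v l \<in> carrier A"
  by (cases l) auto

lemma eval_word_list_closed:
  "(\<And>g. g \<in> letter_base ` set ls \<Longrightarrow> v g \<in> carrier A) \<Longrightarrow> eval_word A v (Word ls) \<in> carrier A"
  by (induction ls) (auto intro!: m_closed eval_letter_closed)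

lemma eval_word_closed: "(\<And>g. g \<in> word_gens w \<Longrightarrow> v g \<in> carrier A) \<Longrightarrow> eval_word A v w \<in> carrier A"
  using eval_word_list_closed by (cases w) auto

end

locale cstar_evaluation = unital_cstar_algebra A for A :: "('a, 'm) cstar_alg_scheme" (structure) +
  fixes G :: "'g set" and v :: "'g \<Rightarrow> 'a"
  assumes v: "g \<in> G \<Longrightarrow> v g \<in> carrier A"
begin

lemma word_closed: "word_gens w \<subseteq> G \<Longrightarrow> eval_word A v w \<in> carrier A"
  using v by (intro eval_word_closed) auto

lemma eval_word_append:
  assumes "word_gens w \<subseteq> G" "word_gens x \<subseteq> G"
  shows "eval_word A v (w + x) = eval_word A v w \<otimes> eval_word A v x"
proof -
  have "eval_word A v (Word (k @ l)) = eval_word A v (Word k) \<otimes> eval_word A v (Word l)"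
    if "word_gens (Word k) \<subseteq> G" "word_gens (Word l) \<subseteq> G" for k l
    using that(1)
  proof (induction k)
    case Nil
    then show ?case using word_closed[OF that(2)] by simp
  next
    case (Cons a k)
    then have "eval_letter A v a \<in> carrier A" "eval_word A v (Word k) \<in> carrier A" "eval_word A v (Word l) \<in> carrier A"
      using word_closed[of "Word k"] word_closed[OF that(2)] v by (auto intro!: eval_letter_closed simp del: eval_word.simps)
    with Cons show ?case by (simp add: m_assoc)
  qed
  then show ?thesis using assms by (cases w; cases x) (auto simp del: eval_word.simps)
qed

lemma eval_word_star:
  assumes "word_gens w \<subseteq> G"
  shows "eval_word A v (word_star w) = adj A (eval_word A v w)"
proof -
  have "eval_word A v (word_star (Word l)) = adj A (eval_word A v (Word l))" if "word_gens (Word l) \<subseteq> G" for l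
    using that
  proof (induction l)
    case (Cons a l)
    have a: "eval_letter A v a \<in> carrier A" using Cons.prems v by (intro eval_letter_closed) auto
    have sa: "eval_letter A v (letter_star a) = adj A (eval_letter A v a)"
      using Cons.prems v by (cases a) auto
    have l: "eval_word A v (Word l) \<in> carrier A"
      using Cons.prems by (intro word_closed) auto
    have "word_star (Word (a # l)) = word_star (Word l) + Word [letter_star a]" by simp
    then have "eval_word A v (word_star (Word (a # l))) = eval_word A v (word_star (Word l)) \<otimes> eval_word A v (Word [letter_star a])"
      using Cons.prems word_gens_star[of "Word l"] eval_word_append[of "word_star (Word l)" "Word [letter_star a]"] by auto
    also have "\<dots> = adj A (eval_word A v (Word l)) \<otimes> adj A (eval_letter A v a)"
      using Cons a sa by auto
    also have "\<dots> = adj A (eval_word A v (Word (a # l)))"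
      using a l by (simp add: adj_mult)
    finally show ?case .
  qed simp
  then show ?thesis using assms by (cases w) blast
qed

lemma term_closed: "word_gens w \<subseteq> G \<Longrightarrow> c \<odot> eval_word A v w \<in> carrier A"
  using word_closed by blast

lemma eval_superset:
  assumes "finite W" "Poly_Mapping.keys f \<subseteq> W" "\<And>w. w \<in> W \<Longrightarrow> word_gens w \<subseteq> G"
  shows "eval_poly A v f = (\<Oplus>w \<in> W. Poly_Mapping.lookup f w \<odot> eval_word A v w)"
  unfolding eval_poly_def
proof (rule add.finprod_mono_neutral_cong_left[OF assms(1,2)])
  show "\<And>i. i \<in> W - Poly_Mapping.keys f \<Longrightarrow> Poly_Mapping.lookup f i \<odot> eval_word A v i = \<zero>"
    using assms(3) word_closed by (auto simp: in_keys_iff)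
  show "(\<lambda>w. Poly_Mapping.lookup f w \<odot> eval_word A v w) \<in> W \<rightarrow> carrier A"
    using assms(3) term_closed by blast
qed auto

lemma eval_closed: "f \<in> free_star_alg G \<Longrightarrow> eval_poly A v f \<in> carrier A"
  unfolding eval_poly_def free_star_alg_def by (intro finsum_closed Pi_I term_closed) auto

lemma eval_add:
  assumes f: "f \<in> free_star_alg G" and g: "g \<in> free_star_alg G"
  shows "eval_poly A v (f + g) = eval_poly A v f \<oplus> eval_poly A v g"
proof -
  let ?W = "Poly_Mapping.keys f \<union> Poly_Mapping.keys g"
  have W: "finite ?W" "\<And>w. w \<in> ?W \<Longrightarrow> word_gens w \<subseteq> G" "Poly_Mapping.keys (f + g) \<subseteq> ?W"
    using f g Poly_Mapping.keys_add[of f g] by (auto simp: free_star_alg_def)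
  have "eval_poly A v (f + g) = (\<Oplus>w \<in> ?W. Poly_Mapping.lookup (f + g) w \<odot> eval_word A v w)"
    by (rule eval_superset[OF W(1,3,2)])
  also have "\<dots> = (\<Oplus>w \<in> ?W. Poly_Mapping.lookup f w \<odot> eval_word A v w \<oplus> Poly_Mapping.lookup g w \<odot> eval_word A v w)"
    using W(2) term_closed by (intro finsum_cong') (auto simp: lookup_add smult_l_distr word_closed)
  also have "\<dots> = eval_poly A v f \<oplus> eval_poly A v g"
    using W term_closed eval_superset[OF W(1) _ W(2), of f] eval_superset[OF W(1) _ W(2), of g]
    by (subst finsum_addf) auto
  finally show ?thesis .
qed

lemma eval_zero [simp]: "eval_poly A v 0 = \<zero>"
  by (simp add: eval_poly_def)

lemma eval_single: 
  assumes "word_gens w \<subseteq> G" 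
  shows "eval_poly A v (Poly_Mapping.single w c) = c \<odot> eval_word A v w"
  using eval_superset[of "{w}" "Poly_Mapping.single w c"] assms term_closed[OF assms] by simp

lemma eval_gen: "g \<in> G \<Longrightarrow> eval_poly A v (gen g) = v g"
  using v by (simp add: gen_def eval_single)

lemma eval_mult:
  assumes f: "f \<in> free_star_alg G" and g: "g \<in> free_star_alg G"
  shows "eval_poly A v (f * g) = eval_poly A v f \<otimes> eval_poly A v g"
proof -
  have 1: "eval_poly A v (Poly_Mapping.single w c * g) = eval_poly A v (Poly_Mapping.single w c) \<otimes> eval_poly A v g"
    if w: "word_gens w \<subseteq> G" for w c
    using g
  proof (induction g rule: free_induct)
    case zero
    show ?case using eval_closed[OF free_single[OF w]] by simp
  next
    case (single x d)
    then show ?case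
      using w word_closed[OF w] word_closed[OF single]
      by (simp add: mult_single eval_single eval_word_append smult_mult_left smult_mult_right
          mult.commute flip: smult_assoc)
  next
    case (add f g)
    then show ?case using free_single[OF w, of c] 
      by (simp add: distrib_left eval_add r_distr eval_closed)
  qed
  show ?thesis
    using f
  proof (induction f rule: free_induct)
    case zero
    show ?case using eval_closed[OF g] by simp
  next
    case (single w c)
    then show ?case by (rule 1)
  next
    case (add f h)
    then show ?case using g by (simp add: distrib_right eval_add l_distr eval_closed)
  qed
qed

lemma eval_const: "eval_poly A v (const c) = c \<odot> \<one>"
proof -
  have "eval_word A v 0 = \<one>" by (simp add: zero_star_word_def)
  then show ?thesis unfolding const_def by (subst eval_single) auto
qed

lemma eval_one [simp]: "eval_poly A v 1 = \<one>"
  using eval_const[of 1] by simp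

lemma eval_scale: "f \<in> free_star_alg G \<Longrightarrow> eval_poly A v (const c * f) = c \<odot> eval_poly A v f"
  by (simp add: eval_mult eval_const eval_closed smult_mult_left)

lemma eval_star: "f \<in> free_star_alg G \<Longrightarrow> eval_poly A v (poly_star f) = adj A (eval_poly A v f)"
proof (induction f rule: free_induct)
  case (single w c)
  then show ?case by (simp add: poly_star_single eval_single eval_word_star adj_smult word_closed)
qed (simp_all add: poly_star_add eval_add adj_add eval_closed)

lemma eval_uminus: "f \<in> free_star_alg G \<Longrightarrow> eval_poly A v (- f) = \<ominus> eval_poly A v f"
  using eval_add[of "-f" f] minus_equality[of "eval_poly A v (-f)" "eval_poly A v f"] by (simp add: eval_closed)

lemma eval_diff: "\<lbrakk>f \<in> free_star_alg G; g \<in> free_star_alg G\<rbrakk> \<Longrightarrow>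
    eval_poly A v (f - g) = eval_poly A v f \<ominus> eval_poly A v g"
  using eval_add[of f "-g"] eval_uminus[of g] by (simp add: a_minus_def)

lemma eval_seminorm: "cstar_seminorm G (\<lambda>f. nrm A (eval_poly A v f))"
  unfolding cstar_seminorm_def
  by (auto simp: eval_closed eval_add eval_mult eval_const smult_mult_left eval_star
      nrm_nonneg nrm_triangle nrm_smult nrm_mult nrm_adj_mult)

end

context unital_cstar_algebra
begin

definition conv :: "(nat \<Rightarrow> 'a) \<Rightarrow> 'a \<Rightarrow> bool" where
  "conv s x \<longleftrightarrow> (\<forall>n. s n \<in> carrier A) \<and> x \<in> carrier A \<and> (\<lambda>n. nrm A (s n \<ominus> x)) \<longlonglongrightarrow> 0"

lemma conv_closed: "conv s x \<Longrightarrow> s n \<in> carrier A" "conv s x \<Longrightarrow> x \<in> carrier A"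
  by (auto simp: conv_def)

lemma dist_commute: "\<lbrakk>x \<in> carrier A; y \<in> carrier A\<rbrakk> \<Longrightarrow> nrm A (x \<ominus> y) = nrm A (y \<ominus> x)"
proof -
  assume xy: "x \<in> carrier A" "y \<in> carrier A"
  have "\<ominus> (x \<ominus> y) = y \<ominus> x" using xy by (simp add: a_minus_def minus_add a_comm)
  then show ?thesis using nrm_uminus[of "x \<ominus> y"] xy by simp
qed

lemma dist_triangle:
  assumes "x \<in> carrier A" "y \<in> carrier A" "z \<in> carrier A"
  shows "nrm A (x \<ominus> z) \<le> nrm A (x \<ominus> y) + nrm A (y \<ominus> z)"
proof -
  have "(x \<ominus> y) \<oplus> (y \<ominus> z) = x \<ominus> z"
    using assms by (simp add: a_minus_def a_assoc r_neg1)
  then show ?thesis using nrm_triangle[of "x \<ominus> y" "y \<ominus> z"] assms by simp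
qed

lemma dist_eq_0: "\<lbrakk>x \<in> carrier A; y \<in> carrier A; nrm A (x \<ominus> y) = 0\<rbrakk> \<Longrightarrow> x = y"
proof -
  assume xy: "x \<in> carrier A" "y \<in> carrier A" and "nrm A (x \<ominus> y) = 0"
  then have "x \<oplus> \<ominus> y = \<zero>" using nrm_eq_0_iff[OF minus_closed[OF xy]] unfolding a_minus_def by blast
  then have "\<ominus> (\<ominus> y) = x" by (rule minus_equality[OF _ a_inv_closed[OF xy(2)] xy(1)])
  then show "x = y" unfolding minus_minus[OF xy(2)] by (rule sym)
qed

lemma conv_unique:
  assumes "conv s x" "conv s y"
  shows "x = y"
proof (rule dist_eq_0)
  show xy: "x \<in> carrier A" "y \<in> carrier A" using assms by (auto simp: conv_def)
  have "(\<lambda>n. nrm A (s n \<ominus> x) + nrm A (s n \<ominus> y)) \<longlonglongrightarrow> 0"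
    using tendsto_add[of "\<lambda>n. nrm A (s n \<ominus> x)" 0 _ "\<lambda>n. nrm A (s n \<ominus> y)" 0] assms by (simp add: conv_def)
  then have "nrm A (x \<ominus> y) \<le> 0"
  proof (rule LIMSEQ_le_const, intro exI allI impI)
    fix n
    show "nrm A (x \<ominus> y) \<le> nrm A (s n \<ominus> x) + nrm A (s n \<ominus> y)"
      using dist_triangle[OF xy(1) conv_closed(1)[OF assms(1), of n] xy(2)]
        dist_commute[OF xy(1) conv_closed(1)[OF assms(1), of n]] by simp
  qed
  then show "nrm A (x \<ominus> y) = 0" using nrm_nonneg[of "x \<ominus> y"] xy by simp
qed

lemma conv_le:
  assumes s: "\<And>n. s n \<in> carrier A" and x: "x \<in> carrier A"
    and "\<And>n. nrm A (s n \<ominus> x) \<le> b n" "b \<longlonglongrightarrow> 0"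
  shows "conv s x"
  unfolding conv_def
  by (intro conjI allI s x null_squeeze[OF nrm_nonneg assms(3,4)] minus_closed)

lemma conv_const: "x \<in> carrier A \<Longrightarrow> conv (\<lambda>n. x) x"
  by (simp add: conv_def r_neg a_minus_def)

lemma conv_nrm:
  assumes "conv s x"
  shows "(\<lambda>n. nrm A (s n)) \<longlonglongrightarrow> nrm A x"
proof -
  note c = conv_closed(1)[OF assms] conv_closed(2)[OF assms]
  have *: "nrm A a \<le> nrm A (a \<ominus> b) + nrm A b" if "a \<in> carrier A" "b \<in> carrier A" for a b
    using dist_triangle[of a b \<zero>] that by (simp add: a_minus_def)
  have "\<bar>nrm A (s n) - nrm A x\<bar> \<le> nrm A (s n \<ominus> x)" for n
    using *[OF c(1)[of n] c(2)] *[OF c(2) c(1)[of n]] dist_commute[OF c(2) c(1)[of n]] by simp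
  then have "(\<lambda>n. \<bar>nrm A (s n) - nrm A x\<bar>) \<longlonglongrightarrow> 0"
    by (rule null_squeeze[OF abs_ge_zero]) (use assms in \<open>simp only: conv_def\<close>)
  then have "(\<lambda>n. nrm A (s n) - nrm A x) \<longlonglongrightarrow> 0"
    by (rule tendsto_rabs_zero_cancel)
  then show ?thesis by (rule LIM_zero_cancel)
qed

lemma conv_add:
  assumes "conv s x" "conv t y"
  shows "conv (\<lambda>n. s n \<oplus> t n) (x \<oplus> y)"
proof (rule conv_le)
  note c = conv_closed(1)[OF assms(1)] conv_closed(2)[OF assms(1)] conv_closed(1)[OF assms(2)] conv_closed(2)[OF assms(2)]
  show "s n \<oplus> t n \<in> carrier A" "x \<oplus> y \<in> carrier A" for n using c by auto
  show "(\<lambda>n. nrm A (s n \<ominus> x) + nrm A (t n \<ominus> y)) \<longlonglongrightarrow> 0"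
    using tendsto_add[of "\<lambda>n. nrm A (s n \<ominus> x)" 0 _ "\<lambda>n. nrm A (t n \<ominus> y)" 0] assms by (simp add: conv_def)
  fix n
  have "(s n \<oplus> t n) \<ominus> (x \<oplus> y) = (s n \<ominus> x) \<oplus> (t n \<ominus> y)"
    using c(1)[of n] c(2) c(3)[of n] c(4) by (simp add: a_minus_def minus_add a_ac)
  then show "nrm A ((s n \<oplus> t n) \<ominus> (x \<oplus> y)) \<le> nrm A (s n \<ominus> x) + nrm A (t n \<ominus> y)"
    using nrm_triangle[OF minus_closed[OF c(1)[of n] c(2)] minus_closed[OF c(3)[of n] c(4)]] by simp
qed

lemma conv_smult:
  assumes "conv s x"
  shows "conv (\<lambda>n. c \<odot> s n) (c \<odot> x)"
proof (rule conv_le)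
  note c = conv_closed(1)[OF assms(1)] conv_closed(2)[OF assms(1)]
  show "c \<odot> s n \<in> carrier A" "c \<odot> x \<in> carrier A" for n using c by auto
  show "(\<lambda>n. cmod c * nrm A (s n \<ominus> x)) \<longlonglongrightarrow> 0"
    using tendsto_mult_left[of "\<lambda>n. nrm A (s n \<ominus> x)" 0 _ "cmod c"] assms by (simp add: conv_def)
  fix n
  have "c \<odot> (\<ominus> x) = \<ominus> (c \<odot> x)"
    using c smult_r_distr[of "\<ominus> x" x c] by (simp add: l_neg minus_equality)
  then have "c \<odot> s n \<ominus> c \<odot> x = c \<odot> (s n \<ominus> x)"
    using c by (simp add: a_minus_def smult_r_distr)
  then show "nrm A (c \<odot> s n \<ominus> c \<odot> x) \<le> cmod c * nrm A (s n \<ominus> x)"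
    using nrm_smult[of "s n \<ominus> x" c] c by simp
qed

lemma conv_adj:
  assumes "conv s x"
  shows "conv (\<lambda>n. adj A (s n)) (adj A x)"
proof (rule conv_le)
  note c = conv_closed(1)[OF assms(1)] conv_closed(2)[OF assms(1)]
  show "adj A (s n) \<in> carrier A" "adj A x \<in> carrier A" for n using c by auto
  show "(\<lambda>n. nrm A (s n \<ominus> x)) \<longlonglongrightarrow> 0"
    using assms by (simp add: conv_def)
  fix n
  have "adj A (\<ominus> x) = \<ominus> (adj A x)"
    using c adj_add[of "\<ominus> x" x] by (simp add: l_neg minus_equality)
  then have "adj A (s n) \<ominus> adj A x = adj A (s n \<ominus> x)"
    using c by (simp add: a_minus_def adj_add)
  then show "nrm A (adj A (s n) \<ominus> adj A x) \<le> nrm A (s n \<ominus> x)"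
    using nrm_adj[of "s n \<ominus> x"] c by simp
qed

lemma conv_mult:
  assumes "conv s x" "conv t y"
  shows "conv (\<lambda>n. s n \<otimes> t n) (x \<otimes> y)"
proof (rule conv_le)
  note c = conv_closed(1)[OF assms(1)] conv_closed(2)[OF assms(1)] conv_closed(1)[OF assms(2)] conv_closed(2)[OF assms(2)]
  show "s n \<otimes> t n \<in> carrier A" "x \<otimes> y \<in> carrier A" for n using c by auto
  have "(\<lambda>n. nrm A (s n) * nrm A (t n \<ominus> y) + nrm A (s n \<ominus> x) * nrm A y) \<longlonglongrightarrow> nrm A x * 0 + 0 * nrm A y"
    by (intro tendsto_add[OF tendsto_mult[OF conv_nrm[OF assms(1)]] tendsto_mult[OF _ tendsto_const]])
      (use assms in \<open>simp_all only: conv_def\<close>)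
  then show "(\<lambda>n. nrm A (s n) * nrm A (t n \<ominus> y) + nrm A (s n \<ominus> x) * nrm A y) \<longlonglongrightarrow> 0" by simp
  fix n
  have "(s n \<otimes> t n) \<ominus> (x \<otimes> y) = s n \<otimes> (t n \<ominus> y) \<oplus> (s n \<ominus> x) \<otimes> y"
  proof -
    have p: "s n \<otimes> t n \<in> carrier A" "s n \<otimes> y \<in> carrier A" "x \<otimes> y \<in> carrier A" using c by auto
    have "s n \<otimes> (t n \<ominus> y) = s n \<otimes> t n \<ominus> s n \<otimes> y"
      unfolding a_minus_def using c(1)[of n] c(3)[of n] c(4) by (simp add: r_distr r_minus)
    moreover have "(s n \<ominus> x) \<otimes> y = s n \<otimes> y \<ominus> x \<otimes> y"
      unfolding a_minus_def using c(1)[of n] c(2) c(4) by (simp add: l_distr l_minus)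
    moreover have "(a \<ominus> b) \<oplus> (b \<ominus> d) = a \<ominus> d" if "a \<in> carrier A" "b \<in> carrier A" "d \<in> carrier A" for a b d
      using that by (simp add: a_minus_def a_assoc r_neg1)
    ultimately show ?thesis using p by simp
  qed
  then have "nrm A ((s n \<otimes> t n) \<ominus> (x \<otimes> y)) \<le> nrm A (s n \<otimes> (t n \<ominus> y)) + nrm A ((s n \<ominus> x) \<otimes> y)"
    using nrm_triangle[OF m_closed[OF c(1)[of n] minus_closed[OF c(3)[of n] c(4)]]
        m_closed[OF minus_closed[OF c(1)[of n] c(2)] c(4)]] by (simp only:)
  then show "nrm A ((s n \<otimes> t n) \<ominus> (x \<otimes> y)) \<le> nrm A (s n) * nrm A (t n \<ominus> y) + nrm A (s n \<ominus> x) * nrm A y"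
    using nrm_mult[OF c(1)[of n] minus_closed[OF c(3)[of n] c(4)]]
      nrm_mult[OF minus_closed[OF c(1)[of n] c(2)] c(4)] by linarith
qed

end

theorem universal_cstar_algebra:
  "projection_relators G \<subseteq> R \<Longrightarrow> unital_cstar_algebra (universal_cstar G R)"
  unfolding universal_cstar_def by (intro completion_cstar_algebra universal_seminorm_csn)

definition universal_gen :: "'g set \<Rightarrow> 'g star_poly set \<Rightarrow> 'g \<Rightarrow> (nat \<Rightarrow> 'g star_poly) set" where
  "universal_gen G R g = seq_class G (universal_seminorm G R) (\<lambda>n. gen g)"

lemma universal_eval:
  assumes R: "projection_relators G \<subseteq> R" and f: "f \<in> free_star_alg G"
  shows "eval_poly (universal_cstar G R) (universal_gen G R) f = seq_class G (universal_seminorm G R) (\<lambda>n. f)"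
proof -
  let ?u = "universal_seminorm G R"
  let ?C = "cstar_completion G ?u"
  note u = universal_seminorm_csn[OF R]
  let ?c = "\<lambda>f. seq_class G ?u (\<lambda>n. f)" and ?v = "universal_gen G R"
  note cc = cauchy_const[OF u]
  interpret unital_cstar_algebra ?C by (rule completion_cstar_algebra[OF u])
  interpret cstar_evaluation ?C G ?v
    by unfold_locales (auto simp: universal_gen_def intro!: completion_in[OF u] cc)
  have "eval_poly ?C ?v f = ?c f"
    using f
  proof (induction f rule: free_induct)
    case zero
    show ?case by (simp add: completion_zero[OF u])
  next
    case (add f g)
    then show ?case by (simp add: eval_add completion_add[OF u cc cc])
  next
    case (single w c)
    have "eval_word ?C ?v (Word ls) = ?c (Poly_Mapping.single (Word ls) 1)" if "letter_base ` set ls \<subseteq> G" for ls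
      using that
    proof (induction ls)
      case Nil
      have "Poly_Mapping.single (Word []) 1 = (1 :: 'a star_poly)"
        by (simp flip: zero_star_word_def)
      then show ?case by (simp add: completion_one[OF u])
    next
      case (Cons l ls)
      have lsf: "Poly_Mapping.single (Word [l]) 1 \<in> free_star_alg G" "Poly_Mapping.single (Word ls) 1 \<in> free_star_alg G"
        using Cons.prems by (auto intro!: free_single)
      have l: "eval_letter ?C ?v l = ?c (Poly_Mapping.single (Word [l]) 1)"
      proof (cases l)
        case (Plain g)
        then show ?thesis by (simp add: universal_gen_def gen_def)
      next
        case (Star g)
        then have "g \<in> G" using Cons.prems by simp
        then show ?thesis using Star completion_adj[OF u cc[OF free_gen]]
          by (simp add: universal_gen_def) (simp add: gen_def poly_star_single)
      qed
      then show ?case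
        using Cons completion_mult[OF u cc[OF lsf(1)] cc[OF lsf(2)]] by (simp add: mult_single)
    qed
    moreover obtain ls where "w = Word ls" by (cases w)
    ultimately have "eval_word ?C ?v w = ?c (Poly_Mapping.single w 1)" using single by simp
    then show ?case
      using single completion_smult[OF u cc[OF free_single[OF single]]] by (simp add: eval_single const_single)
  qed
  then show ?thesis by (simp add: universal_cstar_def)
qed

theorem universal_relations:
  assumes "projection_relators G \<subseteq> R" "R \<subseteq> free_star_alg G" "r \<in> R"
  shows "eval_poly (universal_cstar G R) (universal_gen G R) r = \<zero>\<^bsub>universal_cstar G R\<^esub>"
proof -
  note u = universal_seminorm_csn[OF assms(1)]
  have r: "r \<in> free_star_alg G" using assms by blast
  have "seq_class G (universal_seminorm G R) (\<lambda>n. r) = seq_class G (universal_seminorm G R) (\<lambda>n. 0)"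
    using universal_seminorm_relator[OF assms(1,3) r]
    by (intro cauchy_diff_null[OF u] cauchy_const[OF u] r free_zero) simp
  then show ?thesis
    by (simp add: universal_eval[OF assms(1) r]) (simp add: universal_cstar_def completion_zero[OF u])
qed

theorem universal_dense:
  assumes R: "projection_relators G \<subseteq> R" and x: "x \<in> carrier (universal_cstar G R)" and e: "e > 0"
  shows "\<exists>f \<in> free_star_alg G. nrm (universal_cstar G R)
    (x \<ominus>\<^bsub>universal_cstar G R\<^esub> eval_poly (universal_cstar G R) (universal_gen G R) f) < e"
  using completion_dense[OF universal_seminorm_csn[OF R] x[unfolded universal_cstar_def] e]
    universal_eval[OF R] by (metis universal_cstar_def)

text \<open>Together with \<open>universal_dense\<close> this determines \<open>\<phi>\<close>, as *-homomorphisms between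
  C*-algebras are continuous.\<close>

theorem universal_property:
  fixes D :: "('d, 'm) cstar_alg_scheme"
  assumes R: "projection_relators G \<subseteq> R" and D: "unital_cstar_algebra D"
    and v: "\<And>g. g \<in> G \<Longrightarrow> v g \<in> carrier D"
    and rel: "\<And>r. r \<in> R \<Longrightarrow> eval_poly D v r = \<zero>\<^bsub>D\<^esub>"
  shows "\<exists>\<phi> \<in> star_hom (universal_cstar G R) D. (\<forall>g \<in> G. \<phi> (universal_gen G R g) = v g) \<and>
    (\<forall>x \<in> carrier (universal_cstar G R). nrm D (\<phi> x) \<le> nrm (universal_cstar G R) x)"
proof -
  let ?u = "universal_seminorm G R"
  let ?C = "cstar_completion G ?u"
  note u = universal_seminorm_csn[OF R]
  interpret D: unital_cstar_algebra D by (rule D)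
  interpret E: cstar_evaluation D G v by unfold_locales (rule v)
  let ?ev = "eval_poly D v"
  have le: "nrm D (?ev f) \<le> ?u f" if "f \<in> free_star_alg G" for f
    using universal_seminorm_upper[OF R E.eval_seminorm _ that] rel by simp
  have ex: "\<exists>x. D.conv (\<lambda>n. ?ev (s n)) x" if s: "s \<in> cauchy_seqs G ?u" for s
  proof -
    have sc: "s n \<in> free_star_alg G" for n by (rule cauchy_in_free[OF u s])
    have "\<exists>x \<in> carrier D. (\<lambda>n. nrm D (?ev (s n) \<ominus>\<^bsub>D\<^esub> x)) \<longlonglongrightarrow> 0"
    proof (rule D.complete)
      show "?ev (s n) \<in> carrier D" for n by (rule E.eval_closed[OF sc])
      fix e :: real assume "e > 0"
      then obtain N where N: "\<forall>m \<ge> N. \<forall>n \<ge> N. ?u (s m - s n) < e"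
        using cauchy_seqsD[OF u s] by blast
      have "nrm D (?ev (s m) \<ominus>\<^bsub>D\<^esub> ?ev (s n)) \<le> ?u (s m - s n)" for m n
        using le[OF free_diff[OF sc[of m] sc[of n]]] by (simp add: E.eval_diff sc)
      then show "\<exists>N. \<forall>m \<ge> N. \<forall>n \<ge> N. nrm D (?ev (s m) \<ominus>\<^bsub>D\<^esub> ?ev (s n)) < e"
        using N by (meson order_le_less_trans)
    qed
    then show ?thesis using E.eval_closed[OF sc] by (auto simp: D.conv_def)
  qed
  define \<phi> where "\<phi> S = (THE x. D.conv (\<lambda>n. ?ev (seq_rep S n)) x)" for S
  have \<phi>: "D.conv (\<lambda>n. ?ev (s n)) (\<phi> (seq_class G ?u s))" if s: "s \<in> cauchy_seqs G ?u" for s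
  proof -
    let ?s = "seq_rep (seq_class G ?u s)"
    note s' = seq_rep[OF u s]
    have sc: "s n \<in> free_star_alg G" "?s n \<in> free_star_alg G" for n
      using cauchy_in_free[OF u s] cauchy_in_free[OF u s'(1)] by auto
    obtain x where x: "D.conv (\<lambda>n. ?ev (?s n)) x" using ex[OF s'(1)] by blast
    then have "\<phi> (seq_class G ?u s) = x"
      unfolding \<phi>_def using D.conv_unique by blast
    moreover have "D.conv (\<lambda>n. ?ev (s n)) x"
    proof (rule D.conv_le)
      show "?ev (s n) \<in> carrier D" for n by (rule E.eval_closed[OF sc(1)])
      show xc: "x \<in> carrier D" using x by (rule D.conv_closed)
      show "(\<lambda>n. ?u (s n - ?s n) + nrm D (?ev (?s n) \<ominus>\<^bsub>D\<^esub> x)) \<longlonglongrightarrow> 0"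
        using tendsto_add[OF s'(2), of "\<lambda>n. nrm D (?ev (?s n) \<ominus>\<^bsub>D\<^esub> x)" 0] x by (simp add: D.conv_def)
      show "nrm D (?ev (s n) \<ominus>\<^bsub>D\<^esub> x) \<le> ?u (s n - ?s n) + nrm D (?ev (?s n) \<ominus>\<^bsub>D\<^esub> x)" for n
        using D.dist_triangle[OF E.eval_closed[OF sc(1)] E.eval_closed[OF sc(2)] xc, of n n]
          le[OF free_diff[OF sc], of n n] by (simp add: E.eval_diff sc)
    qed
    ultimately show ?thesis by simp
  qed
  have \<phi>_eqI: "\<phi> (seq_class G ?u s) = x" if "s \<in> cauchy_seqs G ?u" "D.conv (\<lambda>n. ?ev (s n)) x" for s x
    using D.conv_unique[OF \<phi>[OF that(1)] that(2)] .
  have \<phi>_const: "\<phi> (seq_class G ?u (\<lambda>n. f)) = ?ev f" if "f \<in> free_star_alg G" for f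
    by (intro \<phi>_eqI cauchy_const[OF u that] D.conv_const E.eval_closed that)
  have "\<phi> \<in> star_hom ?C D"
    unfolding star_hom_def ring_hom_def
  proof (intro CollectI conjI allI ballI impI Pi_I)
    fix S assume "S \<in> carrier ?C"
    then obtain s where s: "s \<in> cauchy_seqs G ?u" "S = seq_class G ?u s" by (rule completion_cases[OF u])
    note sc = cauchy_in_free[OF u s(1)]
    show "\<phi> S \<in> carrier D" unfolding s(2) by (rule D.conv_closed(2)[OF \<phi>[OF s(1)]])
    show "\<phi> (c \<odot>\<^bsub>?C\<^esub> S) = c \<odot>\<^bsub>D\<^esub> \<phi> S" for c
      unfolding s(2) completion_smult[OF u s(1)]
      by (intro \<phi>_eqI cauchy_scale[OF u s(1)]) (use D.conv_smult[OF \<phi>[OF s(1)]] in \<open>simp add: E.eval_scale sc\<close>)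
    show "\<phi> (adj ?C S) = adj D (\<phi> S)"
      unfolding s(2) completion_adj[OF u s(1)]
      by (intro \<phi>_eqI cauchy_star[OF u s(1)]) (use D.conv_adj[OF \<phi>[OF s(1)]] in \<open>simp add: E.eval_star sc\<close>)
  next
    fix S T assume ST: "S \<in> carrier ?C \<and> T \<in> carrier ?C"
    obtain s where s: "s \<in> cauchy_seqs G ?u" "S = seq_class G ?u s"
      using conjunct1[OF ST] by (rule completion_cases[OF u])
    obtain t where t: "t \<in> cauchy_seqs G ?u" "T = seq_class G ?u t"
      using conjunct2[OF ST] by (rule completion_cases[OF u])
    note sc = cauchy_in_free[OF u s(1)] cauchy_in_free[OF u t(1)]
    show "\<phi> (S \<otimes>\<^bsub>?C\<^esub> T) = \<phi> S \<otimes>\<^bsub>D\<^esub> \<phi> T"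
      unfolding s(2) t(2) completion_mult[OF u s(1) t(1)]
      by (intro \<phi>_eqI cauchy_mult[OF u s(1) t(1)])
        (use D.conv_mult[OF \<phi>[OF s(1)] \<phi>[OF t(1)]] in \<open>simp add: E.eval_mult sc\<close>)
    show "\<phi> (S \<oplus>\<^bsub>?C\<^esub> T) = \<phi> S \<oplus>\<^bsub>D\<^esub> \<phi> T"
      unfolding s(2) t(2) completion_add[OF u s(1) t(1)]
      by (intro \<phi>_eqI cauchy_add[OF u s(1) t(1)])
        (use D.conv_add[OF \<phi>[OF s(1)] \<phi>[OF t(1)]] in \<open>simp add: E.eval_add sc\<close>)
  next
    show "\<phi> \<one>\<^bsub>?C\<^esub> = \<one>\<^bsub>D\<^esub>"
      unfolding completion_one[OF u] by (simp add: \<phi>_const[OF free_one])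
  qed
  moreover have "\<phi> (universal_gen G R g) = v g" if "g \<in> G" for g
    using \<phi>_const[OF free_gen[OF that]] E.eval_gen[OF that] by (simp add: universal_gen_def)
  moreover have "nrm D (\<phi> S) \<le> nrm ?C S" if S: "S \<in> carrier ?C" for S
  proof -
    obtain s where s: "s \<in> cauchy_seqs G ?u" "S = seq_class G ?u s" using S by (rule completion_cases[OF u])
    show ?thesis
      unfolding s(2)
      by (rule LIMSEQ_le[OF D.conv_nrm[OF \<phi>[OF s(1)]] completion_nrm[OF u s(1)]])
        (use le[OF cauchy_in_free[OF u s(1)]] in blast)
  qed
  ultimately show ?thesis unfolding universal_cstar_def by blast
qed

lemma game_presentation:
  "projection_relators (game_gens X Y A B) \<subseteq> game_relators X Y A B lam"
  "game_relators X Y A B lam \<subseteq> free_star_alg (game_gens X Y A B)"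
proof -
  show "projection_relators (game_gens X Y A B) \<subseteq> game_relators X Y A B lam"
    by (auto simp: game_relators_def)
  have P: "gen (PGen x a) \<in> free_star_alg (game_gens X Y A B)" if "x \<in> X" "a \<in> A" for x a
    using that by (intro free_gen) (auto simp: game_gens_def)
  have Q: "gen (QGen y b) \<in> free_star_alg (game_gens X Y A B)" if "y \<in> Y" "b \<in> B" for y b
    using that by (intro free_gen) (auto simp: game_gens_def)
  have "projection_relators (game_gens X Y A B) \<subseteq> free_star_alg (game_gens X Y A B)"
    unfolding projection_relators_def using free_gen by auto
  then show "game_relators X Y A B lam \<subseteq> free_star_alg (game_gens X Y A B)"
    unfolding game_relators_def by (auto intro!: free_diff free_mult free_sum P Q)
qed

lemma assignment_presentation:
  assumes "\<And>z. z \<in> X \<union> Y \<Longrightarrow> V z \<subseteq> {1..n}"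
  shows "projection_relators (assignment_gens n C) \<subseteq> assignment_relators n C V X Y lam"
    "assignment_relators n C V X Y lam \<subseteq> free_star_alg (assignment_gens n C)"
proof -
  show "projection_relators (assignment_gens n C) \<subseteq> assignment_relators n C V X Y lam"
    by (auto simp: assignment_relators_def)
  have E: "gen (i, c) \<in> free_star_alg (assignment_gens n C)" if "i \<in> {1..n}" "c \<in> C" for i c
    using that by (intro free_gen) (auto simp: assignment_gens_def)
  have V: "i \<in> {1..n}" if "i \<in> V z" "z \<in> X \<union> Y" for i z
    using assms that by blast
  have prod: "assignment_prod (V z) a \<in> free_star_alg (assignment_gens n C)"
    if z: "z \<in> X \<union> Y" "dom a = V z" "ran a \<subseteq> C" for z a
    unfolding assignment_prod_def
  proof (rule free_prod_list, clarsimp)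
    fix i assume "i \<in> set (sorted_list_of_set (V z))"
    then have i: "i \<in> V z" using set_sorted_list_of_set[of "V z"]
      by (metis assms finite_atLeastAtMost finite_subset z(1))
    then obtain c where "a i = Some c" using z(2) by blast
    then have "the (a i) \<in> C" using z(3) by (auto simp: ran_def)
    then show "gen (i, the (a i)) \<in> free_star_alg (assignment_gens n C)"
      using E V[OF i z(1)] by blast
  qed
  have comm: "gen (i, c) * gen (j, d) - gen (j, d) * gen (i, c) \<in> free_star_alg (assignment_gens n C)"
    if "c \<in> C" "d \<in> C" "z \<in> X \<union> Y" "i \<in> V z" "j \<in> V z" for i j c d z
    using that by (intro free_diff free_mult E V) auto
  have "projection_relators (assignment_gens n C) \<subseteq> free_star_alg (assignment_gens n C)"
    unfolding projection_relators_def using free_gen by auto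
  moreover have "(\<Sum>c\<in>C. gen (i, c)) - 1 \<in> free_star_alg (assignment_gens n C)" if "i \<in> {1..n}" for i
    using that by (intro free_diff free_sum free_one E)
  ultimately show "assignment_relators n C V X Y lam \<subseteq> free_star_alg (assignment_gens n C)"
    unfolding assignment_relators_def using comm prod
    by (intro Un_least subsetI) (force intro!: free_mult)+
qed

end

theory Submission
  imports Defs
begin

text \<open>
  Both presentations have the same representations in any unital C*-algebra, and the passage
  between them is given by *-polynomials.

  Given projections \<open>p x a\<close> and \<open>q y b\<close> satisfying the relations of the game, let \<open>P x i c\<close> be the sum of
  all \<open>p x a\<close> with \<open>a i = c\<close>, and \<open>Q y i c\<close> the corresponding sum for the second player. If \<open>i\<close> lies in
  \<open>V x \<inter> V y\<close>, the consistency requirement makes \<open>p x a\<close> orthogonal to every \<open>q y b\<close> with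
  \<open>b i \<noteq> a i\<close>. Since the \<open>q y b\<close> sum to one, \<open>p x a \<otimes> Q y i c\<close> is \<open>p x a\<close> if \<open>a i = c\<close> and zero otherwise;
  likewise for \<open>P x i c \<otimes> q y b\<close>. Summing up, \<open>P x i c = P x i c \<otimes> Q y i c = Q y i c\<close>. Hence this element
  depends on \<open>i\<close> and \<open>c\<close> only; call it \<open>e i c\<close> (\<open>P_eq_Q\<close>).

  Consequently every \<open>p x a\<close> is, under right multiplication, a joint eigenvector of the \<open>e i c\<close> with
  \<open>i \<in> V x\<close>, with eigenvalues zero and one. As the \<open>p x a\<close> sum to one, an identity between expressions
  in these \<open>e i c\<close> can be tested after multiplying by each \<open>p x a\<close> from the left. This gives
  idempotence, commutation, the sum over \<open>c\<close>, and the product formula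
  \<open>p x a = (\<Prod>i \<in> V x. e i (a i))\<close> all at once (locale \<open>diagonal_family\<close>). The argument is purely
  algebraic: even the orthogonality of the \<open>p x a\<close> for fixed \<open>x\<close>, which is usually derived from
  positivity, is a consequence of the product formula. (This is for tuples \<open>a\<close> with domain \<open>V x\<close>; any
  other tuple has \<open>p x a = 0\<close> by \<open>p_wrong_dom\<close>.)

  Conversely, given projections \<open>e i c\<close> satisfying the relations (a), (b), (c), the products
  \<open>\<Prod>i \<in> V z. e i (a i)\<close> of commuting projections are projections. Expanding a product of sums,
  in which the factor with index \<open>i\<close> is \<open>\<Sum>c. e i c = 1\<close>, shows that they sum to one; keeping the
  single value \<open>c\<close> in the factor with index \<open>i\<close> shows that their marginals are the \<open>e i c\<close>
  (\<open>answer_marginal\<close>). So the two constructions are mutually inverse.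

  The universal property turns them into contractive *-homomorphisms in both directions. Their
  composites fix the generators, hence agree with the identity on a dense subalgebra, hence
  everywhere (\<open>universal_cstar_isomorphic\<close>).
\<close>

section \<open>Finite sums and ordered products in a ring\<close>

definition (in monoid) list_prod :: "'a list \<Rightarrow> 'a" where
  "list_prod xs = foldr (\<otimes>) xs \<one>"

context monoid
begin

lemma list_prod_Nil [simp]: "list_prod [] = \<one>"
  by (simp add: list_prod_def)

lemma list_prod_Cons [simp]: "list_prod (x # xs) = x \<otimes> list_prod xs"
  by (simp add: list_prod_def)

lemma list_prod_closed [simp, intro]: "set xs \<subseteq> carrier G \<Longrightarrow> list_prod xs \<in> carrier G"
  by (induction xs) auto

lemma list_prod_ones: "set xs \<subseteq> {\<one>} \<Longrightarrow> list_prod xs = \<one>"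
  by (induction xs) auto

lemma list_prod_single:
  assumes "distinct is" "i \<in> set is" "x \<in> carrier G"
  shows "list_prod (map (\<lambda>j. if j = i then x else \<one>) is) = x"
  using assms(1,2)
proof (induction "is")
  case (Cons j js)
  show ?case
  proof (cases "j = i")
    case True
    then have "list_prod (map (\<lambda>j. if j = i then x else \<one>) js) = \<one>"
      using Cons.prems by (intro list_prod_ones) auto
    then show ?thesis using True assms(3) by simp
  next
    case False
    then show ?thesis using Cons assms(3) by simp
  qed
qed simp

lemma list_prod_commute:
  assumes "x \<in> carrier G" "set ys \<subseteq> carrier G" "\<And>y. y \<in> set ys \<Longrightarrow> x \<otimes> y = y \<otimes> x"
  shows "x \<otimes> list_prod ys = list_prod ys \<otimes> x"
  using assms(2,3)
proof (induction ys)
  case (Cons y ys)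
  then have c: "y \<in> carrier G" "list_prod ys \<in> carrier G" by auto
  have "x \<otimes> (y \<otimes> list_prod ys) = y \<otimes> (x \<otimes> list_prod ys)"
    using Cons.prems c assms(1) by (simp flip: m_assoc)
  then show ?case
    using Cons c assms(1) by (simp add: m_assoc)
qed (use assms(1) in simp)

lemma list_prod_idempotent:
  assumes "set xs \<subseteq> carrier G" "\<And>x. x \<in> set xs \<Longrightarrow> x \<otimes> x = x"
    and "\<And>x y. \<lbrakk>x \<in> set xs; y \<in> set xs\<rbrakk> \<Longrightarrow> x \<otimes> y = y \<otimes> x"
  shows "list_prod xs \<otimes> list_prod xs = list_prod xs"
  using assms
proof (induction xs)
  case (Cons x xs)
  let ?p = "list_prod xs"
  have c: "x \<in> carrier G" "?p \<in> carrier G" using Cons.prems(1) by auto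
  have "?p \<otimes> x = x \<otimes> ?p"
    using Cons.prems by (intro list_prod_commute[symmetric]) auto
  then have "(x \<otimes> ?p) \<otimes> (x \<otimes> ?p) = (x \<otimes> x) \<otimes> (?p \<otimes> ?p)"
    using c by (metis m_assoc m_closed)
  then show ?case using Cons by simp
qed simp

end

context ring
begin

lemma minus_eq_zero_iff: "\<lbrakk>x \<in> carrier R; y \<in> carrier R\<rbrakk> \<Longrightarrow> x \<ominus> y = \<zero> \<longleftrightarrow> x = y"
  by (metis a_minus_def minus_equality minus_minus r_neg a_inv_closed)

text \<open>A factor that annihilates part of a partition of unity does not see that part. This is how
  orthogonality between the two players becomes a statement about marginals.\<close>

lemma mult_finsum_support:
  assumes "finite B" "q \<in> B \<rightarrow> carrier R" "x \<in> carrier R" "S \<subseteq> B"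
    and "\<And>b. b \<in> B - S \<Longrightarrow> x \<otimes> q b = \<zero>"
  shows "x \<otimes> finsum R q S = x \<otimes> finsum R q B"
proof -
  have S: "finite S" "q \<in> S \<rightarrow> carrier R"
    using assms finite_subset by auto
  have "(\<Oplus>b\<in>S. x \<otimes> q b) = (\<Oplus>b\<in>B. x \<otimes> q b)"
    using assms by (intro add.finprod_mono_neutral_cong_left) auto
  then show ?thesis using S assms(1-3) by (simp add: finsum_rdistr)
qed

lemma finsum_mult_support:
  assumes "finite B" "q \<in> B \<rightarrow> carrier R" "x \<in> carrier R" "S \<subseteq> B"
    and "\<And>b. b \<in> B - S \<Longrightarrow> q b \<otimes> x = \<zero>"
  shows "finsum R q S \<otimes> x = finsum R q B \<otimes> x"
proof -
  have S: "finite S" "q \<in> S \<rightarrow> carrier R"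
    using assms finite_subset by auto
  have "(\<Oplus>b\<in>S. q b \<otimes> x) = (\<Oplus>b\<in>B. q b \<otimes> x)"
    using assms by (intro add.finprod_mono_neutral_cong_left) auto
  then show ?thesis using S assms(1-3) by (simp add: finsum_ldistr)
qed

lemma mult_finsum_zero:
  assumes "finite B" "q \<in> B \<rightarrow> carrier R" "x \<in> carrier R" "\<And>b. b \<in> B \<Longrightarrow> x \<otimes> q b = \<zero>"
  shows "x \<otimes> finsum R q B = \<zero>"
  using mult_finsum_support[of B q x "{}"] assms by simp

lemma finsum_mult_zero:
  assumes "finite B" "q \<in> B \<rightarrow> carrier R" "x \<in> carrier R" "\<And>b. b \<in> B \<Longrightarrow> q b \<otimes> x = \<zero>"
  shows "finsum R q B \<otimes> x = \<zero>"
  using finsum_mult_support[of B q x "{}"] assms by simp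

end

definition choice_maps :: "'i set \<Rightarrow> ('i \<Rightarrow> 'c set) \<Rightarrow> ('i \<rightharpoonup> 'c) set" where
  "choice_maps W S = {a. dom a = W \<and> (\<forall>i \<in> W. the (a i) \<in> S i)}"

lemma choice_maps_empty: "choice_maps {} S = {Map.empty}"
  by (auto simp: choice_maps_def)

lemma choice_maps_insert:
  assumes "j \<notin> W"
  shows "choice_maps (insert j W) S = (\<Union>c\<in>S j. (\<lambda>a. a(j \<mapsto> c)) ` choice_maps W S)"
proof (intro equalityI subsetI)
  fix a assume a: "a \<in> choice_maps (insert j W) S"
  then obtain c where c: "a j = Some c" by (auto simp: choice_maps_def)
  have "a = (a |` W)(j \<mapsto> the (a j))"
  proof
    fix x show "a x = ((a |` W)(j \<mapsto> the (a j))) x"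
      using a c by (cases "x \<in> W") (auto simp: choice_maps_def restrict_map_def)
  qed
  moreover have "the (a j) \<in> S j" "a |` W \<in> choice_maps W S"
    using a assms by (auto simp: choice_maps_def)
  ultimately show "a \<in> (\<Union>c\<in>S j. (\<lambda>a. a(j \<mapsto> c)) ` choice_maps W S)" by blast
next
  fix a assume "a \<in> (\<Union>c\<in>S j. (\<lambda>a. a(j \<mapsto> c)) ` choice_maps W S)"
  then show "a \<in> choice_maps (insert j W) S"
    using assms by (auto simp: choice_maps_def split: if_splits) (auto simp: dom_def)
qed

lemma finite_choice_maps:
  assumes "finite W" "\<And>i. i \<in> W \<Longrightarrow> finite (S i)"
  shows "finite (choice_maps W S)"
  using assms by (induction W) (auto simp: choice_maps_empty choice_maps_insert)

lemma inj_on_update_choice_maps: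
  assumes "j \<notin> W"
  shows "inj_on (\<lambda>a. a(j \<mapsto> c)) (choice_maps W S)"
proof (rule inj_onI, rule ext)
  fix a b x
  assume ab: "a \<in> choice_maps W S" "b \<in> choice_maps W S" and eq: "a(j \<mapsto> c) = b(j \<mapsto> c)"
  show "a x = b x"
  proof (cases "x = j")
    case True
    then have "x \<notin> dom a" "x \<notin> dom b" using ab assms by (auto simp: choice_maps_def)
    then show ?thesis by (simp add: domIff)
  qed (use fun_cong[OF eq, of x] in simp)
qed

text \<open>Expansion of a product of sums. Letting the index sets \<open>S i\<close> vary with \<open>i\<close> covers both the full
  sum over all answers and its restriction to the answers with a prescribed value.\<close>

lemma (in ring) list_prod_finsum:
  assumes "distinct is" "\<And>i. i \<in> set is \<Longrightarrow> finite (S i)"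
    and "\<And>i c. \<lbrakk>i \<in> set is; c \<in> S i\<rbrakk> \<Longrightarrow> e i c \<in> carrier R"
  shows "(\<Oplus>a\<in>choice_maps (set is) S. list_prod (map (\<lambda>i. e i (the (a i))) is))
    = list_prod (map (\<lambda>i. \<Oplus>c\<in>S i. e i c) is)"
  using assms
proof (induction "is")
  case Nil
  show ?case by (simp add: choice_maps_empty)
next
  case (Cons j js)
  let ?M = "choice_maps (set js) S"
  let ?P = "\<lambda>is a. list_prod (map (\<lambda>i. e i (the (a i))) is)"
  let ?h = "\<lambda>c a. a(j \<mapsto> c)"
  have j: "j \<notin> set js" using Cons.prems by simp
  have fin: "finite (S j)" "finite ?M" using Cons.prems by (auto intro: finite_choice_maps)
  have ec: "e j c \<in> carrier R" if "c \<in> S j" for c using Cons.prems that by simp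
  have Pc: "?P js a \<in> carrier R" if "a \<in> ?M" for a
    using that Cons.prems by (intro list_prod_closed) (auto simp: choice_maps_def)
  have "map (\<lambda>i. e i (the (?h c a i))) js = map (\<lambda>i. e i (the (a i))) js" for c a
    using j by (intro map_cong) auto
  then have Ph: "?P (j # js) (?h c a) = e j c \<otimes> ?P js a" for c a
    by (simp only: list.map list_prod_Cons fun_upd_same option.sel)
  have "finsum R (?P (j # js)) (choice_maps (set (j # js)) S)
      = finsum R (?P (j # js)) (\<Union>c\<in>S j. ?h c ` ?M)"
    by (simp only: list.set choice_maps_insert[OF j])
  also have "\<dots> = (\<Oplus>c\<in>S j. finsum R (?P (j # js)) (?h c ` ?M))"
  proof (rule add.finprod_UN_disjoint)
    show "pairwise (\<lambda>c d. disjnt (?h c ` ?M) (?h d ` ?M)) (S j)"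
      unfolding pairwise_def disjnt_def by (auto dest!: fun_cong[where x = j])
    show "?P (j # js) a \<in> carrier R" if "c \<in> S j" "a \<in> ?h c ` ?M" for c a
      using that ec Pc by (auto simp only: Ph intro!: m_closed)
  qed (use fin in auto)
  also have "\<dots> = (\<Oplus>c\<in>S j. e j c \<otimes> finsum R (?P js) ?M)"
  proof (rule finsum_cong'[OF refl])
    fix c assume c: "c \<in> S j"
    have "finsum R (?P (j # js)) (?h c ` ?M) = (\<Oplus>a\<in>?M. ?P (j # js) (?h c a))"
    proof (rule finsum_reindex[OF _ inj_on_update_choice_maps[OF j]])
      show "?P (j # js) \<in> ?h c ` ?M \<rightarrow> carrier R"
        using c ec Pc by (auto simp only: Ph intro!: m_closed)
    qed
    also have "\<dots> = e j c \<otimes> finsum R (?P js) ?M"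
      unfolding Ph using c ec Pc fin by (intro finsum_rdistr[symmetric]) auto
    finally show "finsum R (?P (j # js)) (?h c ` ?M) = e j c \<otimes> finsum R (?P js) ?M" .
  qed (use ec Pc in auto)
  also have "\<dots> = finsum R (e j) (S j) \<otimes> finsum R (?P js) ?M"
    using fin Pc ec by (intro finsum_ldistr[symmetric]) auto
  finally show ?case
    using Cons by simp
qed

section \<open>Partitions of unity on which a family acts diagonally\<close>

text \<open>The hypotheses hold for both players' answers to a fixed question with variable set \<open>W\<close>, so
  that what is proved here serves both.\<close>

locale diagonal_family = ring R for R (structure) +
  fixes W :: "'i set" and C :: "'c set" and A :: "('i \<rightharpoonup> 'c) set"
    and p :: "('i \<rightharpoonup> 'c) \<Rightarrow> 'a" and e :: "'i \<Rightarrow> 'c \<Rightarrow> 'a"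
  assumes finite_C: "finite C" and finite_A: "finite A"
    and ran: "a \<in> A \<Longrightarrow> ran a \<subseteq> C"
    and p_closed: "a \<in> A \<Longrightarrow> p a \<in> carrier R"
    and e_closed: "\<lbrakk>i \<in> W; c \<in> C\<rbrakk> \<Longrightarrow> e i c \<in> carrier R"
    and p_sum: "finsum R p A = \<one>"
    and p_zero: "\<lbrakk>a \<in> A; dom a \<noteq> W\<rbrakk> \<Longrightarrow> p a = \<zero>"
    and p_e: "\<lbrakk>a \<in> A; i \<in> W; c \<in> C\<rbrakk> \<Longrightarrow> p a \<otimes> e i c = (if a i = Some c then p a else \<zero>)"
begin

lemma p_expand: "x \<in> carrier R \<Longrightarrow> x = (\<Oplus>a\<in>A. p a \<otimes> x)"
  using finsum_ldistr[OF finite_A, of x p] p_closed p_sum by simp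

text \<open>Since the \<open>p a\<close> sum to one, left multiplication by all of them is jointly injective; each \<open>p a\<close>
  then acts as a character on the \<open>e i c\<close>.\<close>

lemma p_separates:
  assumes "x \<in> carrier R" "y \<in> carrier R" "\<And>a. a \<in> A \<Longrightarrow> p a \<otimes> x = p a \<otimes> y"
  shows "x = y"
proof -
  have "x = (\<Oplus>a\<in>A. p a \<otimes> x)" using assms(1) by (rule p_expand)
  also have "\<dots> = (\<Oplus>a\<in>A. p a \<otimes> y)" using assms p_closed by (intro finsum_cong') auto
  also have "\<dots> = y" using p_expand[OF assms(2)] ..
  finally show ?thesis .
qed

lemma p_e_e:
  assumes "a \<in> A" "i \<in> W" "c \<in> C" "j \<in> W" "d \<in> C"
  shows "p a \<otimes> (e i c \<otimes> e j d) = (if a i = Some c \<and> a j = Some d then p a else \<zero>)"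
  using assms by (simp add: p_closed e_closed p_e flip: m_assoc)

lemma e_idempotent: "\<lbrakk>i \<in> W; c \<in> C\<rbrakk> \<Longrightarrow> e i c \<otimes> e i c = e i c"
  by (rule p_separates) (auto simp: p_e_e p_e e_closed)

lemma e_commute: "\<lbrakk>i \<in> W; c \<in> C; j \<in> W; d \<in> C\<rbrakk> \<Longrightarrow> e i c \<otimes> e j d = e j d \<otimes> e i c"
  by (rule p_separates) (auto simp: p_e_e e_closed)

lemma e_sum:
  assumes i: "i \<in> W"
  shows "(\<Oplus>c\<in>C. e i c) = \<one>"
proof (rule p_separates)
  fix a assume a: "a \<in> A"
  have ec: "e i \<in> C \<rightarrow> carrier R" using e_closed[OF i] by auto
  show "p a \<otimes> (\<Oplus>c\<in>C. e i c) = p a \<otimes> \<one>"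
  proof (cases "dom a = W")
    case True
    then obtain c where c: "a i = Some c" "c \<in> C" using i ran[OF a] by (auto simp: ran_def)
    have "p a \<otimes> finsum R (e i) {c} = p a \<otimes> (\<Oplus>c\<in>C. e i c)"
      using a c i by (intro mult_finsum_support finite_C ec p_closed) (auto simp: p_e)
    then show ?thesis using a c i by (simp add: p_e e_closed p_closed)
  next
    case False
    then show ?thesis using a ec by (simp add: p_zero)
  qed
qed (use e_closed[OF i] in auto)

lemma p_list_prod:
  assumes "a \<in> A" "set is \<subseteq> W" "\<And>i. i \<in> set is \<Longrightarrow> f i \<in> C"
  shows "p a \<otimes> list_prod (map (\<lambda>i. e i (f i)) is) = (if \<forall>i \<in> set is. a i = Some (f i) then p a else \<zero>)"
  using assms(2,3)
proof (induction "is")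
  case (Cons i "is")
  have c: "p a \<in> carrier R" "e i (f i) \<in> carrier R" "list_prod (map (\<lambda>i. e i (f i)) is) \<in> carrier R"
    using Cons.prems assms(1) by (auto intro!: p_closed e_closed list_prod_closed)
  then have "p a \<otimes> list_prod (map (\<lambda>i. e i (f i)) (i # is))
      = (if a i = Some (f i) then p a else \<zero>) \<otimes> list_prod (map (\<lambda>i. e i (f i)) is)"
    using Cons.prems assms(1) by (simp add: p_e flip: m_assoc)
  then show ?case using Cons c by auto
qed (use assms(1) p_closed in simp)

text \<open>Expanding the product over \<open>1 = (\<Sum>b. p b)\<close>, the tuples \<open>b\<close> that agree with \<open>a\<close> on \<open>W\<close> survive;
  apart from \<open>a\<close> itself they have a domain other than \<open>W\<close> and so \<open>p b = \<zero>\<close>.\<close>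

lemma list_prod_e:
  assumes a: "a \<in> A" "dom a = W" and W: "set is = W"
  shows "list_prod (map (\<lambda>i. e i (the (a i))) is) = p a"
proof -
  let ?E = "list_prod (map (\<lambda>i. e i (the (a i))) is)"
  have aC: "the (a i) \<in> C" if "i \<in> W" for i
    using a that ran[OF a(1)] by (auto simp: ran_def)
  have pE: "p b \<otimes> ?E = (if a = b then p b else \<zero>)" if b: "b \<in> A" for b
  proof -
    have "p b \<otimes> ?E = (if \<forall>i \<in> W. b i = Some (the (a i)) then p b else \<zero>)"
      using p_list_prod[OF b, of "is" "\<lambda>i. the (a i)"] aC W by simp
    moreover have "a = b" if "dom b = W" "\<forall>i \<in> W. b i = Some (the (a i))"
    proof
      fix i show "a i = b i"
      proof (cases "i \<in> W")
        case True
        then obtain c where "a i = Some c" using a(2) by blast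
        then show ?thesis using that(2) True by simp
      next
        case False
        then show ?thesis using that(1) a(2) by (metis domIff)
      qed
    qed
    moreover have "\<forall>i \<in> W. b i = Some (the (a i))" if "a = b" using that a(2) by auto
    ultimately show ?thesis using p_zero[OF b] by auto
  qed
  have "?E \<in> carrier R" using aC W by (auto intro!: list_prod_closed e_closed)
  then have "?E = (\<Oplus>b\<in>A. p b \<otimes> ?E)" by (rule p_expand)
  also have "\<dots> = (\<Oplus>b\<in>A. if a = b then p b else \<zero>)"
    using p_closed by (intro finsum_cong') (auto simp: pE)
  also have "\<dots> = p a" using a(1) finite_A p_closed by (intro finsum_singleton) auto
  finally show ?thesis .
qed

end

section \<open>Isomorphisms between presented C*-algebras\<close>

context cstar_evaluation
begin

lemma eval_sum:
  "(\<And>i. i \<in> I \<Longrightarrow> f i \<in> free_star_alg G) \<Longrightarrow>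
    eval_poly A v (\<Sum>i\<in>I. f i) = (\<Oplus>i\<in>I. eval_poly A v (f i))"
  by (induction I rule: infinite_finite_induct) (auto simp: eval_add eval_closed free_sum)

lemma eval_prod_list:
  "set fs \<subseteq> free_star_alg G \<Longrightarrow> eval_poly A v (prod_list fs) = list_prod (map (eval_poly A v) fs)"
  by (induction fs) (auto simp: eval_mult free_prod_list)

lemma eval_cong:
  assumes "\<And>g. g \<in> G \<Longrightarrow> v g = w g" "f \<in> free_star_alg G"
  shows "eval_poly A v f = eval_poly A w f"
proof -
  interpret w: cstar_evaluation A G w by unfold_locales (use assms(1) v in auto)
  have "eval_word A v (Word ls) = eval_word A w (Word ls)" if "letter_base ` set ls \<subseteq> G" for ls
    using that
  proof (induction ls)
    case (Cons l ls)
    then have "eval_letter A v l = eval_letter A w l" using assms(1) by (cases l) auto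
    then show ?case using Cons by simp
  qed simp
  then have *: "eval_word A v x = eval_word A w x" if "word_gens x \<subseteq> G" for x
    using that by (cases x) auto
  show ?thesis
    using assms(2) by (induction f rule: free_induct) (simp_all add: eval_add w.eval_add eval_single w.eval_single *)
qed

end

lemma star_homD:
  assumes "\<phi> \<in> star_hom A B"
  shows "x \<in> carrier A \<Longrightarrow> \<phi> x \<in> carrier B"
    and "\<lbrakk>x \<in> carrier A; y \<in> carrier A\<rbrakk> \<Longrightarrow> \<phi> (x \<otimes>\<^bsub>A\<^esub> y) = \<phi> x \<otimes>\<^bsub>B\<^esub> \<phi> y"
    and "\<lbrakk>x \<in> carrier A; y \<in> carrier A\<rbrakk> \<Longrightarrow> \<phi> (x \<oplus>\<^bsub>A\<^esub> y) = \<phi> x \<oplus>\<^bsub>B\<^esub> \<phi> y"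
    and "\<phi> \<one>\<^bsub>A\<^esub> = \<one>\<^bsub>B\<^esub>"
    and "x \<in> carrier A \<Longrightarrow> \<phi> (c \<odot>\<^bsub>A\<^esub> x) = c \<odot>\<^bsub>B\<^esub> \<phi> x"
    and "x \<in> carrier A \<Longrightarrow> \<phi> (adj A x) = adj B (\<phi> x)"
  using assms by (auto simp: star_hom_def ring_hom_def)

lemma star_hom_eval:
  assumes A: "unital_cstar_algebra A" and B: "unital_cstar_algebra B" and \<phi>: "\<phi> \<in> star_hom A B"
    and v: "\<And>g. g \<in> G \<Longrightarrow> v g \<in> carrier A" and f: "f \<in> free_star_alg G"
  shows "\<phi> (eval_poly A v f) = eval_poly B (\<lambda>g. \<phi> (v g)) f"
proof -
  interpret A: unital_cstar_algebra A by (rule A)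
  interpret B: unital_cstar_algebra B by (rule B)
  note h = star_homD[OF \<phi>]
  interpret EA: cstar_evaluation A G v by unfold_locales (rule v)
  interpret EB: cstar_evaluation B G "\<lambda>g. \<phi> (v g)" by unfold_locales (intro h v)
  have \<phi>0: "\<phi> \<zero>\<^bsub>A\<^esub> = \<zero>\<^bsub>B\<^esub>"
    using h(5)[of "\<zero>\<^bsub>A\<^esub>" 0] h(1)[of "\<zero>\<^bsub>A\<^esub>"] by simp
  have "\<phi> (eval_word A v (Word ls)) = eval_word B (\<lambda>g. \<phi> (v g)) (Word ls)"
    if "letter_base ` set ls \<subseteq> G" for ls
    using that
  proof (induction ls)
    case (Cons l ls)
    have "v (letter_base l) \<in> carrier A" using Cons.prems v by simp
    then have "\<phi> (eval_letter A v l) = eval_letter B (\<lambda>g. \<phi> (v g)) l" "eval_letter A v l \<in> carrier A"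
      by (cases l; simp add: h)+
    moreover have "eval_word A v (Word ls) \<in> carrier A"
      using Cons.prems by (intro EA.word_closed) simp
    ultimately show ?case using Cons by (simp add: h(2))
  qed (simp add: h)
  then have word: "\<phi> (eval_word A v x) = eval_word B (\<lambda>g. \<phi> (v g)) x" if "word_gens x \<subseteq> G" for x
    using that by (cases x) auto
  show ?thesis
    using f by (induction f rule: free_induct)
      (simp_all add: word \<phi>0 EA.eval_add EB.eval_add EA.eval_single EB.eval_single EA.word_closed EA.eval_closed h)
qed

lemma universal_gen_closed:
  assumes "projection_relators G \<subseteq> R" "g \<in> G"
  shows "universal_gen G R g \<in> carrier (universal_cstar G R)"
  unfolding universal_gen_def universal_cstar_def
  by (intro completion_in cauchy_const universal_seminorm_csn assms free_gen)

text \<open>An endomorphism that fixes the generators fixes the dense set of their *-polynomials, and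
  contractivity carries this over to limits.\<close>

lemma universal_endomorphism_id:
  assumes R: "projection_relators G \<subseteq> R" 
    and \<phi>: "\<phi> \<in> star_hom (universal_cstar G R) (universal_cstar G R)"
    and x: "x \<in> carrier (universal_cstar G R)"
    and contr: "\<And>x. x \<in> carrier (universal_cstar G R) \<Longrightarrow>
      nrm (universal_cstar G R) (\<phi> x) \<le> nrm (universal_cstar G R) x"
    and gens: "\<And>g. g \<in> G \<Longrightarrow> \<phi> (universal_gen G R g) = universal_gen G R g"
  shows "\<phi> x = x"
proof -
  let ?U = "universal_cstar G R" and ?v = "universal_gen G R"
  note U = universal_cstar_algebra[OF R]
  interpret U: unital_cstar_algebra ?U by (rule U)
  interpret E: cstar_evaluation ?U G ?v by unfold_locales (rule universal_gen_closed[OF R])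
  note h = star_homD[OF \<phi>]
  have "nrm ?U (\<phi> x \<ominus>\<^bsub>?U\<^esub> x) \<le> e" if e: "e > 0" for e
  proof -
    obtain f where f: "f \<in> free_star_alg G" and d: "nrm ?U (x \<ominus>\<^bsub>?U\<^esub> eval_poly ?U ?v f) < e / 2"
      using universal_dense[OF R x, of "e / 2"] e by auto
    let ?f = "eval_poly ?U ?v f"
    have fc: "?f \<in> carrier ?U" by (rule E.eval_closed[OF f])
    have "\<phi> ?f = eval_poly ?U (\<lambda>g. \<phi> (?v g)) f"
      by (rule star_hom_eval[OF U U \<phi> universal_gen_closed[OF R] f])
    also have "\<dots> = ?f"
      by (rule E.eval_cong[symmetric]) (use gens f in auto)
    finally have \<phi>f: "\<phi> ?f = ?f" .
    have "\<ominus>\<^bsub>?U\<^esub> ?f = (-1) \<odot>\<^bsub>?U\<^esub> ?f" using fc by (simp add: U.smult_uminus)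
    then have "\<phi> (x \<ominus>\<^bsub>?U\<^esub> ?f) = \<phi> x \<ominus>\<^bsub>?U\<^esub> ?f"
      using x fc by (simp add: a_minus_def h(3,5) \<phi>f)
    then have "nrm ?U (\<phi> x \<ominus>\<^bsub>?U\<^esub> ?f) \<le> nrm ?U (x \<ominus>\<^bsub>?U\<^esub> ?f)"
      using contr[of "x \<ominus>\<^bsub>?U\<^esub> ?f"] x fc by simp
    then show ?thesis
      using U.dist_triangle[OF h(1)[OF x] fc x] U.dist_commute[OF fc x] d by simp
  qed
  then have "nrm ?U (\<phi> x \<ominus>\<^bsub>?U\<^esub> x) \<le> 0"
    by (rule field_le_epsilon[of _ 0, simplified])
  then have "nrm ?U (\<phi> x \<ominus>\<^bsub>?U\<^esub> x) = 0"
    using U.nrm_nonneg[of "\<phi> x \<ominus>\<^bsub>?U\<^esub> x"] h(1)[OF x] x by simp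
  then show ?thesis by (rule U.dist_eq_0[OF h(1)[OF x] x])
qed

lemma star_hom_compose:
  assumes "\<phi> \<in> star_hom A B" "\<psi> \<in> star_hom B C"
  shows "\<psi> \<circ> \<phi> \<in> star_hom A C"
  using assms unfolding star_hom_def ring_hom_def by (auto simp: Pi_def)

text \<open>As each substitution carries over the relations, the universal property yields *-homomorphisms
  in both directions. As the substitutions are mutually inverse on generators, both composites fix
  the generators, and \<open>universal_endomorphism_id\<close> makes them identities.\<close>

theorem universal_cstar_isomorphic:
  fixes F :: "'g \<Rightarrow> 'h star_poly" and F' :: "'h \<Rightarrow> 'g star_poly"
  assumes R: "projection_relators G \<subseteq> R" and R': "projection_relators H \<subseteq> R'"
    and F: "\<And>g. g \<in> G \<Longrightarrow> F g \<in> free_star_alg H" and F': "\<And>h. h \<in> H \<Longrightarrow> F' h \<in> free_star_alg G"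
  defines "U \<equiv> universal_cstar G R" and "U' \<equiv> universal_cstar H R'"
  defines "v \<equiv> universal_gen G R" and "v' \<equiv> universal_gen H R'"
  defines "w \<equiv> \<lambda>h. eval_poly U v (F' h)" and "w' \<equiv> \<lambda>g. eval_poly U' v' (F g)"
  assumes rel: "\<And>r. r \<in> R \<Longrightarrow> eval_poly U' w' r = \<zero>\<^bsub>U'\<^esub>"
    and rel': "\<And>r. r \<in> R' \<Longrightarrow> eval_poly U w r = \<zero>\<^bsub>U\<^esub>"
    and inv: "\<And>g. g \<in> G \<Longrightarrow> eval_poly U w (F g) = v g"
    and inv': "\<And>h. h \<in> H \<Longrightarrow> eval_poly U' w' (F' h) = v' h"
  shows "U \<cong>\<^sub>* U'"
proof -
  have U: "unital_cstar_algebra U" and U': "unital_cstar_algebra U'"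
    unfolding U_def U'_def by (intro universal_cstar_algebra R R')+
  have vc: "v g \<in> carrier U" if "g \<in> G" for g
    unfolding U_def v_def by (rule universal_gen_closed[OF R that])
  have vc': "v' h \<in> carrier U'" if "h \<in> H" for h
    unfolding U'_def v'_def by (rule universal_gen_closed[OF R' that])
  interpret E: cstar_evaluation U G v by (intro cstar_evaluation.intro U cstar_evaluation_axioms.intro vc)
  interpret E': cstar_evaluation U' H v' by (intro cstar_evaluation.intro U' cstar_evaluation_axioms.intro vc')
  have wc: "w h \<in> carrier U" if "h \<in> H" for h unfolding w_def by (intro E.eval_closed F' that)
  have wc': "w' g \<in> carrier U'" if "g \<in> G" for g unfolding w'_def by (intro E'.eval_closed F that)
  obtain \<phi> where \<phi>: "\<phi> \<in> star_hom U U'" "\<And>g. g \<in> G \<Longrightarrow> \<phi> (v g) = w' g"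
    "\<And>x. x \<in> carrier U \<Longrightarrow> nrm U' (\<phi> x) \<le> nrm U x"
    using universal_property[OF R U' wc' rel] unfolding U_def v_def by blast
  obtain \<psi> where \<psi>: "\<psi> \<in> star_hom U' U" "\<And>h. h \<in> H \<Longrightarrow> \<psi> (v' h) = w h"
    "\<And>x. x \<in> carrier U' \<Longrightarrow> nrm U (\<psi> x) \<le> nrm U' x"
    using universal_property[OF R' U wc rel'] unfolding U'_def v'_def by blast
  note h = star_homD(1)[OF \<phi>(1)] and h' = star_homD(1)[OF \<psi>(1)]
  interpret Ew: cstar_evaluation U H w by (intro cstar_evaluation.intro U cstar_evaluation_axioms.intro wc)
  interpret Ew': cstar_evaluation U' G w' by (intro cstar_evaluation.intro U' cstar_evaluation_axioms.intro wc')
  have 1: "\<psi> (w' g) = v g" if g: "g \<in> G" for g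
  proof -
    have "\<psi> (w' g) = eval_poly U (\<lambda>h. \<psi> (v' h)) (F g)"
      unfolding w'_def by (rule star_hom_eval[OF U' U \<psi>(1) vc' F[OF g]])
    also have "\<dots> = eval_poly U w (F g)"
      by (rule Ew.eval_cong[symmetric]) (use \<psi>(2) F[OF g] in auto)
    finally show ?thesis using inv[OF g] by simp
  qed
  have 2: "\<phi> (w h) = v' h" if g: "h \<in> H" for h
  proof -
    have "\<phi> (w h) = eval_poly U' (\<lambda>g. \<phi> (v g)) (F' h)"
      unfolding w_def by (rule star_hom_eval[OF U U' \<phi>(1) vc F'[OF g]])
    also have "\<dots> = eval_poly U' w' (F' h)"
      by (rule Ew'.eval_cong[symmetric]) (use \<phi>(2) F'[OF g] in auto)
    finally show ?thesis using inv'[OF g] by simp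
  qed
  have "(\<psi> \<circ> \<phi>) x = x" if "x \<in> carrier U" for x
    using star_hom_compose[OF \<phi>(1) \<psi>(1)] that unfolding U_def
  proof (rule universal_endomorphism_id[OF R])
    fix y assume "y \<in> carrier (universal_cstar G R)"
    then show "nrm (universal_cstar G R) ((\<psi> \<circ> \<phi>) y) \<le> nrm (universal_cstar G R) y"
      using \<phi>(3)[of y] \<psi>(3)[OF h, of y] unfolding U_def by (simp add: order_trans)
  qed (use \<phi>(2) 1 in \<open>simp_all add: v_def\<close>)
  moreover have "(\<phi> \<circ> \<psi>) x = x" if "x \<in> carrier U'" for x
    using star_hom_compose[OF \<psi>(1) \<phi>(1)] that unfolding U'_def
  proof (rule universal_endomorphism_id[OF R'])
    fix y assume "y \<in> carrier (universal_cstar H R')"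
    then show "nrm (universal_cstar H R') ((\<phi> \<circ> \<psi>) y) \<le> nrm (universal_cstar H R') y"
      using \<psi>(3)[of y] \<phi>(3)[OF h', of y] unfolding U'_def by (simp add: order_trans)
  qed (use \<psi>(2) 2 in \<open>simp_all add: v'_def\<close>)
  ultimately have "bij_betw \<phi> (carrier U) (carrier U')"
    using h h' by (intro bij_betw_byWitness[where f' = \<psi>]) auto
  then show ?thesis unfolding star_isomorphic_def using \<phi>(1) by blast
qed

section \<open>Projections\<close>

context unital_cstar_algebra
begin

definition projections :: "'a set" where
  "projections = {x \<in> carrier A. x \<otimes> x = x \<and> adj A x = x}"

lemma projections_closed: "x \<in> projections \<Longrightarrow> x \<in> carrier A"
  by (simp add: projections_def)

lemma projectionsD: "x \<in> projections \<Longrightarrow> x \<otimes> x = x" "x \<in> projections \<Longrightarrow> adj A x = x"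
  by (simp_all add: projections_def)

lemma adj_finsum: "f \<in> I \<rightarrow> carrier A \<Longrightarrow> adj A (finsum A f I) = (\<Oplus>i\<in>I. adj A (f i))"
  by (induction I rule: infinite_finite_induct) (auto simp: adj_add Pi_iff)

lemma zero_projection: "\<zero> \<in> projections"
  by (simp add: projections_def)

lemma list_prod_projection:
  assumes "set xs \<subseteq> projections" "\<And>x y. \<lbrakk>x \<in> set xs; y \<in> set xs\<rbrakk> \<Longrightarrow> x \<otimes> y = y \<otimes> x"
  shows "list_prod xs \<in> projections"
proof -
  have c: "set xs \<subseteq> carrier A" using assms(1) projections_closed by blast
  have "adj A (list_prod xs) = list_prod xs"
    using assms
  proof (induction xs)
    case (Cons x xs)
    have x: "x \<in> carrier A" "list_prod xs \<in> carrier A" "adj A x = x"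
      using Cons.prems(1) by (auto simp: projections_def intro!: list_prod_closed)
    have "x \<otimes> list_prod xs = list_prod xs \<otimes> x"
      using Cons.prems by (intro list_prod_commute) (auto simp: projections_def)
    then show ?case using Cons x by (simp add: adj_mult)
  qed simp
  moreover have "list_prod xs \<otimes> list_prod xs = list_prod xs"
    using assms projectionsD by (intro list_prod_idempotent c) blast+
  ultimately show ?thesis using c by (simp add: projections_def list_prod_closed)
qed

end

lemma (in cstar_evaluation) projection_relators_vanish_iff:
  "(\<forall>r \<in> projection_relators G. eval_poly A v r = \<zero>) \<longleftrightarrow> (\<forall>g \<in> G. v g \<in> projections)"
proof -
  have "eval_poly A v (gen g * gen g - gen g) = \<zero> \<longleftrightarrow> v g \<otimes> v g = v g"
    "eval_poly A v (poly_star (gen g) - gen g) = \<zero> \<longleftrightarrow> adj A (v g) = v g" if "g \<in> G" for g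
    using that v[OF that] free_gen[OF that]
    by (simp_all add: eval_diff eval_mult eval_star eval_gen minus_eq_zero_iff)
  then show ?thesis
    using v unfolding projection_relators_def projections_def by blast
qed

section \<open>Representations of the two presentations\<close>

locale assignment_game =
  fixes n :: nat and C :: "'c set" and V :: "'q \<Rightarrow> nat set" and X Y :: "'q set"
    and A B :: "(nat \<rightharpoonup> 'c) set" and lam :: "'q \<Rightarrow> 'q \<Rightarrow> (nat \<rightharpoonup> 'c) \<Rightarrow> (nat \<rightharpoonup> 'c) \<Rightarrow> bool"
  assumes game: "variable_assignment_game n C V X Y A B lam"
begin

lemma A_eq: "A = tuples n C" and B_eq: "B = tuples n C" and finite_values: "finite C"
  using game by (simp_all add: variable_assignment_game_def)

lemma finite_AB: "finite A" "finite B"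
proof -
  have "nonsignalling_game X Y A B lam"
    using game unfolding variable_assignment_game_def by (elim conjE)
  then show "finite A" "finite B" by (simp_all add: nonsignalling_game_def)
qed

lemma tuple_value: "\<lbrakk>a \<in> tuples n C; i \<in> dom a\<rbrakk> \<Longrightarrow> the (a i) \<in> C"
  by (auto simp: tuples_def ran_def)

lemma V_subset: "z \<in> X \<union> Y \<Longrightarrow> V z \<subseteq> {1..n}"
  using game unfolding variable_assignment_game_def by (elim conjE) (rule bspec)

lemma finite_V: "z \<in> X \<union> Y \<Longrightarrow> finite (V z)"
  using V_subset finite_subset by blast

lemma questions_exist: "i \<in> {1..n} \<Longrightarrow> \<exists>x \<in> X. \<exists>y \<in> Y. i \<in> V x \<inter> V y"
  using game unfolding variable_assignment_game_def by (elim conjE) (rule bspec)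

lemma lamD:
  assumes "x \<in> X" "y \<in> Y" "a \<in> A" "b \<in> B" "lam x y a b"
  shows "dom a = V x" "dom b = V y" "\<And>i. i \<in> V x \<Longrightarrow> i \<in> V y \<Longrightarrow> a i = b i"
proof -
  have "\<forall>x \<in> X. \<forall>y \<in> Y. \<forall>a \<in> A. \<forall>b \<in> B. lam x y a b \<longrightarrow>
      dom a = V x \<and> dom b = V y \<and> (\<forall>i \<in> V x \<inter> V y. a i = b i)"
    using game unfolding variable_assignment_game_def by (elim conjE)
  then have "dom a = V x \<and> dom b = V y \<and> (\<forall>i \<in> V x \<inter> V y. a i = b i)"
    using assms by simp
  then show "dom a = V x" "dom b = V y" "\<And>i. i \<in> V x \<Longrightarrow> i \<in> V y \<Longrightarrow> a i = b i"
    by auto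
qed

lemma tuples_dom: "z \<in> X \<union> Y \<Longrightarrow> dom a = V z \<Longrightarrow> a \<in> tuples n C \<longleftrightarrow> ran a \<subseteq> C"
  using V_subset[of z] by (simp add: tuples_def)

lemma choice_maps_eq:
  assumes z: "z \<in> X \<union> Y"
  shows "choice_maps (V z) (\<lambda>_. C) = {a \<in> tuples n C. dom a = V z}"
proof -
  have "(\<forall>i \<in> dom a. the (a i) \<in> C) \<longleftrightarrow> ran a \<subseteq> C" for a :: "nat \<rightharpoonup> 'c"
    by (force simp: ran_def dom_def)
  then show ?thesis
    using tuples_dom[OF z] unfolding choice_maps_def by (metis (mono_tags, lifting) Collect_cong)
qed

text \<open>Any question to the first player about \<open>i\<close> would do: by \<open>P_eq_Q\<close>, the marginals at \<open>i\<close> agree for all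
  questions in whose variable set \<open>i\<close> occurs.\<close>

definition question :: "nat \<Rightarrow> 'q" where
  "question i = (SOME x. x \<in> X \<and> i \<in> V x)"

lemma question: "i \<in> {1..n} \<Longrightarrow> question i \<in> X \<and> i \<in> V (question i)"
  unfolding question_def by (rule someI_ex) (use questions_exist in blast)

end

definition (in ring) marginal :: "('i \<rightharpoonup> 'c) set \<Rightarrow> (('i \<rightharpoonup> 'c) \<Rightarrow> 'a) \<Rightarrow> 'i \<Rightarrow> 'c \<Rightarrow> 'a" where
  "marginal S r i c = finsum R r {a \<in> S. a i = Some c}"

text \<open>The relations of a presentation as equations in a C*-algebra; they are tied to the vanishing of
  evaluated relators by \<open>game_relators_vanish_iff\<close> and \<open>assignment_relators_vanish_iff\<close>.\<close>

locale game_representation = unital_cstar_algebra D + assignment_game n C V X Y A B lam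
  for D :: "('d, 'm) cstar_alg_scheme" (structure)
    and n :: nat and C :: "'c set" and V :: "'q \<Rightarrow> nat set" and X Y :: "'q set"
    and A B :: "(nat \<rightharpoonup> 'c) set" and lam :: "'q \<Rightarrow> 'q \<Rightarrow> (nat \<rightharpoonup> 'c) \<Rightarrow> (nat \<rightharpoonup> 'c) \<Rightarrow> bool" +
  fixes p q :: "'q \<Rightarrow> (nat \<rightharpoonup> 'c) \<Rightarrow> 'd"
  assumes p_proj: "\<lbrakk>x \<in> X; a \<in> A\<rbrakk> \<Longrightarrow> p x a \<in> projections"
    and q_proj: "\<lbrakk>y \<in> Y; b \<in> B\<rbrakk> \<Longrightarrow> q y b \<in> projections"
    and p_sum: "x \<in> X \<Longrightarrow> finsum D (p x) A = \<one>"
    and q_sum: "y \<in> Y \<Longrightarrow> finsum D (q y) B = \<one>"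
    and p_q: "\<lbrakk>x \<in> X; y \<in> Y; a \<in> A; b \<in> B; \<not> lam x y a b\<rbrakk> \<Longrightarrow> p x a \<otimes> q y b = \<zero>"
begin

lemma p_closed: "\<lbrakk>x \<in> X; a \<in> A\<rbrakk> \<Longrightarrow> p x a \<in> carrier D"
  and q_closed: "\<lbrakk>y \<in> Y; b \<in> B\<rbrakk> \<Longrightarrow> q y b \<in> carrier D"
  using p_proj q_proj projections_closed by auto

lemma p_funcset: "x \<in> X \<Longrightarrow> p x \<in> A \<rightarrow> carrier D"
  and q_funcset: "y \<in> Y \<Longrightarrow> q y \<in> B \<rightarrow> carrier D"
  using p_closed q_closed by auto

text \<open>A tuple with the wrong domain loses against every answer of the other player. This needs a
  question to the other player, which exists as soon as there is a variable; and without variables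
  all domains are empty.\<close>

lemma p_wrong_dom:
  assumes "x \<in> X" "a \<in> A" "dom a \<noteq> V x"
  shows "p x a = \<zero>"
proof -
  have "dom a \<subseteq> {1..n}" "V x \<subseteq> {1..n}"
    using assms V_subset by (auto simp: A_eq tuples_def)
  then obtain i where "i \<in> {1..n}" using assms(3) by blast
  then obtain y where y: "y \<in> Y" using questions_exist by blast
  have "p x a \<otimes> q y b = \<zero>" if "b \<in> B" for b
    using p_q lamD(1) assms y that by blast
  then have "p x a \<otimes> finsum D (q y) B = \<zero>"
    using assms y by (intro mult_finsum_zero finite_AB q_funcset p_closed) auto
  then show ?thesis using q_sum[OF y] p_closed assms by simp
qed

lemma q_wrong_dom:
  assumes "y \<in> Y" "b \<in> B" "dom b \<noteq> V y"
  shows "q y b = \<zero>"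
proof -
  have "dom b \<subseteq> {1..n}" "V y \<subseteq> {1..n}"
    using assms V_subset by (auto simp: B_eq tuples_def)
  then obtain i where "i \<in> {1..n}" using assms(3) by blast
  then obtain x where x: "x \<in> X" using questions_exist by blast
  have "p x a \<otimes> q y b = \<zero>" if "a \<in> A" for a
    using p_q lamD(2) assms x that by blast
  then have "finsum D (p x) A \<otimes> q y b = \<zero>"
    using assms x by (intro finsum_mult_zero finite_AB p_funcset q_closed) auto
  then show ?thesis using p_sum[OF x] q_closed assms by simp
qed

abbreviation P where "P x i c \<equiv> marginal A (p x) i c"
abbreviation Q where "Q y i c \<equiv> marginal B (q y) i c"

lemma P_closed: "x \<in> X \<Longrightarrow> P x i c \<in> carrier D"
  and Q_closed: "y \<in> Y \<Longrightarrow> Q y i c \<in> carrier D"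
  unfolding marginal_def using p_closed q_closed by (auto intro!: finsum_closed)

lemma p_Q:
  assumes "x \<in> X" "y \<in> Y" "i \<in> V x" "i \<in> V y" "a \<in> A"
  shows "p x a \<otimes> Q y i c = (if a i = Some c then p x a else \<zero>)"
proof (cases "a i = Some c")
  case True
  have "p x a \<otimes> Q y i c = p x a \<otimes> finsum D (q y) B"
    unfolding marginal_def
    using assms True lamD(3)[OF assms(1,2,5) _ _ assms(3,4)]
    by (intro mult_finsum_support finite_AB q_funcset p_closed p_q) auto
  then show ?thesis using assms True q_sum p_closed by simp
next
  case False
  have "p x a \<otimes> Q y i c = \<zero>"
    unfolding marginal_def
    using assms False lamD(3)[OF assms(1,2,5) _ _ assms(3,4)] q_closed finite_AB
    by (intro mult_finsum_zero p_closed p_q) auto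
  then show ?thesis using False by simp
qed

lemma P_q:
  assumes "x \<in> X" "y \<in> Y" "i \<in> V x" "i \<in> V y" "b \<in> B"
  shows "P x i c \<otimes> q y b = (if b i = Some c then q y b else \<zero>)"
proof (cases "b i = Some c")
  case True
  have "P x i c \<otimes> q y b = finsum D (p x) A \<otimes> q y b"
    unfolding marginal_def
    using assms True lamD(3)[OF assms(1,2) _ assms(5) _ assms(3,4)]
    by (intro finsum_mult_support finite_AB p_funcset q_closed p_q) auto
  then show ?thesis using assms True p_sum q_closed by simp
next
  case False
  have "P x i c \<otimes> q y b = \<zero>"
    unfolding marginal_def
    using assms False lamD(3)[OF assms(1,2) _ assms(5) _ assms(3,4)] p_closed finite_AB
    by (intro finsum_mult_zero q_closed p_q) auto
  then show ?thesis using False by simp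
qed

text \<open>Summing \<open>p_Q\<close> over the tuples with value \<open>c\<close> at \<open>i\<close> evaluates \<open>P x i c \<otimes> Q y i c\<close> to its first
  factor, and summing \<open>P_q\<close> evaluates it to its second. In particular the marginals of any two
  questions to the same player agree, by comparison with a question to the other player.\<close>

lemma P_eq_Q:
  assumes "x \<in> X" "y \<in> Y" "i \<in> V x" "i \<in> V y"
  shows "P x i c = Q y i c"
proof -
  let ?S = "{a \<in> A. a i = Some c}" and ?T = "{b \<in> B. b i = Some c}"
  have S: "finite ?S" "p x \<in> ?S \<rightarrow> carrier D" and T: "finite ?T" "q y \<in> ?T \<rightarrow> carrier D"
    using finite_AB p_closed q_closed assms by auto
  have "P x i c \<otimes> Q y i c = (\<Oplus>a\<in>?S. p x a \<otimes> Q y i c)"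
    unfolding marginal_def[of A] by (rule finsum_ldistr[OF S(1) Q_closed[OF assms(2)] S(2)])
  also have "\<dots> = P x i c"
    unfolding marginal_def[of A] using S assms by (intro finsum_cong') (auto simp: p_Q)
  finally have 1: "P x i c \<otimes> Q y i c = P x i c" .
  have "P x i c \<otimes> Q y i c = (\<Oplus>b\<in>?T. P x i c \<otimes> q y b)"
    unfolding marginal_def[of B] by (rule finsum_rdistr[OF T(1) P_closed[OF assms(1)] T(2)])
  also have "\<dots> = Q y i c"
    unfolding marginal_def[of B] using T assms by (intro finsum_cong') (auto simp: P_q)
  finally show ?thesis using 1 by simp
qed

definition e :: "nat \<Rightarrow> 'c \<Rightarrow> 'd" where
  "e i c = P (question i) i c"

lemma e_eq_Q: "\<lbrakk>y \<in> Y; i \<in> V y\<rbrakk> \<Longrightarrow> e i c = Q y i c"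
  unfolding e_def using V_subset[of y] question[of i] by (intro P_eq_Q) auto

lemma e_eq_P:
  assumes "x \<in> X" "i \<in> V x"
  shows "e i c = P x i c"
proof -
  have "i \<in> {1..n}" using V_subset assms by blast
  then obtain y where "y \<in> Y" "i \<in> V y" using questions_exist by blast
  then show ?thesis using P_eq_Q[OF assms(1) _ assms(2)] e_eq_Q by simp
qed

lemma e_closed: "i \<in> {1..n} \<Longrightarrow> e i c \<in> carrier D"
  unfolding e_def using question by (intro P_closed) auto

lemma e_adj: "i \<in> {1..n} \<Longrightarrow> adj D (e i c) = e i c"
  unfolding e_def marginal_def using question[of i] p_proj
  by (subst adj_finsum) (auto simp: projections_def intro!: finsum_cong')

lemma p_e:
  assumes "x \<in> X" "i \<in> V x" "a \<in> A"
  shows "p x a \<otimes> e i c = (if a i = Some c then p x a else \<zero>)"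
proof -
  have "i \<in> {1..n}" using V_subset assms by blast
  then obtain y where "y \<in> Y" "i \<in> V y" using questions_exist by blast
  then show ?thesis using p_Q assms e_eq_Q by simp
qed

text \<open>The second player's projections arise on the right of \<open>P x i c\<close>; passing to adjoints moves them
  to the left, where the diagonal action is needed.\<close>

lemma q_e:
  assumes y: "y \<in> Y" "i \<in> V y" "b \<in> B"
  shows "q y b \<otimes> e i c = (if b i = Some c then q y b else \<zero>)"
proof -
  have i: "i \<in> {1..n}" using V_subset y by blast
  then obtain x where x: "x \<in> X" "i \<in> V x" using questions_exist by blast
  have "e i c \<otimes> q y b = (if b i = Some c then q y b else \<zero>)"
    using P_q x y e_eq_P by simp
  moreover have "q y b \<otimes> e i c = adj D (e i c \<otimes> q y b)"
    using e_closed[OF i] e_adj[OF i] q_proj[OF y(1,3)] by (simp add: adj_mult projections_def)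
  ultimately show ?thesis using q_proj[OF y(1,3)] by (simp add: projections_def)
qed

lemma p_diagonal:
  assumes x: "x \<in> X"
  shows "diagonal_family D (V x) C A (p x) e"
proof (intro diagonal_family.intro diagonal_family_axioms.intro ring_axioms finite_values finite_AB)
  show "finsum D (p x) A = \<one>" by (rule p_sum[OF x])
  show "e i c \<in> carrier D" if "i \<in> V x" for i c
    using e_closed V_subset[of x] x that by blast
  fix a assume a: "a \<in> A"
  show "ran a \<subseteq> C" using a by (simp add: A_eq tuples_def)
  show "p x a \<in> carrier D" by (rule p_closed[OF x a])
  show "p x a = \<zero>" if "dom a \<noteq> V x" by (rule p_wrong_dom[OF x a that])
  show "p x a \<otimes> e i c = (if a i = Some c then p x a else \<zero>)" if "i \<in> V x" for i c
    by (rule p_e[OF x that a])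
qed

lemma q_diagonal:
  assumes y: "y \<in> Y"
  shows "diagonal_family D (V y) C B (q y) e"
proof (intro diagonal_family.intro diagonal_family_axioms.intro ring_axioms finite_values finite_AB)
  show "finsum D (q y) B = \<one>" by (rule q_sum[OF y])
  show "e i c \<in> carrier D" if "i \<in> V y" for i c
    using e_closed V_subset[of y] y that by blast
  fix b assume b: "b \<in> B"
  show "ran b \<subseteq> C" using b by (simp add: B_eq tuples_def)
  show "q y b \<in> carrier D" by (rule q_closed[OF y b])
  show "q y b = \<zero>" if "dom b \<noteq> V y" by (rule q_wrong_dom[OF y b that])
  show "q y b \<otimes> e i c = (if b i = Some c then q y b else \<zero>)" if "i \<in> V y" for i c
    by (rule q_e[OF y that b])
qed

lemma p_eq_list_prod:
  assumes "x \<in> X" "a \<in> A" "dom a = V x"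
  shows "list_prod (map (\<lambda>i. e i (the (a i))) (sorted_list_of_set (V x))) = p x a"
  by (rule diagonal_family.list_prod_e[OF p_diagonal[OF assms(1)] assms(2,3)])
    (use assms(1) finite_V[of x] in simp)

lemma q_eq_list_prod:
  assumes "y \<in> Y" "b \<in> B" "dom b = V y"
  shows "list_prod (map (\<lambda>i. e i (the (b i))) (sorted_list_of_set (V y))) = q y b"
  by (rule diagonal_family.list_prod_e[OF q_diagonal[OF assms(1)] assms(2,3)])
    (use assms(1) finite_V[of y] in simp)

end

locale assignment_representation = unital_cstar_algebra D + assignment_game n C V X Y A B lam
  for D :: "('d, 'm) cstar_alg_scheme" (structure)
    and n :: nat and C :: "'c set" and V :: "'q \<Rightarrow> nat set" and X Y :: "'q set"
    and A B :: "(nat \<rightharpoonup> 'c) set" and lam :: "'q \<Rightarrow> 'q \<Rightarrow> (nat \<rightharpoonup> 'c) \<Rightarrow> (nat \<rightharpoonup> 'c) \<Rightarrow> bool" +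
  fixes e :: "nat \<Rightarrow> 'c \<Rightarrow> 'd"
  assumes e_proj: "\<lbrakk>i \<in> {1..n}; c \<in> C\<rbrakk> \<Longrightarrow> e i c \<in> projections"
    and e_sum: "i \<in> {1..n} \<Longrightarrow> finsum D (e i) C = \<one>"
    and e_commute: "\<lbrakk>z \<in> X \<union> Y; i \<in> V z; j \<in> V z; c \<in> C; d \<in> C\<rbrakk> \<Longrightarrow> e i c \<otimes> e j d = e j d \<otimes> e i c"
    and e_orth: "\<lbrakk>x \<in> X; y \<in> Y; dom a = V x; ran a \<subseteq> C; dom b = V y; ran b \<subseteq> C; \<not> lam x y a b\<rbrakk> \<Longrightarrow>
      list_prod (map (\<lambda>i. e i (the (a i))) (sorted_list_of_set (V x))) \<otimes>
      list_prod (map (\<lambda>i. e i (the (b i))) (sorted_list_of_set (V y))) = \<zero>"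
begin

text \<open>Tuples with a domain other than \<open>V z\<close> are never accepted, hence the value zero.\<close>

definition answer :: "'q \<Rightarrow> (nat \<rightharpoonup> 'c) \<Rightarrow> 'd" where
  "answer z a = (if dom a = V z then list_prod (map (\<lambda>i. e i (the (a i))) (sorted_list_of_set (V z))) else \<zero>)"

lemma e_closed: "\<lbrakk>i \<in> {1..n}; c \<in> C\<rbrakk> \<Longrightarrow> e i c \<in> carrier D"
  using e_proj projections_closed by blast

lemma answer_proj:
  assumes z: "z \<in> X \<union> Y" and a: "a \<in> tuples n C"
  shows "answer z a \<in> projections"
proof (cases "dom a = V z")
  case True
  have "the (a i) \<in> C" "i \<in> {1..n}" if "i \<in> V z" for i
    using that True tuple_value[OF a] V_subset[OF z] by auto
  then have "list_prod (map (\<lambda>i. e i (the (a i))) (sorted_list_of_set (V z))) \<in> projections"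
    using finite_V[OF z] by (intro list_prod_projection) (auto intro!: e_proj e_commute[OF z])
  then show ?thesis using True by (simp add: answer_def)
qed (simp add: answer_def zero_projection)

lemma answer_closed: "\<lbrakk>z \<in> X \<union> Y; a \<in> tuples n C\<rbrakk> \<Longrightarrow> answer z a \<in> carrier D"
  using answer_proj projections_closed by blast

lemma finite_tuples: "finite (tuples n C)"
  using finite_AB A_eq by simp

text \<open>Used for the set of all tuples, with \<open>S i = C\<close>, and for those with value \<open>c\<close> at \<open>i\<close>, with
  \<open>S i = {c}\<close>.\<close>

lemma finsum_answer:
  assumes z: "z \<in> X \<union> Y" and T: "T \<subseteq> tuples n C"
    and eq: "{a \<in> T. dom a = V z} = choice_maps (V z) S" and S: "\<And>i. i \<in> V z \<Longrightarrow> S i \<subseteq> C"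
  shows "finsum D (answer z) T = list_prod (map (\<lambda>i. finsum D (e i) (S i)) (sorted_list_of_set (V z)))"
proof -
  let ?l = "sorted_list_of_set (V z)"
  have l: "set ?l = V z" "distinct ?l" using finite_V[OF z] by auto
  have fS: "finite (S i)" if "i \<in> V z" for i
    using S[OF that] finite_values finite_subset by blast
  have ec: "e i c \<in> carrier D" if "i \<in> V z" "c \<in> S i" for i c
    using e_closed V_subset[OF z] S that by blast
  have "finsum D (answer z) T = finsum D (answer z) {a \<in> T. dom a = V z}"
    using T finite_subset[OF T finite_tuples] answer_closed[OF z]
    by (intro add.finprod_mono_neutral_cong_right) (auto simp: answer_def)
  also have "\<dots> = (\<Oplus>a\<in>choice_maps (V z) S. list_prod (map (\<lambda>i. e i (the (a i))) ?l))"
  proof (rule finsum_cong'[OF eq])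
    fix a assume "a \<in> choice_maps (V z) S"
    then have "a \<in> {a \<in> T. dom a = V z}" by (simp only: eq)
    then show "answer z a = list_prod (map (\<lambda>i. e i (the (a i))) ?l)" by (simp add: answer_def)
  next
    show "(\<lambda>a. list_prod (map (\<lambda>i. e i (the (a i))) ?l)) \<in> choice_maps (V z) S \<rightarrow> carrier D"
    proof
      fix a assume a: "a \<in> choice_maps (V z) S"
      show "list_prod (map (\<lambda>i. e i (the (a i))) ?l) \<in> carrier D"
      proof (intro list_prod_closed subsetI)
        fix x assume "x \<in> set (map (\<lambda>i. e i (the (a i))) ?l)"
        then obtain i where "i \<in> V z" "x = e i (the (a i))" using l by auto
        moreover from this have "the (a i) \<in> S i" using a by (simp add: choice_maps_def)
        ultimately show "x \<in> carrier D" using ec by blast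
      qed
    qed
  qed
  also have "\<dots> = list_prod (map (\<lambda>i. finsum D (e i) (S i)) ?l)"
    using list_prod_finsum[OF l(2), of S e] fS ec unfolding l(1) by blast
  finally show ?thesis .
qed

lemma answer_sum:
  assumes z: "z \<in> X \<union> Y"
  shows "finsum D (answer z) (tuples n C) = \<one>"
proof -
  have "finsum D (answer z) (tuples n C) = list_prod (map (\<lambda>i. finsum D (e i) C) (sorted_list_of_set (V z)))"
    by (intro finsum_answer z) (simp_all add: choice_maps_eq[OF z])
  also have "\<dots> = \<one>"
    using e_sum V_subset[OF z] finite_V[OF z] by (intro list_prod_ones) auto
  finally show ?thesis .
qed

text \<open>Only the factor with index \<open>i\<close> is restricted to a single value; all others sum to one.\<close>

lemma answer_marginal:
  assumes z: "z \<in> X \<union> Y" and i: "i \<in> V z" and c: "c \<in> C"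
  shows "marginal (tuples n C) (answer z) i c = e i c"
proof -
  let ?S = "\<lambda>j. if j = i then {c} else C"
  have i': "i \<in> {1..n}" using V_subset[OF z] i by blast
  have "a \<in> choice_maps (V z) ?S \<longleftrightarrow> a \<in> choice_maps (V z) (\<lambda>_. C) \<and> a i = Some c" for a
  proof (cases "dom a = V z")
    case True
    then have "i \<in> dom a" using i by simp
    then obtain d where d: "a i = Some d" by auto
    have "the (a j) \<in> ?S j \<longleftrightarrow> the (a j) \<in> C \<and> (j = i \<longrightarrow> d = c)" for j
      using d c by auto
    then have "(\<forall>j \<in> V z. the (a j) \<in> ?S j) \<longleftrightarrow> (\<forall>j \<in> V z. the (a j) \<in> C) \<and> d = c"
      using i by blast
    then show ?thesis unfolding choice_maps_def mem_Collect_eq d using True by simp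
  qed (simp add: choice_maps_def)
  then have eq: "{a \<in> {a \<in> tuples n C. a i = Some c}. dom a = V z} = choice_maps (V z) ?S"
    unfolding choice_maps_eq[OF z] by (intro Set.set_eqI) (simp only: mem_Collect_eq conj_ac)
  have "marginal (tuples n C) (answer z) i c
      = list_prod (map (\<lambda>j. finsum D (e j) (?S j)) (sorted_list_of_set (V z)))"
    unfolding marginal_def
  proof (rule finsum_answer[OF z _ eq])
    show "?S j \<subseteq> C" for j using c by simp
  qed blast
  also have "map (\<lambda>j. finsum D (e j) (?S j)) (sorted_list_of_set (V z))
      = map (\<lambda>j. if j = i then e i c else \<one>) (sorted_list_of_set (V z))"
  proof (rule map_cong[OF refl])
    fix j assume "j \<in> set (sorted_list_of_set (V z))"
    then have "j \<in> {1..n}" using finite_V[OF z] V_subset[OF z] by auto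
    then show "finsum D (e j) (?S j) = (if j = i then e i c else \<one>)"
      using e_sum e_closed[OF i' c] by simp
  qed
  also have "list_prod \<dots> = e i c"
    using finite_V[OF z] i e_closed[OF i' c] by (intro list_prod_single) auto
  finally show ?thesis .
qed

lemma answer_orth:
  assumes "x \<in> X" "y \<in> Y" "a \<in> A" "b \<in> B" "\<not> lam x y a b"
  shows "answer x a \<otimes> answer y b = \<zero>"
proof -
  have "answer x a \<in> carrier D" "answer y b \<in> carrier D"
    using assms answer_closed by (auto simp: A_eq B_eq)
  then show ?thesis
    using assms e_orth[of x y a b] by (auto simp: answer_def A_eq B_eq tuples_def)
qed

end

text \<open>The families \<open>p\<close>, \<open>q\<close>, \<open>e\<close> need to agree with the valuation \<open>v\<close> of the generators only within
  the index sets, because they are instantiated below with families defined by their own formulas.\<close>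

context assignment_game
begin

lemma game_relators_vanish_iff:
  fixes D :: "('d, 'm) cstar_alg_scheme" (structure)
  assumes ev: "cstar_evaluation D (game_gens X Y A B) v"
    and p: "\<And>x a. \<lbrakk>x \<in> X; a \<in> A\<rbrakk> \<Longrightarrow> v (PGen x a) = p x a"
    and q: "\<And>y b. \<lbrakk>y \<in> Y; b \<in> B\<rbrakk> \<Longrightarrow> v (QGen y b) = q y b"
  shows "(\<forall>s \<in> game_relators X Y A B lam. eval_poly D v s = \<zero>\<^bsub>D\<^esub>) \<longleftrightarrow>
    game_representation D n C V X Y A B lam p q"
proof -
  let ?G = "game_gens X Y A B"
  interpret cstar_evaluation D ?G v by (rule ev)
  have Pg: "PGen x a \<in> ?G \<longleftrightarrow> x \<in> X \<and> a \<in> A" and Qg: "QGen y b \<in> ?G \<longleftrightarrow> y \<in> Y \<and> b \<in> B" for x y a b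
    by (auto simp: game_gens_def)
  have pc: "p x a \<in> carrier D" if "x \<in> X" "a \<in> A" for x a
    using v[of "PGen x a"] p that by (simp add: Pg)
  have qc: "q y b \<in> carrier D" if "y \<in> Y" "b \<in> B" for y b
    using v[of "QGen y b"] q that by (simp add: Qg)
  have evp: "eval_poly D v (gen (PGen x a)) = p x a" if "x \<in> X" "a \<in> A" for x a
    using that p by (simp add: eval_gen Pg)
  have evq: "eval_poly D v (gen (QGen y b)) = q y b" if "y \<in> Y" "b \<in> B" for y b
    using that q by (simp add: eval_gen Qg)
  have Pf: "gen (PGen x a) \<in> free_star_alg ?G" if "x \<in> X" "a \<in> A" for x a
    using that by (intro free_gen) (simp add: Pg)
  have Qf: "gen (QGen y b) \<in> free_star_alg ?G" if "y \<in> Y" "b \<in> B" for y b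
    using that by (intro free_gen) (simp add: Qg)
  have proj: "(\<forall>s \<in> projection_relators ?G. eval_poly D v s = \<zero>) \<longleftrightarrow>
      (\<forall>x \<in> X. \<forall>a \<in> A. p x a \<in> projections) \<and> (\<forall>y \<in> Y. \<forall>b \<in> B. q y b \<in> projections)"
  proof -
    have "(\<forall>g \<in> ?G. v g \<in> projections) \<longleftrightarrow>
        (\<forall>x \<in> X. \<forall>a \<in> A. v (PGen x a) \<in> projections) \<and> (\<forall>y \<in> Y. \<forall>b \<in> B. v (QGen y b) \<in> projections)"
      unfolding game_gens_def by blast
    then show ?thesis by (simp add: projection_relators_vanish_iff p q)
  qed
  have psum: "eval_poly D v ((\<Sum>a\<in>A. gen (PGen x a)) - 1) = \<zero> \<longleftrightarrow> finsum D (p x) A = \<one>" if x: "x \<in> X" for x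
  proof -
    have "eval_poly D v (\<Sum>a\<in>A. gen (PGen x a)) = (\<Oplus>a\<in>A. eval_poly D v (gen (PGen x a)))"
      by (intro eval_sum Pf x)
    also have "\<dots> = finsum D (p x) A"
      using evp pc x by (intro finsum_cong') auto
    finally show ?thesis
      using pc x Pf by (simp add: eval_diff free_sum minus_eq_zero_iff finsum_closed Pi_iff)
  qed
  have qsum: "eval_poly D v ((\<Sum>b\<in>B. gen (QGen y b)) - 1) = \<zero> \<longleftrightarrow> finsum D (q y) B = \<one>" if y: "y \<in> Y" for y
  proof -
    have "eval_poly D v (\<Sum>b\<in>B. gen (QGen y b)) = (\<Oplus>b\<in>B. eval_poly D v (gen (QGen y b)))"
      by (intro eval_sum Qf y)
    also have "\<dots> = finsum D (q y) B"
      using evq qc y by (intro finsum_cong') auto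
    finally show ?thesis
      using qc y Qf by (simp add: eval_diff free_sum minus_eq_zero_iff finsum_closed Pi_iff)
  qed
  have orth: "eval_poly D v (gen (PGen x a) * gen (QGen y b)) = p x a \<otimes> q y b"
    if "x \<in> X" "y \<in> Y" "a \<in> A" "b \<in> B" for x y a b
    using that by (simp add: eval_mult Pf Qf evp evq)
  have "(\<forall>s \<in> game_relators X Y A B lam. eval_poly D v s = \<zero>) \<longleftrightarrow>
      (\<forall>s \<in> projection_relators ?G. eval_poly D v s = \<zero>) \<and>
      (\<forall>x \<in> X. eval_poly D v ((\<Sum>a\<in>A. gen (PGen x a)) - 1) = \<zero>) \<and>
      (\<forall>y \<in> Y. eval_poly D v ((\<Sum>b\<in>B. gen (QGen y b)) - 1) = \<zero>) \<and>
      (\<forall>x y a b. x \<in> X \<and> y \<in> Y \<and> a \<in> A \<and> b \<in> B \<and> \<not> lam x y a b \<longrightarrow>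
        eval_poly D v (gen (PGen x a) * gen (QGen y b)) = \<zero>)"
    unfolding game_relators_def by blast
  also have "\<dots> \<longleftrightarrow> game_representation D n C V X Y A B lam p q"
    unfolding game_representation_def game_representation_axioms_def proj
    using unital_cstar_algebra_axioms assignment_game_axioms psum qsum orth by auto
  finally show ?thesis .
qed

lemma assignment_prod_free:
  assumes "z \<in> X \<union> Y" "a \<in> tuples n C" "dom a = V z"
  shows "assignment_prod (V z) a \<in> free_star_alg (assignment_gens n C)"
proof -
  have "(i, the (a i)) \<in> assignment_gens n C" if "i \<in> V z" for i
    using that V_subset[OF assms(1)] tuple_value[OF assms(2)] assms(3)
    by (auto simp: assignment_gens_def)
  then show ?thesis
    unfolding assignment_prod_def using finite_V[OF assms(1)] by (intro free_prod_list) auto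
qed

lemma eval_assignment_prod:
  assumes "cstar_evaluation D (assignment_gens n C) v"
    and e: "\<And>i c. \<lbrakk>i \<in> {1..n}; c \<in> C\<rbrakk> \<Longrightarrow> v (i, c) = e i c"
    and z: "z \<in> X \<union> Y" "a \<in> tuples n C" "dom a = V z"
  shows "eval_poly D v (assignment_prod (V z) a) =
    monoid.list_prod D (map (\<lambda>i. e i (the (a i))) (sorted_list_of_set (V z)))"
proof -
  interpret cstar_evaluation D "assignment_gens n C" v by (rule assms(1))
  let ?l = "sorted_list_of_set (V z)"
  have l: "set ?l = V z" using finite_V[OF z(1)] by simp
  have a: "(i, the (a i)) \<in> assignment_gens n C" "v (i, the (a i)) = e i (the (a i))" if "i \<in> V z" for i
  proof -
    have "i \<in> {1..n}" "the (a i) \<in> C"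
      using that V_subset[OF z(1)] tuple_value[OF z(2)] z(3) by auto
    then show "(i, the (a i)) \<in> assignment_gens n C" "v (i, the (a i)) = e i (the (a i))"
      using e by (simp_all add: assignment_gens_def)
  qed
  have "set (map (\<lambda>i. gen (i, the (a i))) ?l) \<subseteq> free_star_alg (assignment_gens n C)"
    using a(1) l by auto
  moreover have "map (\<lambda>i. eval_poly D v (gen (i, the (a i)))) ?l = map (\<lambda>i. e i (the (a i))) ?l"
    using a l by (intro map_cong refl) (simp add: eval_gen)
  ultimately show ?thesis
    by (simp only: assignment_prod_def eval_prod_list map_map comp_def)
qed

lemma assignment_relators_vanish_iff:
  fixes D :: "('d, 'm) cstar_alg_scheme" (structure)
  assumes ev: "cstar_evaluation D (assignment_gens n C) v"
    and e: "\<And>i c. \<lbrakk>i \<in> {1..n}; c \<in> C\<rbrakk> \<Longrightarrow> v (i, c) = e i c"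
  shows "(\<forall>s \<in> assignment_relators n C V X Y lam. eval_poly D v s = \<zero>\<^bsub>D\<^esub>) \<longleftrightarrow>
    assignment_representation D n C V X Y A B lam e"
proof -
  let ?G = "assignment_gens n C"
  interpret cstar_evaluation D ?G v by (rule ev)
  have Eg: "(i, c) \<in> ?G \<longleftrightarrow> i \<in> {1..n} \<and> c \<in> C" for i c
    by (auto simp: assignment_gens_def)
  have ec: "e i c \<in> carrier D" if "i \<in> {1..n}" "c \<in> C" for i c
    using v[of "(i, c)"] e that by (simp add: Eg)
  have evg: "eval_poly D v (gen (i, c)) = e i c" if "i \<in> {1..n}" "c \<in> C" for i c
    using that e by (simp add: eval_gen Eg)
  have Ef: "gen (i, c) \<in> free_star_alg ?G" if "i \<in> {1..n}" "c \<in> C" for i c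
    using that by (intro free_gen) (simp add: Eg)
  have proj: "(\<forall>s \<in> projection_relators ?G. eval_poly D v s = \<zero>) \<longleftrightarrow>
      (\<forall>i \<in> {1..n}. \<forall>c \<in> C. e i c \<in> projections)"
    unfolding projection_relators_vanish_iff unfolding assignment_gens_def using e by auto
  have sum: "eval_poly D v ((\<Sum>c\<in>C. gen (i, c)) - 1) = \<zero> \<longleftrightarrow> finsum D (e i) C = \<one>" if i: "i \<in> {1..n}" for i
  proof -
    have "eval_poly D v (\<Sum>c\<in>C. gen (i, c)) = (\<Oplus>c\<in>C. eval_poly D v (gen (i, c)))"
      by (intro eval_sum Ef i)
    also have "\<dots> = finsum D (e i) C"
      using evg ec i by (intro finsum_cong') auto
    finally show ?thesis
      using ec[OF i] Ef[OF i] by (simp add: eval_diff free_sum minus_eq_zero_iff finsum_closed Pi_iff)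
  qed
  have comm: "eval_poly D v (gen (i, c) * gen (j, d) - gen (j, d) * gen (i, c)) = \<zero> \<longleftrightarrow>
      e i c \<otimes> e j d = e j d \<otimes> e i c" if "z \<in> X \<union> Y" "i \<in> V z" "j \<in> V z" "c \<in> C" "d \<in> C" for z i j c d
  proof -
    have "i \<in> {1..n}" "j \<in> {1..n}" using V_subset[OF that(1)] that by blast+
    then show ?thesis
      using that Ef ec by (simp add: eval_diff eval_mult evg minus_eq_zero_iff)
  qed
  have orth: "eval_poly D v (assignment_prod (V x) a * assignment_prod (V y) b) =
      list_prod (map (\<lambda>i. e i (the (a i))) (sorted_list_of_set (V x))) \<otimes>
      list_prod (map (\<lambda>i. e i (the (b i))) (sorted_list_of_set (V y)))"
    if "x \<in> X" "y \<in> Y" "dom a = V x" "ran a \<subseteq> C" "dom b = V y" "ran b \<subseteq> C" for x y a b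
  proof -
    have ab: "a \<in> tuples n C" "b \<in> tuples n C" using tuples_dom that by auto
    note a = eval_assignment_prod[OF ev e, of x a] and b = eval_assignment_prod[OF ev e, of y b]
    show ?thesis
      using that a b ab assignment_prod_free by (simp add: eval_mult)
  qed
  have "(\<forall>s \<in> assignment_relators n C V X Y lam. eval_poly D v s = \<zero>) \<longleftrightarrow>
      (\<forall>s \<in> projection_relators ?G. eval_poly D v s = \<zero>) \<and>
      (\<forall>i \<in> {1..n}. eval_poly D v ((\<Sum>c\<in>C. gen (i, c)) - 1) = \<zero>) \<and>
      (\<forall>i j c d. c \<in> C \<and> d \<in> C \<and> (\<exists>z \<in> X \<union> Y. i \<in> V z \<and> j \<in> V z) \<longrightarrow>
        eval_poly D v (gen (i, c) * gen (j, d) - gen (j, d) * gen (i, c)) = \<zero>) \<and>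
      (\<forall>x y a b. x \<in> X \<and> y \<in> Y \<and> dom a = V x \<and> ran a \<subseteq> C \<and> dom b = V y \<and> ran b \<subseteq> C \<and> \<not> lam x y a b \<longrightarrow>
        eval_poly D v (assignment_prod (V x) a * assignment_prod (V y) b) = \<zero>)"
    unfolding assignment_relators_def by blast
  also have "\<dots> \<longleftrightarrow> (\<forall>i \<in> {1..n}. \<forall>c \<in> C. e i c \<in> projections) \<and>
      (\<forall>i \<in> {1..n}. finsum D (e i) C = \<one>) \<and>
      (\<forall>z i j c d. z \<in> X \<union> Y \<and> i \<in> V z \<and> j \<in> V z \<and> c \<in> C \<and> d \<in> C \<longrightarrow> e i c \<otimes> e j d = e j d \<otimes> e i c) \<and>
      (\<forall>x y a b. x \<in> X \<and> y \<in> Y \<and> dom a = V x \<and> ran a \<subseteq> C \<and> dom b = V y \<and> ran b \<subseteq> C \<and> \<not> lam x y a b \<longrightarrow>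
        list_prod (map (\<lambda>i. e i (the (a i))) (sorted_list_of_set (V x))) \<otimes>
        list_prod (map (\<lambda>i. e i (the (b i))) (sorted_list_of_set (V y))) = \<zero>)"
    (is "_ \<longleftrightarrow> ?proj \<and> ?sum \<and> ?comm \<and> ?orth")
  proof (intro arg_cong2[where f = "(\<and>)"] proj)
    show "(\<forall>i \<in> {1..n}. eval_poly D v ((\<Sum>c\<in>C. gen (i, c)) - 1) = \<zero>) \<longleftrightarrow> ?sum"
      using sum by blast
    show "(\<forall>i j c d. c \<in> C \<and> d \<in> C \<and> (\<exists>z \<in> X \<union> Y. i \<in> V z \<and> j \<in> V z) \<longrightarrow>
        eval_poly D v (gen (i, c) * gen (j, d) - gen (j, d) * gen (i, c)) = \<zero>) \<longleftrightarrow> ?comm"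
      using comm by metis
  next
    show "(\<forall>x y a b. x \<in> X \<and> y \<in> Y \<and> dom a = V x \<and> ran a \<subseteq> C \<and> dom b = V y \<and> ran b \<subseteq> C \<and> \<not> lam x y a b \<longrightarrow>
        eval_poly D v (assignment_prod (V x) a * assignment_prod (V y) b) = \<zero>) \<longleftrightarrow> ?orth"
      using orth by (intro iff_allI imp_cong refl) simp
  qed
  also have "\<dots> \<longleftrightarrow> assignment_representation D n C V X Y A B lam e"
    unfolding assignment_representation_def assignment_representation_axioms_def
    using unital_cstar_algebra_axioms assignment_game_axioms by blast
  finally show ?thesis .
qed

end

section \<open>Passing between the two kinds of representation\<close>

text \<open>Commutation is required also for variables that occur together only in a question to the second
  player; there the diagonal family is that player's.\<close>

lemma (in game_representation) assignment_representation:
  "assignment_representation D n C V X Y A B lam e"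
proof (intro assignment_representation.intro assignment_representation_axioms.intro
    unital_cstar_algebra_axioms assignment_game_axioms)
  fix i assume i: "i \<in> {1..n}"
  then have x: "question i \<in> X" "i \<in> V (question i)" using question by auto
  note diag = p_diagonal[OF x(1)]
  show "finsum D (e i) C = \<one>" by (rule diagonal_family.e_sum[OF diag x(2)])
  show "e i c \<in> projections" if "c \<in> C" for c
    using diagonal_family.e_idempotent[OF diag x(2) that] e_closed[OF i] e_adj[OF i]
    by (simp add: projections_def)
next
  fix z i j c d assume "z \<in> X \<union> Y" and ij: "i \<in> V z" "j \<in> V z" "c \<in> C" "d \<in> C"
  then consider "z \<in> X" | "z \<in> Y" by blast
  then show "e i c \<otimes> e j d = e j d \<otimes> e i c"
  proof cases
    case 1
    show ?thesis by (rule diagonal_family.e_commute[OF p_diagonal[OF 1] ij(1,3,2,4)])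
  next
    case 2
    show ?thesis by (rule diagonal_family.e_commute[OF q_diagonal[OF 2] ij(1,3,2,4)])
  qed
next
  fix x y a b
  assume xy: "x \<in> X" "y \<in> Y" and a: "dom a = V x" "ran a \<subseteq> C" and b: "dom b = V y" "ran b \<subseteq> C"
    and lam: "\<not> lam x y a b"
  have "a \<in> A" "b \<in> B" using tuples_dom a b xy by (auto simp: A_eq B_eq)
  then show "list_prod (map (\<lambda>i. e i (the (a i))) (sorted_list_of_set (V x))) \<otimes>
      list_prod (map (\<lambda>i. e i (the (b i))) (sorted_list_of_set (V y))) = \<zero>"
    using p_q xy lam a b by (simp add: p_eq_list_prod q_eq_list_prod)
qed

lemma (in assignment_representation) game_representation:
  "game_representation D n C V X Y A B lam answer answer"
  using answer_proj answer_sum answer_orth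
  by (intro game_representation.intro game_representation_axioms.intro
    unital_cstar_algebra_axioms assignment_game_axioms) (auto simp: A_eq B_eq)

section \<open>The isomorphism\<close>

text \<open>Evaluated in a representation of the respective other presentation, \<open>answer_poly\<close> gives the
  elements \<open>answer z a\<close>, and \<open>value_poly\<close> gives the marginals \<open>e i c\<close>.\<close>

fun answer_poly ::
  "('q \<Rightarrow> nat set) \<Rightarrow> ('q, 'q, nat \<rightharpoonup> 'c, nat \<rightharpoonup> 'c) game_gen \<Rightarrow> (nat \<times> 'c) star_poly" where
  "answer_poly V (PGen x a) = (if dom a = V x then assignment_prod (V x) a else 0)"
| "answer_poly V (QGen y b) = (if dom b = V y then assignment_prod (V y) b else 0)"

context assignment_game
begin

fun value_poly :: "nat \<times> 'c \<Rightarrow> ('q, 'q, nat \<rightharpoonup> 'c, nat \<rightharpoonup> 'c) game_gen star_poly" where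
  "value_poly (i, c) = (\<Sum>a\<in>{a \<in> A. a i = Some c}. gen (PGen (question i) a))"

lemma value_poly_free:
  assumes "h \<in> assignment_gens n C"
  shows "value_poly h \<in> free_star_alg (game_gens X Y A B)"
  using assms question
  by (auto simp: assignment_gens_def game_gens_def intro!: free_sum free_gen)

lemma eval_value_poly:
  assumes "cstar_evaluation D (game_gens X Y A B) v"
    and "\<And>x a. \<lbrakk>x \<in> X; a \<in> A\<rbrakk> \<Longrightarrow> v (PGen x a) = p x a" and i: "i \<in> {1..n}"
  shows "eval_poly D v (value_poly (i, c)) = ring.marginal D A (p (question i)) i c"
proof -
  interpret cstar_evaluation D "game_gens X Y A B" v by (rule assms(1))
  have x: "question i \<in> X" using question i by blast
  have g: "PGen (question i) a \<in> game_gens X Y A B" if "a \<in> A" for a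
    using that x by (auto simp: game_gens_def)
  have "eval_poly D v (value_poly (i, c))
      = (\<Oplus>\<^bsub>D\<^esub>a\<in>{a \<in> A. a i = Some c}. eval_poly D v (gen (PGen (question i) a)))"
    unfolding value_poly.simps using g by (intro eval_sum) auto
  also have "\<dots> = marginal A (p (question i)) i c"
    unfolding marginal_def
  proof (rule finsum_cong'[OF refl])
    have p: "p (question i) a = v (PGen (question i) a)" if "a \<in> A" for a
      using assms(2)[OF x that] by simp
    then show "p (question i) \<in> {a \<in> A. a i = Some c} \<rightarrow> carrier D" using v g by simp
    show "eval_poly D v (gen (PGen (question i) a)) = p (question i) a" if "a \<in> {a \<in> A. a i = Some c}" for a
      using that p g by (simp add: eval_gen)
  qed
  finally show ?thesis .
qed

lemma answer_poly_free:
  assumes "g \<in> game_gens X Y A B"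
  shows "answer_poly V g \<in> free_star_alg (assignment_gens n C)"
  using assms assignment_prod_free by (auto simp: game_gens_def A_eq B_eq)

lemma (in assignment_representation) eval_answer_poly:
  assumes ev: "cstar_evaluation D (assignment_gens n C) v"
    and e: "\<And>i c. \<lbrakk>i \<in> {1..n}; c \<in> C\<rbrakk> \<Longrightarrow> v (i, c) = e i c"
  shows "\<lbrakk>x \<in> X; a \<in> A\<rbrakk> \<Longrightarrow> eval_poly D v (answer_poly V (PGen x a)) = answer x a"
    and "\<lbrakk>y \<in> Y; b \<in> B\<rbrakk> \<Longrightarrow> eval_poly D v (answer_poly V (QGen y b)) = answer y b"
proof -
  interpret ev: cstar_evaluation D "assignment_gens n C" v by (rule ev)
  show "\<lbrakk>x \<in> X; a \<in> A\<rbrakk> \<Longrightarrow> eval_poly D v (answer_poly V (PGen x a)) = answer x a"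
    "\<lbrakk>y \<in> Y; b \<in> B\<rbrakk> \<Longrightarrow> eval_poly D v (answer_poly V (QGen y b)) = answer y b"
    using eval_assignment_prod[OF ev e] by (simp_all add: answer_def A_eq B_eq)
qed

end

theorem proposition4p9:
  fixes n :: nat and C :: "'c set" and V :: "'q \<Rightarrow> nat set" and X Y :: "'q set"
    and A B :: "(nat \<rightharpoonup> 'c) set"
    and lam :: "'q \<Rightarrow> 'q \<Rightarrow> (nat \<rightharpoonup> 'c) \<Rightarrow> (nat \<rightharpoonup> 'c) \<Rightarrow> bool"
  assumes "variable_assignment_game n C V X Y A B lam"
  shows "game_cstar X Y A B lam \<cong>\<^sub>*
    universal_cstar (assignment_gens n C) (assignment_relators n C V X Y lam)"
proof -
  interpret assignment_game n C V X Y A B lam by unfold_locales (rule assms)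
  let ?G = "game_gens X Y A B" and ?R = "game_relators X Y A B lam"
  let ?H = "assignment_gens n C" and ?S = "assignment_relators n C V X Y lam"
  let ?U = "universal_cstar ?G ?R" and ?U' = "universal_cstar ?H ?S"
  let ?v = "universal_gen ?G ?R" and ?v' = "universal_gen ?H ?S"
  let ?w = "\<lambda>h. eval_poly ?U ?v (value_poly h)" and ?w' = "\<lambda>g. eval_poly ?U' ?v' (answer_poly V g)"
  note R = game_presentation[of X Y A B lam] and S = assignment_presentation[of X Y V n C lam, OF V_subset]
  note U = universal_cstar_algebra[OF R(1)] and U' = universal_cstar_algebra[OF S(1)]
  have v: "cstar_evaluation ?U ?G ?v"
    by (intro cstar_evaluation.intro[OF U] cstar_evaluation_axioms.intro universal_gen_closed[OF R(1)])
  have v': "cstar_evaluation ?U' ?H ?v'"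
    by (intro cstar_evaluation.intro[OF U'] cstar_evaluation_axioms.intro universal_gen_closed[OF S(1)])
  have w: "cstar_evaluation ?U ?H ?w"
    by (intro cstar_evaluation.intro[OF U] cstar_evaluation_axioms.intro
        cstar_evaluation.eval_closed[OF v] value_poly_free)
  have w': "cstar_evaluation ?U' ?G ?w'"
    by (intro cstar_evaluation.intro[OF U'] cstar_evaluation_axioms.intro
        cstar_evaluation.eval_closed[OF v'] answer_poly_free)
  define p where "p x a = ?v (PGen x a)" for x a
  define q where "q y b = ?v (QGen y b)" for y b
  interpret P: game_representation ?U n C V X Y A B lam p q
    using game_relators_vanish_iff[OF v, of p q] universal_relations[OF R] by (simp add: p_def q_def)
  have we: "?w (i, c) = P.e i c" if "i \<in> {1..n}" for i c
    unfolding P.e_def by (rule eval_value_poly[OF v _ that]) (simp add: p_def)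
  interpret PE: assignment_representation ?U n C V X Y A B lam P.e
    by (rule P.assignment_representation)
  define e where "e i c = ?v' (i, c)" for i c
  interpret E: assignment_representation ?U' n C V X Y A B lam e
    using assignment_relators_vanish_iff[OF v', of e] universal_relations[OF S] by (simp add: e_def)
  have wr: "?w' (PGen x a) = E.answer x a" if "x \<in> X" "a \<in> A" for x a
    by (rule E.eval_answer_poly(1)[OF v' _ that]) (simp add: e_def)
  have wr': "?w' (QGen y b) = E.answer y b" if "y \<in> Y" "b \<in> B" for y b
    by (rule E.eval_answer_poly(2)[OF v' _ that]) (simp add: e_def)
  have "?U \<cong>\<^sub>* ?U'"
  proof (rule universal_cstar_isomorphic[OF R(1) S(1), where F = "answer_poly V" and F' = value_poly])
    show "eval_poly ?U' ?w' s = \<zero>\<^bsub>?U'\<^esub>" if "s \<in> ?R" for s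
      using game_relators_vanish_iff[OF w' wr wr'] E.game_representation that by blast
    show "eval_poly ?U ?w s = \<zero>\<^bsub>?U\<^esub>" if "s \<in> ?S" for s
      using assignment_relators_vanish_iff[OF w we] P.assignment_representation that by blast
    show "eval_poly ?U ?w (answer_poly V g) = ?v g" if g: "g \<in> ?G" for g
    proof -
      consider x a where "g = PGen x a" "x \<in> X" "a \<in> A" | y b where "g = QGen y b" "y \<in> Y" "b \<in> B"
        using g unfolding game_gens_def by blast
      then show ?thesis
      proof cases
        case 1
        then have "eval_poly ?U ?w (answer_poly V g) = PE.answer x a"
          using PE.eval_answer_poly(1)[OF w we] by simp
        also have "\<dots> = p x a"
          using 1 P.p_eq_list_prod P.p_wrong_dom by (simp add: PE.answer_def)
        finally show ?thesis using 1 by (simp add: p_def)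
      next
        case 2
        then have "eval_poly ?U ?w (answer_poly V g) = PE.answer y b"
          using PE.eval_answer_poly(2)[OF w we] by simp
        also have "\<dots> = q y b"
          using 2 P.q_eq_list_prod P.q_wrong_dom by (simp add: PE.answer_def)
        finally show ?thesis using 2 by (simp add: q_def)
      qed
    qed
    show "eval_poly ?U' ?w' (value_poly h) = ?v' h" if h_in: "h \<in> ?H" for h
    proof -
      obtain i c where h: "h = (i, c)" "i \<in> {1..n}" "c \<in> C"
        using h_in by (auto simp: assignment_gens_def)
      have "eval_poly ?U' ?w' (value_poly h) = E.marginal A (E.answer (question i)) i c"
        unfolding h(1) by (rule eval_value_poly[OF w' wr h(2)])
      also have "\<dots> = e i c"
        using E.answer_marginal[of "question i" i c] question[OF h(2)] h(3) by (simp add: A_eq)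
      finally show ?thesis using h(1) by (simp add: e_def)
    qed
  qed (use answer_poly_free value_poly_free in auto)
  then show ?thesis by (simp add: game_cstar_def)
qed

end
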